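(* Let $S=K[x_1,\dots,x_n]$ be a polynomial ring over a field $K$, $m=(x_1,\dots,x_n)$, and let $I=\bigcap_{i=1}^s P_i\subset S$ be a squarefree monomial ideal, where $P_1,\dots,P_s$ are the (distinct) minimal monomial prime ideals of $S/I$. Suppose that $\sum_{i=1}^s P_i=m$, $\operatorname{bigsize}(I)=2$ and $q(I)>1$. Then $\operatorname{depth}_S I=2+q(I)>3$ if and only if the graph associated to $I$ is a concatenation of several graphs on two vertices having no edges.
   Context: Depth is taken with respect to $m$. The bigsize of a squarefree monomial ideal $I$ with minimal primes $P_1,\dots,P_s$ is $t+(n-h)-1$, where $h$ is the height of $\sum_{j=1}^sP_j$ and $t$ is the minimal number $e$ such that for all integers $1\le i_1<\dots<i_e\le s$ one has $\sum_{k=1}^eP_{i_k}=\sum_{j=1}^sP_j$. Set $q(I)=\min\{\dim S/(P_i+P_j): j\neq i,\ P_i+P_j\ne m\}$. The graph associated to $I$ is the simple graph $\Gamma$ on $[s]=\{1,\dots,s\}$ in which $\{i,j\}$ ($i\ne j$) is an edge if and only if $P_i+P_j=m$. Concatenation: let $\Gamma_1$ be a graph on $\{1,\dots,r\}$ and $\Gamma_2$ a graph on $\{r,r+1,\dots,s\}$, with $1<r<s$. The concatenation of $\Gamma_1,\Gamma_2$ in the vertex $r$ is the graph on $[s]$ with edge set $E(\Gamma_1)\cup E(\Gamma_2)\cup\{\{i,j\}: 1\le i<r,\ r<j\le s\}$. Graphs are considered up to renumbering of vertices. A graph is a concatenation of several graphs on two vertices having no edges if it can be obtained, starting from edgeless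 graphs on two vertices, by repeatedly forming concatenations (in arbitrary vertices, after renumbering). *)

theory Defs
  imports
    "HOL-Library.Poly_Mapping"
    "HOL-Library.Extended_Nat"
    "HOL-Library.Cardinality"
    "HOL-Algebra.Algebraic_Closure_Type"
begin

section \<open>Prime ideals, Krull dimension, height\<close>

definition minimal_primes :: "('a, 'b) ring_scheme \<Rightarrow> 'a set \<Rightarrow> 'a set set" where
  "minimal_primes R I =
     {P. primeideal P R \<and> I \<subseteq> P \<and> (\<forall>Q. primeideal Q R \<and> I \<subseteq> Q \<and> Q \<subseteq> P \<longrightarrow> Q = P)}"

text \<open>\<open>prime_chain R p d\<close>: \<open>p 0 \<subset> p 1 \<subset> \<dots> \<subset> p d\<close> are prime ideals; the values of \<open>p\<close> beyond \<open>d\<close>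
  are irrelevant.\<close>

definition prime_chain :: "('a, 'b) ring_scheme \<Rightarrow> (nat \<Rightarrow> 'a set) \<Rightarrow> nat \<Rightarrow> bool" where
  "prime_chain R p d \<longleftrightarrow> (\<forall>i\<le>d. primeideal (p i) R) \<and> (\<forall>i<d. p i \<subset> p (Suc i))"

text \<open>The zero ring gets dimension 0 here, since a supremum of an empty set in \<open>enat\<close> is 0.\<close>

definition krull_dim :: "('a, 'b) ring_scheme \<Rightarrow> enat" where
  "krull_dim R = Sup {enat d | d p. prime_chain R p d}"

definition prime_height :: "('a, 'b) ring_scheme \<Rightarrow> 'a set \<Rightarrow> enat" where
  "prime_height R P = Sup {enat d | d p. prime_chain R p d \<and> p d = P}"

definition ideal_height :: "('a, 'b) ring_scheme \<Rightarrow> 'a set \<Rightarrow> enat" where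
  "ideal_height R J = Inf {prime_height R P | P. primeideal P R \<and> J \<subseteq> P}"

definition ideal_sum :: "('a, 'b) ring_scheme \<Rightarrow> 'a set set \<Rightarrow> 'a set" where
  "ideal_sum R \<P> = Idl\<^bsub>R\<^esub> (\<Union>\<P>)"


section \<open>Depth of a module with respect to an ideal\<close>

definition ideal_smult :: "('a, 'b) ring_scheme \<Rightarrow> 'a set \<Rightarrow> ('a, 'c, 'd) module_scheme \<Rightarrow> 'c set" where
  "ideal_smult R J M = \<Inter>{N. submodule N R M \<and> (\<forall>a\<in>J. \<forall>x\<in>carrier M. a \<odot>\<^bsub>M\<^esub> x \<in> N)}"

text \<open>\<open>f\<^sub>1, \<dots>, f\<^sub>d\<close> is \<open>M\<close>-regular if \<open>f\<^sub>i\<close> is a nonzerodivisor on \<open>M / (f\<^sub>1, \<dots>, f\<^bsub>i-1\<^esub>) M\<close>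
  for all \<open>i\<close>, and \<open>(f\<^sub>1, \<dots>, f\<^sub>d) M \<noteq> M\<close>. The list is indexed from 0.\<close>

definition regular_seq :: "('a, 'b) ring_scheme \<Rightarrow> ('a, 'c, 'd) module_scheme \<Rightarrow> 'a list \<Rightarrow> bool" where
  "regular_seq R M fs \<longleftrightarrow>
     set fs \<subseteq> carrier R \<and>
     (\<forall>i<length fs. \<forall>x\<in>carrier M.
        fs ! i \<odot>\<^bsub>M\<^esub> x \<in> ideal_smult R (Idl\<^bsub>R\<^esub> (set (take i fs))) M \<longrightarrow>
        x \<in> ideal_smult R (Idl\<^bsub>R\<^esub> (set (take i fs))) M) \<and>
     ideal_smult R (Idl\<^bsub>R\<^esub> (set fs)) M \<noteq> carrier M"

definition depth :: "('a, 'b) ring_scheme \<Rightarrow> 'a set \<Rightarrow> ('a, 'c, 'd) module_scheme \<Rightarrow> enat" where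
  "depth R J M = Sup {enat (length fs) | fs. set fs \<subseteq> J \<and> regular_seq R M fs}"

text \<open>The module record extends the ring record, so the fields \<open>mult\<close> and \<open>one\<close> have to be
  filled although they play no role.\<close>

definition ideal_as_module :: "('a, 'b) ring_scheme \<Rightarrow> 'a set \<Rightarrow> ('a, 'a) module" where
  "ideal_as_module R I =
     \<lparr>carrier = I, monoid.mult = monoid.mult R, one = one R, zero = zero R, add = add R,
      module.smult = monoid.mult R\<rparr>"


section \<open>The polynomial ring and squarefree monomial ideals\<close>

text \<open>\<open>K[x\<^sub>1, \<dots>, x\<^sub>n]\<close> with variables indexed by a finite type \<open>'n\<close>, so \<open>n = CARD('n)\<close>: a polynomial
  maps an exponent vector to its coefficient.\<close>

type_synonym ('n, 'k) mpoly = "('n \<Rightarrow>\<^sub>0 nat) \<Rightarrow>\<^sub>0 'k"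

definition mpoly_ring :: "('n::finite, 'k::field) mpoly ring" where
  "mpoly_ring = ring_of_type_algebra"

definition monomial :: "('n::finite \<Rightarrow>\<^sub>0 nat) \<Rightarrow> ('n, 'k::field) mpoly" where
  "monomial a = Poly_Mapping.single a 1"

definition var :: "'n::finite \<Rightarrow> ('n, 'k::field) mpoly" where
  "var i = monomial (Poly_Mapping.single i 1)"

definition max_ideal :: "('n::finite, 'k::field) mpoly set" where
  "max_ideal = Idl\<^bsub>mpoly_ring\<^esub> (range var)"

definition squarefree_monomial_ideal :: "('n::finite, 'k::field) mpoly set \<Rightarrow> bool" where
  "squarefree_monomial_ideal I \<longleftrightarrow>
     (\<exists>A. (\<forall>a\<in>A. \<forall>i. Poly_Mapping.lookup a i \<le> 1) \<and> I = Idl\<^bsub>mpoly_ring\<^esub> (monomial ` A))"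

text \<open>Choosing indices \<open>i\<^sub>1 < \<dots> < i\<^sub>e\<close> amounts to choosing an \<open>e\<close>-element set of minimal
  primes, as the \<open>P\<^sub>i\<close> are distinct. The subtractions in \<open>enat\<close> do not truncate: the height of a
  proper ideal is at most \<open>n\<close>, and \<open>e \<ge> 1\<close>.\<close>

definition bigsize :: "('n::finite, 'k::field) mpoly set \<Rightarrow> enat" where
  "bigsize I =
     (let \<P> = minimal_primes mpoly_ring I;
          h = ideal_height mpoly_ring (ideal_sum mpoly_ring \<P>);
          t = (LEAST e. 1 \<le> e \<and>
                 (\<forall>\<A>\<subseteq>\<P>. card \<A> = e \<longrightarrow> ideal_sum mpoly_ring \<A> = ideal_sum mpoly_ring \<P>))
      in enat t + (enat CARD('n) - h) - 1)"

definition q_inv :: "('n::finite, 'k::field) mpoly set \<Rightarrow> enat" where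
  "q_inv I =
     Inf {krull_dim (mpoly_ring Quot (P <+>\<^bsub>mpoly_ring\<^esub> Q)) | P Q.
            P \<in> minimal_primes mpoly_ring I \<and> Q \<in> minimal_primes mpoly_ring I \<and>
            P \<noteq> Q \<and> P <+>\<^bsub>mpoly_ring\<^esub> Q \<noteq> max_ideal}"


section \<open>Graphs and concatenation\<close>

text \<open>A simple graph is a pair of a vertex set and a set of two-element sets of vertices.\<close>

type_synonym ugraph = "nat set \<times> nat set set"

definition assoc_graph :: "(nat \<Rightarrow> ('n::finite, 'k::field) mpoly set) \<Rightarrow> nat \<Rightarrow> ugraph" where
  "assoc_graph P s =
     ({1..s}, {{i, j} | i j. i \<in> {1..s} \<and> j \<in> {1..s} \<and> i \<noteq> j \<and>
                             P i <+>\<^bsub>mpoly_ring\<^esub> P j = max_ideal})"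

definition concat_edges :: "nat \<Rightarrow> nat \<Rightarrow> nat set set \<Rightarrow> nat set set \<Rightarrow> nat set set" where
  "concat_edges r s E1 E2 = E1 \<union> E2 \<union> {{i, j} | i j. 1 \<le> i \<and> i < r \<and> r < j \<and> j \<le> s}"

text \<open>Closure under graph isomorphism (\<open>renumber\<close>) makes concatenation possible in arbitrary
  vertices, and either operand may itself be a concatenation.\<close>

inductive concat_of_edgeless :: "ugraph \<Rightarrow> bool" where
  edgeless: "concat_of_edgeless ({1, 2}, {})"
| concat: "\<lbrakk>1 < r; r < s; concat_of_edgeless ({1..r}, E1); concat_of_edgeless ({r..s}, E2)\<rbrakk>
    \<Longrightarrow> concat_of_edgeless ({1..s}, concat_edges r s E1 E2)"
| renumber: "\<lbrakk>concat_of_edgeless (V, E); bij_betw f V W\<rbrakk>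
    \<Longrightarrow> concat_of_edgeless (W, (`) f ` E)"

end

theory Submission
  imports Defs
begin

text \<open>
  Write \<open>P i\<close> as the ideal generated by the variables outside a set \<open>G i\<close>. The sets \<open>G i\<close> are the facets
  of the simplicial complex of \<open>I\<close>. The sum \<open>P i + P j\<close> is generated by the variables outside
  \<open>G i \<inter> G j\<close>, so \<open>S / (P i + P j)\<close> has dimension \<open>card (G i \<inter> G j)\<close>, and edges of the
  graph of \<open>I\<close> are pairs of disjoint facets. Since the \<open>P i\<close> sum up to the maximal ideal, bigsize 2 says that
  three different facets never have a common vertex, while some two do. The number \<open>q\<close> is the
  least size of a nonempty intersection of two facets.

  Let \<open>H\<close> be the graph of meeting facets, the complement of the graph of \<open>I\<close>. On complements, a
  concatenation glues two graphs at one vertex, so the concatenations of edgeless graphs on two vertices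
  are the graphs whose complement is a tree with at least two vertices (\<open>concat_of_edgeless_imp_tree\<close>,
  \<open>tree_imp_concat_of_edgeless\<close>). It remains to show that \<open>I\<close> has depth \<open>q + 2\<close> if and only if \<open>H\<close> is a
  tree (\<open>depth_facet_ideal_iff_tree\<close>). As the complex has the homotopy type of \<open>H\<close>, and the links of its
  nonempty faces are simplices or unions of two simplices, this is what Hochster's formula predicts; the proof below
  makes both bounds explicit.

  Upper bounds come from Koszul cohomology. If a sequence of length \<open>d\<close> in the maximal ideal is regular on
  \<open>I\<close>, then Koszul cocycles with values in \<open>I\<close> and degree less than \<open>d\<close> are boundaries
  (\<open>koszul_cocycle_is_boundary\<close>). Hence a cocycle of degree \<open>e\<close> that is not a boundary bounds the
  depth by \<open>e\<close>. Two kinds of cocycles suffice. If the facets fall into two groups such that facets of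
  different groups meet only inside a set \<open>C\<close>, there is one of degree \<open>card C + 2\<close>
  (\<open>regular_length_le_separation\<close>); it is used with \<open>C\<close> empty if \<open>H\<close> is disconnected, and with \<open>C\<close> a smallest
  nonempty intersection of two facets if \<open>H\<close> is a tree, where every edge is a bridge. If \<open>H\<close> has a cycle, there is
  one of degree 3 (\<open>regular_length_le_cycle\<close>), and \<open>3 < q + 2\<close>.

  The lower bound for a tree comes from the construction of a regular sequence (\<open>tree_regular_sequence\<close>). A tree grows by
  adding leaves, and for a leaf \<open>x\<close> attached at \<open>y\<close> the ideal of the older facets and \<open>P x\<close> have the sum
  \<open>P y + P x\<close>. The exact sequence of an intersection then adds one element to a sequence of length \<open>q\<close>
  that is regular modulo all sums \<open>P y + P x\<close> (\<open>regular_mod_Int\<close>), and passing from \<open>S / I\<close> to \<open>I\<close> adds another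
  one (\<open>regular_on_ideal\<close>). Sums of variables according to a vertex colouring supply the first \<open>q\<close> elements.

  The Krull dimension of a polynomial ring is computed from the definition, by an elementary
  argument on algebraic relations along a chain of primes (\<open>krull_dim_Quot_var_ideal\<close>).
\<close>

section \<open>Trees and concatenations\<close>

text \<open>
  Trees are handled through the order in which their leaves can be attached. The starting set \<open>S\<close> is
  a parameter so that one construction can continue another, which is what gluing two trees at a
  vertex amounts to.
\<close>
inductive grows :: "('a \<Rightarrow> 'a \<Rightarrow> bool) \<Rightarrow> 'a set \<Rightarrow> 'a set \<Rightarrow> bool" for adj S where
  start: "grows adj S S"
| leaf: "\<lbrakk>grows adj S V; x \<notin> V; y \<in> V; adj x y; \<And>z. z \<in> V \<Longrightarrow> adj x z \<Longrightarrow> z = y\<rbrakk>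
    \<Longrightarrow> grows adj S (insert x V)"

definition tree_on :: "('a \<Rightarrow> 'a \<Rightarrow> bool) \<Rightarrow> 'a set \<Rightarrow> bool" where
  "tree_on adj V \<longleftrightarrow> (\<exists>r\<in>V. grows adj {r} V)"

lemma grows_subset: "grows adj S V \<Longrightarrow> S \<subseteq> V"
  by (induction rule: grows.induct) auto

lemma grows_finite: "grows adj S V \<Longrightarrow> finite S \<Longrightarrow> finite V"
  by (induction rule: grows.induct) auto

lemma grows_trans:
  assumes "grows adj T V" "grows adj S T"
  shows "grows adj S V"
  using assms
proof (induction rule: grows.induct)
  case (leaf V x y)
  show ?case
    by (rule grows.leaf[OF leaf.IH[OF leaf.prems] leaf.hyps(2-4)]) (rule leaf.hyps(5))
qed

text \<open>
  The vertices of \<open>T\<close> not adjacent to anything that is attached later can be present from the start.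
\<close>
lemma grows_union:
  assumes "grows adj S V" "\<And>x t. x \<in> V - S \<Longrightarrow> x \<notin> T \<and> (t \<in> T - S \<longrightarrow> \<not> adj x t)"
  shows "grows adj (S \<union> T) (V \<union> T)"
  using assms
proof (induction rule: grows.induct)
  case start
  show ?case by (rule grows.start)
next
  case (leaf V x y)
  have xS: "x \<notin> S" using leaf.hyps(2) grows_subset[OF leaf.hyps(1)] by blast
  have g: "grows adj (S \<union> T) (V \<union> T)" by (rule leaf.IH) (use leaf.prems in blast)
  have "grows adj (S \<union> T) (insert x (V \<union> T))"
  proof (rule grows.leaf[OF g, of x y])
    show "x \<notin> V \<union> T" using leaf.hyps(2) leaf.prems[of x] xS by blast
    show "z = y" if "z \<in> V \<union> T" "adj x z" for z
      using that leaf.hyps(5)[of z] leaf.prems[of x z] xS grows_subset[OF leaf.hyps(1)] by blast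
  qed (use leaf.hyps(3,4) in auto)
  then show ?case by simp
qed

text \<open>
  If the new root is the last leaf \<open>x\<close>, attached at \<open>y\<close>, then start with \<open>x\<close>, attach \<open>y\<close>, and
  continue as for the smaller tree grown from \<open>y\<close>; the later vertices do not see \<open>x\<close>.
\<close>
lemma grows_reroot:
  assumes "grows adj {r} V" "symp adj" "s \<in> V"
  shows "grows adj {s} V"
  using assms(1,3)
proof (induction arbitrary: s rule: grows.induct)
  case start
  then show ?case by (auto intro: grows.start)
next
  case (leaf V x y)
  show ?case
  proof (cases "s = x")
    case False
    then have "grows adj {s} V" using leaf.IH leaf.prems by blast
    then show ?thesis by (rule grows.leaf[where V = V and y = y]) (fact leaf.hyps)+
  next
    case True
    have sym: "adj a b \<Longrightarrow> adj b a" for a b using assms(2) by (auto simp: symp_def)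
    have "grows adj ({y} \<union> {x}) (V \<union> {x})"
      using leaf.IH[OF leaf.hyps(3)] leaf.hyps(2,5) sym by (intro grows_union) blast+
    moreover have "grows adj {x} (insert y {x})"
      using leaf.hyps(2,3) sym[OF leaf.hyps(4)] by (intro grows.leaf[of adj "{x}" "{x}" y x] grows.start) auto
    ultimately show ?thesis using True by (auto intro: grows_trans simp: insert_commute)
  qed
qed

lemma grows_map:
  assumes "grows adj S V" "inj_on f V"
    and "\<And>x y. x \<in> V \<Longrightarrow> y \<in> V \<Longrightarrow> adj' (f x) (f y) \<longleftrightarrow> adj x y"
  shows "grows adj' (f ` S) (f ` V)"
  using assms
proof (induction rule: grows.induct)
  case start
  show ?case by (rule grows.start)
next
  case (leaf V x y)
  have "grows adj' (f ` S) (f ` V)" using leaf.prems by (intro leaf.IH) auto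
  then have "grows adj' (f ` S) (insert (f x) (f ` V))"
  proof (rule grows.leaf[where y = "f y"])
    show "f x \<notin> f ` V" using leaf.prems(1) leaf.hyps(2) by auto
    show "adj' (f x) (f y)" using leaf.prems(2) leaf.hyps(3,4) by blast
    show "z = f y" if "z \<in> f ` V" "adj' (f x) z" for z
      using that leaf.prems(2) leaf.hyps(5) by blast
  qed (use leaf.hyps(3) in auto)
  then show ?case by simp
qed

lemma tree_on_map:
  assumes "tree_on adj V" "inj_on f V"
    and "\<And>x y. x \<in> V \<Longrightarrow> y \<in> V \<Longrightarrow> adj' (f x) (f y) \<longleftrightarrow> adj x y"
  shows "tree_on adj' (f ` V)"
  using assms grows_map[of adj "{_}" V f adj'] unfolding tree_on_def by fastforce

lemma tree_on_cong:
  assumes "tree_on adj V" "\<And>x y. x \<in> V \<Longrightarrow> y \<in> V \<Longrightarrow> adj' x y \<longleftrightarrow> adj x y"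
  shows "tree_on adj' V"
  using tree_on_map[of adj V "\<lambda>x. x" adj'] assms by simp

lemma tree_on_root:
  assumes "tree_on adj V" "symp adj" "s \<in> V"
  shows "grows adj {s} V"
  using assms unfolding tree_on_def by (blast intro: grows_reroot)

text \<open>
  An edge to a new leaf is cut by the leaf alone; for an older edge, the new leaf joins the side of
  its only neighbour.
\<close>
lemma tree_edge_is_bridge:
  assumes "tree_on adj V" "symp adj" "i \<in> V" "j \<in> V" "adj i j" "i \<noteq> j"
  obtains K where "K \<subseteq> V" "i \<in> K" "j \<notin> K"
    "\<And>k l. k \<in> K \<Longrightarrow> l \<in> V - K \<Longrightarrow> adj k l \<Longrightarrow> k = i \<and> l = j"
proof -
  have sym: "adj a b \<Longrightarrow> adj b a" for a b using assms(2) by (auto simp: symp_def)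
  obtain r where "grows adj {r} V" using assms(1) by (auto simp: tree_on_def)
  then have "\<exists>K\<subseteq>V. i \<in> K \<and> j \<notin> K \<and> (\<forall>k\<in>K. \<forall>l\<in>V-K. adj k l \<longrightarrow> k = i \<and> l = j)"
    using assms(3,4,5,6)
  proof (induction arbitrary: i j rule: grows.induct)
    case start
    then show ?case by auto
  next
    case (leaf V x y)
    have uniq: "z = y" if "z \<in> V" "adj x z \<or> adj z x" for z
      using leaf.hyps(5) that sym by blast
    consider "i \<in> V" "j \<in> V" | "i = x" "j = y" | "j = x" "i = y"
      using leaf.prems uniq by blast
    then show ?case
    proof cases
      case 1
      then obtain K where K: "K \<subseteq> V" "i \<in> K" "j \<notin> K"
        "\<forall>k\<in>K. \<forall>l\<in>V-K. adj k l \<longrightarrow> k = i \<and> l = j"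
        using leaf.IH[of i j] leaf.prems(3,4) by blast
      show ?thesis
      proof (cases "y \<in> K")
        case True
        show ?thesis
        proof (intro exI[of _ "insert x K"] conjI ballI impI)
          fix k l assume "k \<in> insert x K" "l \<in> insert x V - insert x K" "adj k l"
          then show "k = i" "l = j" using K(4) True uniq[of l] by blast+
        next
          show "j \<notin> insert x K" using K(3) 1 leaf.hyps(2) by blast
        qed (use K(1,2) in auto)
      next
        case False
        show ?thesis
        proof (intro exI[of _ K] conjI ballI impI)
          fix k l assume "k \<in> K" "l \<in> insert x V - K" "adj k l"
          then show "k = i" "l = j" using K(1,4) False uniq[of k] by blast+
        qed (use K(1-3) in auto)
      qed
    next
      case 2
      then show ?thesis using uniq leaf.hyps(2,3) by (intro exI[of _ "{x}"]) blast
    next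
      case 3
      then show ?thesis using uniq leaf.hyps(2,3) by (intro exI[of _ V]) blast
    qed
  qed
  then show ?thesis using that by blast
qed

lemma grows_connected:
  assumes "grows adj {r} V" "symp adj" "y \<in> V" "y' \<in> V"
  shows "(y, y') \<in> {(k, l). k \<in> V \<and> l \<in> V \<and> adj k l}\<^sup>*"
proof -
  have sym: "adj a b \<Longrightarrow> adj b a" for a b using assms(2) by (auto simp: symp_def)
  have main: "(y, r) \<in> {(k, l). k \<in> V \<and> l \<in> V \<and> adj k l}\<^sup>*" if "grows adj {r} V" "y \<in> V" for y V
    using that
  proof (induction arbitrary: y rule: grows.induct)
    case (leaf V x z)
    have mono: "{(k, l). k \<in> V \<and> l \<in> V \<and> adj k l}\<^sup>* \<subseteq> {(k, l). k \<in> insert x V \<and> l \<in> insert x V \<and> adj k l}\<^sup>*"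
      by (rule rtrancl_mono) auto
    show ?case
    proof (cases "y \<in> V")
      case True
      then show ?thesis using leaf.IH mono by blast
    next
      case False
      then have "(y, z) \<in> {(k, l). k \<in> insert x V \<and> l \<in> insert x V \<and> adj k l}"
        using leaf.hyps(3,4) leaf.prems by auto
      then show ?thesis using leaf.IH[OF leaf.hyps(3)] mono by (meson converse_rtrancl_into_rtrancl subsetD)
    qed
  qed auto
  have "sym {(k, l). k \<in> V \<and> l \<in> V \<and> adj k l}" using sym by (auto simp: sym_def)
  then have "(r, y') \<in> {(k, l). k \<in> V \<and> l \<in> V \<and> adj k l}\<^sup>*"
    using main[OF assms(1,4)] by (meson sym_rtrancl symD)
  then show ?thesis using main[OF assms(1,3)] by (rule rtrancl_trans[rotated])
qed

text \<open>
  A largest subtree \<open>W\<close> either has no edge to the remaining vertices, or some outside vertex has two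
  neighbours in \<open>W\<close>, for otherwise that vertex could be attached as a leaf.
\<close>
lemma not_tree_cases:
  assumes "finite V" "V \<noteq> {}" "symp adj" "\<not> tree_on adj V"
  obtains (disconnected) K where "K \<subseteq> V" "K \<noteq> {}" "K \<noteq> V" "\<And>k l. k \<in> K \<Longrightarrow> l \<in> V - K \<Longrightarrow> \<not> adj k l"
  | (cycle) i j k where "i \<in> V" "j \<in> V" "k \<in> V" "i \<noteq> k" "adj i j" "adj k j" "i \<noteq> j" "k \<noteq> j"
      "(i, k) \<in> {(a, b). a \<in> V - {j} \<and> b \<in> V - {j} \<and> adj a b}\<^sup>*"
proof -
  have sym: "adj a b \<Longrightarrow> adj b a" for a b using assms(3) by (auto simp: symp_def)
  let ?Q = "\<lambda>W. W \<subseteq> V \<and> tree_on adj W"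
  obtain r where r: "r \<in> V" using assms(2) by blast
  have ex: "?Q {r}" using r by (auto simp: tree_on_def intro: grows.start)
  obtain W where W: "?Q W" "\<And>W'. ?Q W' \<Longrightarrow> card W' \<le> card W"
    using ex_has_greatest_nat[of ?Q "{r}" card "Suc (card V)"] ex assms(1)
    by (metis card_mono le_imp_less_Suc)
  then obtain r0 where r0: "r0 \<in> W" "grows adj {r0} W" by (auto simp: tree_on_def)
  have neq: "W \<noteq> V" using W assms(4) by auto
  show thesis
  proof (cases "\<exists>k\<in>W. \<exists>l\<in>V-W. adj k l")
    case False
    then show thesis using disconnected[of W] W(1) r0(1) neq by blast
  next
    case True
    then obtain y x where yx: "y \<in> W" "x \<in> V - W" "adj y x" by blast
    have "\<exists>y'\<in>W. adj x y' \<and> y' \<noteq> y"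
    proof (rule ccontr)
      assume no: "\<not> ?thesis"
      have "grows adj {r0} (insert x W)"
        by (rule grows.leaf[OF r0(2) _ yx(1) sym[OF yx(3)]]) (use yx no in blast)+
      then have "?Q (insert x W)" using W(1) yx r0 by (auto simp: tree_on_def)
      then have "card (insert x W) \<le> card W" using W(2) by blast
      moreover have "finite W" using W(1) assms(1) finite_subset by blast
      ultimately show False using yx by auto
    qed
    then obtain y' where y': "y' \<in> W" "adj x y'" "y' \<noteq> y" by blast
    have "(y, y') \<in> {(k, l). k \<in> W \<and> l \<in> W \<and> adj k l}\<^sup>*"
      by (rule grows_connected[OF r0(2) assms(3) yx(1) y'(1)])
    moreover have "{(k, l). k \<in> W \<and> l \<in> W \<and> adj k l} \<subseteq> {(a, b). a \<in> V - {x} \<and> b \<in> V - {x} \<and> adj a b}"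
      using W(1) yx(2) by blast
    ultimately have "(y, y') \<in> {(a, b). a \<in> V - {x} \<and> b \<in> V - {x} \<and> adj a b}\<^sup>*"
      using rtrancl_mono by blast
    then show thesis using cycle[of y x y'] yx y' W(1) sym by blast
  qed
qed

definition co_adj :: "ugraph \<Rightarrow> nat \<Rightarrow> nat \<Rightarrow> bool" where
  "co_adj G i j \<longleftrightarrow> i \<in> fst G \<and> j \<in> fst G \<and> i \<noteq> j \<and> {i, j} \<notin> snd G"

lemma symp_co_adj: "symp (co_adj G)"
  by (auto simp: co_adj_def symp_def insert_commute)

text \<open>
  In terms of non-edges, a concatenation identifies a vertex of one graph with a vertex of the other
  and adds nothing, since all pairs across become edges. Growing the second tree from the shared vertex
  therefore continues the growth of the first.
\<close>
lemma concat_of_edgeless_imp_tree: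
  assumes "concat_of_edgeless G"
  shows "snd G \<subseteq> Pow (fst G) \<and> tree_on (co_adj G) (fst G)"
  using assms
proof (induction rule: concat_of_edgeless.induct)
  case edgeless
  have "grows (co_adj ({1,2},{})) {1} (insert 2 {1})"
    by (rule grows.leaf[OF grows.start, of _ _ 1]) (auto simp: co_adj_def)
  then show ?case by (auto simp: tree_on_def insert_commute)
next
  case (concat r s E1 E2)
  let ?A = "co_adj ({1..s}, concat_edges r s E1 E2)"
  have E: "E1 \<subseteq> Pow {1..r}" "E2 \<subseteq> Pow {r..s}" using concat.IH by auto
  have a1: "?A x y \<longleftrightarrow> co_adj ({1..r}, E1) x y" if "x \<in> {1..r}" "y \<in> {1..r}" for x y
    using that E concat.hyps by (auto simp: co_adj_def concat_edges_def doubleton_eq_iff)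
  have a2: "?A x y \<longleftrightarrow> co_adj ({r..s}, E2) x y" if "x \<in> {r..s}" "y \<in> {r..s}" for x y
    using that E concat.hyps by (auto simp: co_adj_def concat_edges_def doubleton_eq_iff)
  have "tree_on ?A {1..r}" 
  proof (rule tree_on_cong[where adj = "co_adj ({1..r}, E1)"])
    show "tree_on (co_adj ({1..r}, E1)) {1..r}" using concat.IH(1) by (simp only: fst_conv snd_conv)
  qed (fact a1)
  then have g1: "grows ?A {1} {1..r}"
    by (rule tree_on_root[OF _ symp_co_adj]) (use concat.hyps in auto)
  have "tree_on ?A {r..s}" 
  proof (rule tree_on_cong[where adj = "co_adj ({r..s}, E2)"])
    show "tree_on (co_adj ({r..s}, E2)) {r..s}" using concat.IH(2) by (simp only: fst_conv snd_conv)
  qed (fact a2)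
  then have g2: "grows ?A {r} {r..s}"
    by (rule tree_on_root[OF _ symp_co_adj]) (use concat.hyps in auto)
  have across: "\<not> ?A x t" if "r < x" "t < r" "1 \<le> t" "x \<le> s" for x t
    using that concat.hyps by (auto simp: co_adj_def concat_edges_def doubleton_eq_iff)
  have "grows ?A ({r} \<union> {1..r}) ({r..s} \<union> {1..r})"
    by (rule grows_union[OF g2]) (use across in auto)
  moreover have "{r} \<union> {1..r} = {1..r}" "{r..s} \<union> {1..r} = {1..s}" using concat.hyps by auto
  ultimately have "grows ?A {1} {1..s}" using g1 grows_trans by metis
  moreover have "concat_edges r s E1 E2 \<subseteq> Pow {1..s}"
    using E concat.hyps unfolding concat_edges_def by fastforce
  ultimately show ?case using concat.hyps by (auto simp: tree_on_def)
next
  case (renumber V E f W)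
  have inj: "inj_on f V" and W: "f ` V = W" using renumber.hyps by (auto simp: bij_betw_def)
  have E: "E \<subseteq> Pow V" using renumber.IH by simp
  have mem: "{f x, f y} \<in> (`) f ` E \<longleftrightarrow> {x, y} \<in> E" if "x \<in> V" "y \<in> V" for x y
  proof
    assume "{f x, f y} \<in> (`) f ` E"
    then obtain e where e: "e \<in> E" "f ` {x, y} = f ` e" by auto
    then have "{x, y} = e" using E inj that by (subst (asm) inj_on_image_eq_iff[of f V]) auto
    then show "{x, y} \<in> E" using e by simp
  next
    assume "{x, y} \<in> E"
    then show "{f x, f y} \<in> (`) f ` E" by (metis (no_types) image_eqI image_insert image_empty)
  qed
  have "tree_on (co_adj (W, (`) f ` E)) (f ` V)"
  proof (rule tree_on_map[OF _ inj])
    show "tree_on (co_adj (V, E)) V" using renumber.IH by simp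
    show "co_adj (W, (`) f ` E) (f x) (f y) \<longleftrightarrow> co_adj (V, E) x y" if "x \<in> V" "y \<in> V" for x y
      using that mem[OF that] inj W by (auto simp: co_adj_def inj_on_def)
  qed
  then show ?case using E W by auto
qed

definition non_edges :: "(nat \<Rightarrow> nat \<Rightarrow> bool) \<Rightarrow> nat set \<Rightarrow> nat set set" where
  "non_edges adj V = {{i, j} | i j. i \<in> V \<and> j \<in> V \<and> i \<noteq> j \<and> \<not> adj i j}"

lemma non_edges_image:
  assumes "inj_on f V" "\<And>x y. x \<in> V \<Longrightarrow> y \<in> V \<Longrightarrow> adj' (f x) (f y) \<longleftrightarrow> adj x y"
  shows "(`) f ` non_edges adj V = non_edges adj' (f ` V)"
proof -
  have "(`) f ` non_edges adj V = {{f i, f j} | i j. i \<in> V \<and> j \<in> V \<and> i \<noteq> j \<and> \<not> adj i j}"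
    unfolding non_edges_def by (auto simp: image_iff) (metis image_empty image_insert)
  also have "\<dots> = non_edges adj' (f ` V)"
    using assms unfolding non_edges_def inj_on_def by (auto; blast)
  finally show ?thesis .
qed

lemma concat_of_edgeless_iso:
  assumes "concat_of_edgeless (V, non_edges adj V)" "inj_on f V"
    "\<And>x y. x \<in> V \<Longrightarrow> y \<in> V \<Longrightarrow> adj' (f x) (f y) \<longleftrightarrow> adj x y"
  shows "concat_of_edgeless (f ` V, non_edges adj' (f ` V))"
proof -
  have "concat_of_edgeless (f ` V, (`) f ` non_edges adj V)"
    using assms(1,2) by (intro concat_of_edgeless.renumber) (auto simp: bij_betw_def)
  then show ?thesis using non_edges_image[of f V adj' adj] assms(2,3) by simp
qed

text \<open>
  Attaching the leaf \<open>x\<close> at \<open>y\<close> is the concatenation with the edgeless graph on \<open>{y, x}\<close>, once the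
  old vertices are numbered so that \<open>y\<close> comes last.
\<close>
lemma tree_imp_concat_of_edgeless:
  assumes "grows adj {r} V" "symp adj" "card V \<ge> 2"
  shows "concat_of_edgeless (V, non_edges adj V)"
  using assms(1,3)
proof (induction rule: grows.induct)
  case start
  then show ?case by simp
next
  case (leaf V x y)
  have sym: "adj a b \<longleftrightarrow> adj b a" for a b using assms(2) by (auto simp: symp_def)
  have fin: "finite V" using grows_finite[OF leaf.hyps(1)] by simp
  show ?case
  proof (cases "card V \<ge> 2")
    case False
    then have "card V = 1" using leaf.hyps(3) fin by (metis One_nat_def Suc_leI card_gt_0_iff empty_iff le_antisym not_less_eq_eq numeral_2_eq_2)
    then have V: "V = {y}" using leaf.hyps(3) by (metis card_1_singletonE singletonD)
    let ?f = "\<lambda>k::nat. if k = 1 then x else y"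
    have "concat_of_edgeless (?f ` {1,2}, non_edges adj (?f ` {1,2}))"
    proof (rule concat_of_edgeless_iso[where adj = "\<lambda>a b. adj (?f a) (?f b)"])
      have ne: "non_edges (\<lambda>a b. adj (?f a) (?f b)) {1,2} = {}"
        using leaf.hyps(4) sym unfolding non_edges_def by auto
      show "concat_of_edgeless ({1,2}, non_edges (\<lambda>a b. adj (?f a) (?f b)) {1,2})"
        using concat_of_edgeless.edgeless by (simp only: ne)
    qed (use leaf.hyps(2) V in \<open>auto simp: inj_on_def\<close>)
    then show ?thesis using V by (simp add: insert_commute)
  next
    case True
    define m where "m = card V"
    have IH: "concat_of_edgeless (V, non_edges adj V)" using leaf.IH True by simp
    have "\<exists>g. bij_betw g (V - {y}) {1..<m}"
      using fin leaf.hyps(3) by (intro finite_same_card_bij) (auto simp: m_def)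
    then obtain g0 where g0: "bij_betw g0 (V - {y}) {1..<m}" by blast
    \<comment> \<open>number the old vertices by \<open>1, \<dots>, m\<close> with \<open>y\<close> last, and let \<open>x\<close> follow\<close>
    define g where "g = (\<lambda>k. if k = x then Suc m else if k = y then m else g0 k)"
    have gV: "g ` V = {1..m}" "inj_on g V"
    proof -
      have im: "g0 ` (V - {y}) = {1..<m}" "inj_on g0 (V - {y})" using g0 by (auto simp: bij_betw_def)
      have g_eq: "g v = g0 v" if "v \<in> V - {y}" for v using that leaf.hyps(2) by (auto simp: g_def)
      have gy: "g y = m" using leaf.hyps(2,3) by (auto simp: g_def)
      have im': "g ` (V - {y}) = {1..<m}" "inj_on g (V - {y})"
      proof -
        have "g ` (V - {y}) = g0 ` (V - {y})" by (rule image_cong[OF refl g_eq])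
        then show "g ` (V - {y}) = {1..<m}" using im(1) by simp
        have "inj_on g (V - {y}) \<longleftrightarrow> inj_on g0 (V - {y})" by (rule inj_on_cong) (rule g_eq)
        then show "inj_on g (V - {y})" using im(2) by simp
      qed
      have V: "V = insert y (V - {y})" using leaf.hyps(3) by blast
      have "g ` V = insert m {1..<m}" by (subst V) (simp only: image_insert im'(1) gy)
      then show "g ` V = {1..m}" using True by (auto simp: m_def)
      show "inj_on g V" by (subst V) (use im' gy in \<open>simp add: inj_on_insert del: insert_Diff_single\<close>)
    qed
    have gx: "g x = Suc m" "g y = m" using leaf.hyps(2,3) by (auto simp: g_def)
    have ginj: "inj_on g (insert x V)"
      using gV gx leaf.hyps(2) by (auto simp: inj_on_insert)
    have gim: "g ` insert x V = {1..Suc m}" using gV(1) gx by (auto simp: image_insert)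
    define f where "f = the_inv_into (insert x V) g"
    have fg: "f (g v) = v" if "v \<in> insert x V" for v
      unfolding f_def using ginj that by (rule the_inv_into_f_f)
    let ?B = "\<lambda>a b. adj (f a) (f b)"
    have B: "?B (g u) (g v) \<longleftrightarrow> adj u v" if "u \<in> insert x V" "v \<in> insert x V" for u v
      using fg that by simp
    have c1: "concat_of_edgeless ({1..m}, non_edges ?B {1..m})"
      using concat_of_edgeless_iso[OF IH gV(2), of ?B] B gV(1) by simp
    have c2: "concat_of_edgeless ({m..Suc m}, non_edges ?B {m..Suc m})"
    proof -
      let ?h = "\<lambda>k::nat. if k = 1 then m else Suc m"
      have im: "?h ` {1,2} = {m..Suc m}" by auto
      have ne: "non_edges (\<lambda>a b. ?B (?h a) (?h b)) {1,2} = {}"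
        using leaf.hyps(4) sym fg[of x] fg[of y] gx leaf.hyps(3) unfolding non_edges_def by auto
      have "concat_of_edgeless (?h ` {1,2}, non_edges ?B (?h ` {1,2}))"
      proof (rule concat_of_edgeless_iso[where adj = "\<lambda>a b. ?B (?h a) (?h b)"])
        show "concat_of_edgeless ({1,2}, non_edges (\<lambda>a b. ?B (?h a) (?h b)) {1,2})"
          using concat_of_edgeless.edgeless by (simp only: ne)
      qed (auto simp: inj_on_def)
      then show ?thesis by (simp only: im)
    qed
    have "concat_of_edgeless ({1..Suc m}, concat_edges m (Suc m) (non_edges ?B {1..m}) (non_edges ?B {m..Suc m}))"
      using c1 c2 True by (intro concat_of_edgeless.concat) (auto simp: m_def)
    moreover have "concat_edges m (Suc m) (non_edges ?B {1..m}) (non_edges ?B {m..Suc m}) = non_edges ?B {1..Suc m}"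
    proof -
      have far: "\<not> ?B i (Suc m)" "\<not> ?B (Suc m) i" if "1 \<le> i" "i < m" for i
      proof -
        have "i \<in> g ` V" using gV(1) that by auto
        then obtain v where v: "v \<in> V" "g v = i" by blast
        then have "v \<noteq> y" using gx that by auto
        then have "\<not> adj x v" using leaf.hyps(5) v by blast
        then show "\<not> ?B i (Suc m)" "\<not> ?B (Suc m) i"
          using B[of v x] B[of x v] v gx sym by auto
      qed
      have "e \<in> concat_edges m (Suc m) (non_edges ?B {1..m}) (non_edges ?B {m..Suc m})"
        if "e \<in> non_edges ?B {1..Suc m}" for e
      proof -
        obtain i j where ij: "e = {i, j}" "i < j" "1 \<le> i" "j \<le> Suc m" "\<not> ?B i j"
        proof -
          obtain i j where ij: "e = {i, j}" "i \<in> {1..Suc m}" "j \<in> {1..Suc m}" "i \<noteq> j" "\<not> ?B i j"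
            using \<open>e \<in> _\<close> unfolding non_edges_def by blast
          show thesis
          proof (cases "i < j")
            case True
            then show thesis using that[of i j] ij by simp
          next
            case False
            moreover have "\<not> ?B j i" using ij(5) sym by blast
            ultimately show thesis using that[of j i] ij(1-4) by (simp add: insert_commute)
          qed
        qed
        consider "j \<le> m" | "j = Suc m" "i = m" | "j = Suc m" "i < m" using ij by linarith
        then show ?thesis
        proof cases
          case 1
          then have "i \<in> {1..m}" "j \<in> {1..m}" "i \<noteq> j" using ij by simp_all
          then have "e \<in> non_edges ?B {1..m}" using ij(1,5) unfolding non_edges_def by blast
          then show ?thesis unfolding concat_edges_def by blast
        next
          case 2
          then have "i \<in> {m..Suc m}" "j \<in> {m..Suc m}" "i \<noteq> j" using ij by simp_all
          then have "e \<in> non_edges ?B {m..Suc m}" using ij(1,5) unfolding non_edges_def by blast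
          then show ?thesis unfolding concat_edges_def by blast
        next
          case 3
          then have "1 \<le> i" "m < j" "j \<le> Suc m" using ij by simp_all
          then show ?thesis using ij(1) 3(2) unfolding concat_edges_def by blast
        qed
      qed
      moreover have "e \<in> non_edges ?B {1..Suc m}"
        if "e \<in> concat_edges m (Suc m) (non_edges ?B {1..m}) (non_edges ?B {m..Suc m})" for e
      proof -
        have mg: "m \<ge> 2" using True by (simp add: m_def)
        from that consider "e \<in> non_edges ?B {1..m}" | "e \<in> non_edges ?B {m..Suc m}"
          | i j where "e = {i, j}" "1 \<le> i" "i < m" "m < j" "j \<le> Suc m"
          unfolding concat_edges_def by blast
        then show ?thesis
        proof cases
          case 3
          then have "j = Suc m" by simp
          moreover have "i \<in> {1..Suc m}" "j \<in> {1..Suc m}" "i \<noteq> j" using 3 by simp_all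
          ultimately show ?thesis using 3(1) far(1)[OF 3(2,3)] unfolding non_edges_def by blast
        next
          case 1
          moreover have "{1..m} \<subseteq> {1..Suc m}" by auto
          ultimately show ?thesis unfolding non_edges_def by blast
        next
          case 2
          moreover have "{m..Suc m} \<subseteq> {1..Suc m}" using mg by auto
          ultimately show ?thesis unfolding non_edges_def by blast
        qed
      qed
      ultimately show ?thesis by blast
    qed
    ultimately have c: "concat_of_edgeless ({1..Suc m}, non_edges ?B {1..Suc m})" by simp
    have finj: "inj_on f {1..Suc m}"
    proof (rule inj_on_inverseI[where g = g])
      show "g (f k) = k" if "k \<in> {1..Suc m}" for k
        using that gim unfolding f_def by (intro f_the_inv_into_f[OF ginj]) simp
    qed
    have "f ` g ` insert x V = insert x V" unfolding image_image using fg by (simp only: image_ident cong: image_cong)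
    then have fim: "f ` {1..Suc m} = insert x V" by (simp only: gim)
    show ?thesis using concat_of_edgeless_iso[OF c finj refl] by (simp only: fim)
  qed
qed

section \<open>Regular sequences in commutative rings\<close>

text \<open>
  Ideals as sets over a type class; \<open>ideal_iff_closed_ideal\<close> identifies them with the ideals of the
  record \<open>mpoly_ring\<close>, and \<open>primeideal_iff_prime_set\<close> does the same for primes. This keeps ring
  computations in the type class, where simplification is effective.
\<close>
definition closed_ideal :: "'a::comm_ring_1 set \<Rightarrow> bool" where
  "closed_ideal J \<longleftrightarrow> 0 \<in> J \<and> (\<forall>x\<in>J. \<forall>y\<in>J. x + y \<in> J) \<and> (\<forall>r. \<forall>x\<in>J. r * x \<in> J)"

definition prime_set :: "'a::comm_ring_1 set \<Rightarrow> bool" where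
  "prime_set Q \<longleftrightarrow> closed_ideal Q \<and> 1 \<notin> Q \<and> (\<forall>x y. x * y \<in> Q \<longrightarrow> x \<in> Q \<or> y \<in> Q)"

definition sum_set :: "'a::comm_ring_1 set \<Rightarrow> 'a set \<Rightarrow> 'a set" where
  "sum_set J J' = {x + y | x y. x \<in> J \<and> y \<in> J'}"

lemma sum_setI: "x \<in> J \<Longrightarrow> y \<in> J' \<Longrightarrow> x + y \<in> sum_set J J'"
  unfolding sum_set_def by blast

lemma closed_idealD:
  assumes "closed_ideal J"
  shows "0 \<in> J" "x \<in> J \<Longrightarrow> y \<in> J \<Longrightarrow> x + y \<in> J" "x \<in> J \<Longrightarrow> r * x \<in> J" "x \<in> J \<Longrightarrow> x * r \<in> J"
    "x \<in> J \<Longrightarrow> - x \<in> J" "x \<in> J \<Longrightarrow> y \<in> J \<Longrightarrow> x - y \<in> J"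
proof -
  show "0 \<in> J" and add: "x \<in> J \<Longrightarrow> y \<in> J \<Longrightarrow> x + y \<in> J" and m: "x \<in> J \<Longrightarrow> r * x \<in> J" for x y r
    using assms by (auto simp: closed_ideal_def)
  show "x \<in> J \<Longrightarrow> x * r \<in> J" using m[of x r] by (simp add: mult.commute)
  show neg: "x \<in> J \<Longrightarrow> - x \<in> J" for x using m[of x "-1"] by simp
  show "x \<in> J \<Longrightarrow> y \<in> J \<Longrightarrow> x - y \<in> J" using add[OF _ neg, of x y] by simp
qed

lemma closed_ideal_sum:
  assumes "closed_ideal J" "\<And>i. i \<in> A \<Longrightarrow> f i \<in> J"
  shows "sum f A \<in> J"
  using assms(2) by (induction A rule: infinite_finite_induct) (auto intro: closed_idealD[OF assms(1)])

lemma closed_ideal_sum_set: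
  assumes "closed_ideal J" "closed_ideal J'"
  shows "closed_ideal (sum_set J J')"
  unfolding closed_ideal_def sum_set_def
proof (intro conjI ballI allI)
  show "0 \<in> {x + y |x y. x \<in> J \<and> y \<in> J'}"
    using closed_idealD(1)[OF assms(1)] closed_idealD(1)[OF assms(2)] by force
next
  fix u v assume "u \<in> {x + y |x y. x \<in> J \<and> y \<in> J'}" "v \<in> {x + y |x y. x \<in> J \<and> y \<in> J'}"
  then obtain x y x' y' where "u = x + y" "v = x' + y'" "x \<in> J" "x' \<in> J" "y \<in> J'" "y' \<in> J'" by blast
  then have "u + v = (x + x') + (y + y')" "x + x' \<in> J" "y + y' \<in> J'"
    using closed_idealD[OF assms(1)] closed_idealD[OF assms(2)] by auto
  then show "u + v \<in> {x + y |x y. x \<in> J \<and> y \<in> J'}" by blast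
next
  fix r u assume "u \<in> {x + y |x y. x \<in> J \<and> y \<in> J'}"
  then obtain x y where "u = x + y" "x \<in> J" "y \<in> J'" by blast
  then have "r * u = r * x + r * y" "r * x \<in> J" "r * y \<in> J'"
    using closed_idealD[OF assms(1)] closed_idealD[OF assms(2)] by (auto simp: distrib_left)
  then show "r * u \<in> {x + y |x y. x \<in> J \<and> y \<in> J'}" by blast
qed

lemma prime_setD:
  assumes "prime_set Q"
  shows "closed_ideal Q" "1 \<notin> Q" "x * y \<in> Q \<Longrightarrow> x \<notin> Q \<Longrightarrow> y \<in> Q"
  using assms by (auto simp: prime_set_def)

lemma prime_set_prod:
  assumes "prime_set Q" "finite A" "\<And>i. i \<in> A \<Longrightarrow> f i \<notin> Q"
  shows "prod f A \<notin> Q"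
  using assms(2,3) by (induction A) (use prime_setD[OF assms(1)] in auto)

lemma prime_set_power: "prime_set Q \<Longrightarrow> x ^ k \<in> Q \<Longrightarrow> x \<in> Q"
  by (induction k) (auto simp: prime_set_def)

text \<open>
  Induction on the number of primes. Fix \<open>Q\<close> and avoid the primes not contained in \<open>Q\<close> by some \<open>h\<close>. If
  \<open>h\<close> lies in \<open>Q\<close>, add an element of \<open>J\<close> that lies in all of those primes but not in \<open>Q\<close>. The primes
  contained in \<open>Q\<close> are then avoided as well.
\<close>
lemma prime_avoidance:
  fixes J :: "'a::comm_ring_1 set"
  assumes "finite \<Q>" "closed_ideal J" "\<And>Q. Q \<in> \<Q> \<Longrightarrow> prime_set Q" "\<And>Q. Q \<in> \<Q> \<Longrightarrow> \<not> J \<subseteq> Q"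
  obtains h where "h \<in> J" "\<And>Q. Q \<in> \<Q> \<Longrightarrow> h \<notin> Q"
proof -
  have "\<exists>h\<in>J. \<forall>Q\<in>\<Q>. h \<notin> Q"
    using assms(1,3,4)
  proof (induction "card \<Q>" arbitrary: \<Q> rule: less_induct)
    case less
    show ?case
    proof (cases "\<Q> = {}")
      case True
      then show ?thesis using closed_idealD(1)[OF assms(2)] by blast
    next
      case False
      then obtain Q where Q: "Q \<in> \<Q>" by blast
      define \<Q>' where "\<Q>' = {Q'\<in>\<Q>. \<not> Q' \<subseteq> Q}"
      have fin: "finite \<Q>'" using less.prems(1) by (simp add: \<Q>'_def)
      have "\<Q>' \<subset> \<Q>" using Q by (auto simp: \<Q>'_def)
      then have "card \<Q>' < card \<Q>" using less.prems(1) by (simp add: psubset_card_mono)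
      then obtain h where h: "h \<in> J" "\<And>Q'. Q' \<in> \<Q>' \<Longrightarrow> h \<notin> Q'"
      proof -
        have "\<exists>h\<in>J. \<forall>Q'\<in>\<Q>'. h \<notin> Q'"
          by (rule less.hyps) (use \<open>card \<Q>' < card \<Q>\<close> fin less.prems(2,3) in \<open>auto simp: \<Q>'_def\<close>)
        then show thesis using that by blast
      qed
      obtain t where t: "t \<in> J" "t \<notin> Q" using less.prems(3)[OF Q] by blast
      have "\<exists>r. \<forall>Q'\<in>\<Q>'. r Q' \<in> Q' \<and> r Q' \<notin> Q" unfolding \<Q>'_def by (rule bchoice) blast
      then obtain r where r: "\<And>Q'. Q' \<in> \<Q>' \<Longrightarrow> r Q' \<in> Q' \<and> r Q' \<notin> Q" by blast
      \<comment> \<open>lies in every prime of \<open>\<Q>'\<close> but not in \<open>Q\<close>\<close>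
      define w where "w = prod r \<Q>' * t"
      have pQ: "prime_set Q" using less.prems(2) Q .
      have wQ: "w \<notin> Q"
      proof -
        have "prod r \<Q>' \<notin> Q" by (rule prime_set_prod[OF pQ fin]) (use r in blast)
        then show ?thesis using t(2) prime_setD(3)[OF pQ, of "prod r \<Q>'" t] unfolding w_def by blast
      qed
      have wQ': "w \<in> Q'" if "Q' \<in> \<Q>'" for Q'
      proof -
        have "w = r Q' * (prod r (\<Q>' - {Q'}) * t)"
          unfolding w_def by (subst prod.remove[OF fin that]) (simp add: mult.assoc)
        moreover have "closed_ideal Q'" using less.prems(2) that by (auto simp: \<Q>'_def prime_set_def)
        ultimately show ?thesis using r[OF that] closed_idealD(4) by metis
      qed
      define h' where "h' = (if h \<in> Q then h + w else h)"
      have wJ: "w \<in> J" unfolding w_def using closed_idealD(3)[OF assms(2) t(1)] .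
      have "h' \<in> J" using h(1) wJ closed_idealD(2)[OF assms(2)] by (auto simp: h'_def)
      moreover have h'Q: "h' \<notin> Q"
      proof
        assume "h' \<in> Q"
        then have "h \<in> Q" "h + w \<in> Q" by (auto simp: h'_def split: if_splits)
        then show False using wQ closed_idealD(6)[OF prime_setD(1)[OF pQ], of "h + w" h] by simp
      qed
      moreover have "h' \<notin> Q'" if Q': "Q' \<in> \<Q>" for Q'
      proof (cases "Q' \<subseteq> Q")
        case True
        then show ?thesis using h'Q by blast
      next
        case False
        then have m: "Q' \<in> \<Q>'" using Q' by (simp add: \<Q>'_def)
        have "closed_ideal Q'" using less.prems(2)[OF Q'] by (rule prime_setD)
        then show ?thesis
          using closed_idealD(6)[of Q' "h + w" w] h(2)[OF m] wQ'[OF m] by (auto simp: h'_def)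
      qed
      ultimately show ?thesis by blast
    qed
  qed
  then show ?thesis using that by blast
qed

text \<open>
  The submodule \<open>(f 0, \<dots>, f (k - 1)) M\<close>.
\<close>
definition seq_mult :: "(nat \<Rightarrow> 'a::comm_ring_1) \<Rightarrow> nat \<Rightarrow> 'a set \<Rightarrow> 'a set" where
  "seq_mult f k M = {\<Sum>i<k. f i * y i | y. \<forall>i<k. y i \<in> M}"

lemma seq_mult_0 [simp]: "seq_mult f 0 M = {0}"
  by (auto simp: seq_mult_def)

lemma seq_mult_Suc: "seq_mult f (Suc k) M = {n + f k * y | n y. n \<in> seq_mult f k M \<and> y \<in> M}"
proof -
  have "\<exists>y. n + f k * z = (\<Sum>i<Suc k. f i * y i) \<and> (\<forall>i<Suc k. y i \<in> M)"
    if n: "n \<in> seq_mult f k M" and z: "z \<in> M" for n z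
  proof -
    obtain y where "n = (\<Sum>i<k. f i * y i)" "\<forall>i<k. y i \<in> M" using n by (auto simp: seq_mult_def)
    then show ?thesis using z by (intro exI[of _ "y(k := z)"]) (auto simp: less_Suc_eq)
  qed
  then show ?thesis unfolding seq_mult_def by (auto 4 4)
qed

lemma closed_ideal_seq_mult:
  assumes "closed_ideal M"
  shows "closed_ideal (seq_mult f k M)"
proof (induction k)
  case (Suc k)
  have "closed_ideal ((*) (f k) ` M)"
    unfolding closed_ideal_def
  proof (intro conjI ballI allI)
    show "0 \<in> (*) (f k) ` M" using closed_idealD(1)[OF assms] by (force simp: image_iff)
    show "x + y \<in> (*) (f k) ` M" if "x \<in> (*) (f k) ` M" "y \<in> (*) (f k) ` M" for x y
      using that closed_idealD(2)[OF assms] by (auto simp: image_iff) (metis distrib_left)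
    show "r * x \<in> (*) (f k) ` M" if "x \<in> (*) (f k) ` M" for r x
      using that closed_idealD(3)[OF assms] by (auto simp: image_iff) (metis mult.left_commute)
  qed
  moreover have "seq_mult f (Suc k) M = sum_set (seq_mult f k M) ((*) (f k) ` M)"
    by (auto simp: seq_mult_Suc sum_set_def)
  ultimately show ?case using closed_ideal_sum_set[OF Suc] by simp
qed (auto simp: closed_ideal_def)

lemma seq_mult_cong: "(\<And>i. i < k \<Longrightarrow> f i = g i) \<Longrightarrow> seq_mult f k M = seq_mult g k M"
  by (induction k) (auto simp: seq_mult_Suc)

lemma seq_mult_subset: "closed_ideal M \<Longrightarrow> seq_mult f k M \<subseteq> M"
  by (auto simp: seq_mult_def intro!: closed_ideal_sum closed_idealD(3))

text \<open>
  The ideal \<open>J + (f 0, \<dots>, f (a - 1))\<close>.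
\<close>
definition seq_ideal :: "'a::comm_ring_1 set \<Rightarrow> (nat \<Rightarrow> 'a) \<Rightarrow> nat \<Rightarrow> 'a set" where
  "seq_ideal J f a = sum_set J (seq_mult f a UNIV)"

lemma closed_ideal_UNIV [simp]: "closed_ideal UNIV"
  by (simp add: closed_ideal_def)

lemma closed_ideal_zero [simp]: "closed_ideal {0}"
  by (simp add: closed_ideal_def)

lemma closed_ideal_seq_ideal: "closed_ideal J \<Longrightarrow> closed_ideal (seq_ideal J f a)"
  unfolding seq_ideal_def by (intro closed_ideal_sum_set closed_ideal_seq_mult) auto

lemma seq_ideal_0 [simp]: "seq_ideal J f 0 = J"
  by (auto simp: seq_ideal_def sum_set_def)

lemma seq_ideal_Suc: "seq_ideal J f (Suc a) = {n + f a * y | n y. n \<in> seq_ideal J f a}"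
  unfolding seq_ideal_def sum_set_def seq_mult_Suc by (auto; metis add.assoc)

lemma seq_ideal_SucI: "n \<in> seq_ideal J f a \<Longrightarrow> n + f a * y \<in> seq_ideal J f (Suc a)"
  unfolding seq_ideal_Suc by blast

lemma seq_ideal_zero: "seq_ideal {0} f a = seq_mult f a UNIV"
  by (auto simp: seq_ideal_def sum_set_def)

lemma seq_ideal_mono: "J \<subseteq> J' \<Longrightarrow> seq_ideal J f a \<subseteq> seq_ideal J' f a"
  unfolding seq_ideal_def sum_set_def by blast

lemma seq_ideal_subset_Suc: "seq_ideal J f a \<subseteq> seq_ideal J f (Suc a)"
  using seq_ideal_SucI[where y = 0] by fastforce

lemma subset_seq_ideal: "J \<subseteq> seq_ideal J f a"
proof (induction a)
  case (Suc a)
  then show ?case using seq_ideal_subset_Suc by (rule subset_trans)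
qed simp

lemma seq_in_seq_ideal:
  assumes "closed_ideal J" "i < a"
  shows "f i \<in> seq_ideal J f a"
  using assms(2)
proof (induction a)
  case (Suc a)
  have "f a \<in> seq_ideal J f (Suc a)"
    using seq_ideal_SucI[OF closed_idealD(1)[OF closed_ideal_seq_ideal[OF assms(1)]], of f a 1] by simp
  then show ?case using Suc seq_ideal_subset_Suc by (metis less_antisym subsetD)
qed auto

lemma seq_ideal_least:
  assumes "closed_ideal K" "J \<subseteq> K" "\<And>i. i < a \<Longrightarrow> f i \<in> K"
  shows "seq_ideal J f a \<subseteq> K"
  using assms(3)
proof (induction a)
  case (Suc a)
  then show ?case by (auto simp: seq_ideal_Suc intro!: closed_idealD[OF assms(1)])
qed (use assms in auto)

lemma seq_ideal_sum_set:
  "seq_ideal (sum_set J J') f a = sum_set (seq_ideal J f a) (seq_ideal J' f a)"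
proof (induction a)
  case (Suc a)
  show ?case
  proof (intro Set.set_eqI iffI)
    fix x assume "x \<in> seq_ideal (sum_set J J') f (Suc a)"
    then obtain n n' y where "x = (n + n') + f a * y" "n \<in> seq_ideal J f a" "n' \<in> seq_ideal J' f a"
      unfolding seq_ideal_Suc Suc by (auto simp: sum_set_def)
    then have "x = (n + f a * y) + (n' + f a * 0)" by (simp add: algebra_simps)
    then show "x \<in> sum_set (seq_ideal J f (Suc a)) (seq_ideal J' f (Suc a))"
      unfolding sum_set_def seq_ideal_Suc using \<open>n \<in> _\<close> \<open>n' \<in> _\<close> by blast
  next
    fix x assume "x \<in> sum_set (seq_ideal J f (Suc a)) (seq_ideal J' f (Suc a))"
    then obtain n n' y y' where "x = (n + f a * y) + (n' + f a * y')" "n \<in> seq_ideal J f a" "n' \<in> seq_ideal J' f a"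
      unfolding sum_set_def seq_ideal_Suc by blast
    then have "x = (n + n') + f a * (y + y')" by (simp add: algebra_simps)
    then show "x \<in> seq_ideal (sum_set J J') f (Suc a)"
      unfolding seq_ideal_Suc Suc using \<open>n \<in> _\<close> \<open>n' \<in> _\<close> by (auto simp: sum_set_def)
  qed
qed simp

definition regular_mod :: "'a::comm_ring_1 set \<Rightarrow> (nat \<Rightarrow> 'a) \<Rightarrow> nat \<Rightarrow> bool" where
  "regular_mod J f d \<longleftrightarrow> (\<forall>a<d. \<forall>x. f a * x \<in> seq_ideal J f a \<longrightarrow> x \<in> seq_ideal J f a)"

lemma regular_mod_prime_seq:
  assumes "\<And>a. a < d \<Longrightarrow> prime_set (seq_ideal J f a) \<and> f a \<notin> seq_ideal J f a"
  shows "regular_mod J f d"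
  using assms unfolding regular_mod_def by (blast dest: prime_setD(3))

text \<open>
  In general only one inclusion holds. If \<open>x = j + f s = j' + f t\<close>, regularity modulo \<open>J + J'\<close> makes
  \<open>s - t\<close> an element of \<open>J + J'\<close>, so \<open>s\<close> and \<open>t\<close> can be corrected by elements of \<open>J\<close> and \<open>J'\<close> to a
  common value \<open>w\<close>, and then \<open>x - f w\<close> lies in both ideals.
\<close>
lemma seq_ideal_Int:
  assumes "closed_ideal J" "closed_ideal J'" "regular_mod (sum_set J J') f d" "a \<le> d"
  shows "seq_ideal (J \<inter> J') f a = seq_ideal J f a \<inter> seq_ideal J' f a"
  using assms(4)
proof (induction a)
  case (Suc a)
  have cl: "closed_ideal (seq_ideal J f a)" "closed_ideal (seq_ideal J' f a)"
    using assms by (auto intro: closed_ideal_seq_ideal)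
  have "x \<in> seq_ideal (J \<inter> J') f (Suc a)"
    if x_in: "x \<in> seq_ideal J f (Suc a)" "x \<in> seq_ideal J' f (Suc a)" for x
  proof -
    obtain j j' s t where x: "x = j + f a * s" "x = j' + f a * t" "j \<in> seq_ideal J f a" "j' \<in> seq_ideal J' f a"
      using x_in unfolding seq_ideal_Suc by blast
    have "f a * (s - t) = (- j) + j'" using x by (simp add: algebra_simps)
    then have "f a * (s - t) \<in> seq_ideal (sum_set J J') f a"
      unfolding seq_ideal_sum_set using sum_setI[OF closed_idealD(5)[OF cl(1) x(3)] x(4)] by simp
    then have "s - t \<in> seq_ideal (sum_set J J') f a"
      using assms(3) Suc.prems unfolding regular_mod_def by (meson Suc_le_lessD)
    then obtain u u' where u: "s - t = u + u'" "u \<in> seq_ideal J f a" "u' \<in> seq_ideal J' f a"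
      unfolding seq_ideal_sum_set by (auto simp: sum_set_def)
    define w where "w = s - u"
    have w: "w = t + u'" using u by (simp add: w_def algebra_simps)
    have xw: "x - f a * w = j + f a * u" using x(1) by (simp add: w_def algebra_simps)
    have xw': "x - f a * w = j' - f a * u'" using x(2) by (simp add: w algebra_simps)
    have "x - f a * w \<in> seq_ideal J f a" unfolding xw
      by (intro closed_idealD(2,3)[OF cl(1)] x u)
    moreover have "x - f a * w \<in> seq_ideal J' f a" unfolding xw'
      by (intro closed_idealD(3,6)[OF cl(2)] x u)
    ultimately have "x - f a * w \<in> seq_ideal (J \<inter> J') f a" using Suc.IH Suc.prems by simp
    then show ?thesis using seq_ideal_SucI[of "x - f a * w" "J \<inter> J'" f a w] by simp
  qed
  moreover have "seq_ideal (J \<inter> J') f (Suc a) \<subseteq> seq_ideal J f (Suc a)"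
    "seq_ideal (J \<inter> J') f (Suc a) \<subseteq> seq_ideal J' f (Suc a)"
    by (intro seq_ideal_mono Int_lower1 Int_lower2)+
  ultimately show ?case by blast
qed simp

text \<open>
  The depth lemma for \<open>0 \<rightarrow> R/(J \<inter> J') \<rightarrow> R/J \<oplus> R/J' \<rightarrow> R/(J + J') \<rightarrow> 0\<close>: the module on the left admits one
  element more than the one on the right. The last element only has to be regular on the two middle
  terms, because \<open>seq_ideal_Int\<close> embeds the left quotient into the middle one.
\<close>
lemma regular_mod_Int:
  assumes "closed_ideal J" "closed_ideal J'" "regular_mod (sum_set J J') f d"
    "regular_mod J f (Suc d)" "regular_mod J' f (Suc d)"
  shows "regular_mod (J \<inter> J') f (Suc d)"
  using assms(4,5) seq_ideal_Int[OF assms(1-3)] unfolding regular_mod_def by auto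

definition regular_on :: "'a::comm_ring_1 set \<Rightarrow> (nat \<Rightarrow> 'a) \<Rightarrow> nat \<Rightarrow> bool" where
  "regular_on M f d \<longleftrightarrow> (\<forall>i<d. \<forall>x\<in>M. f i * x \<in> seq_mult f i M \<longrightarrow> x \<in> seq_mult f i M)"

text \<open>
  The vanishing of the first Tor of \<open>R/J\<close> and \<open>R/(f)\<close>, in elementary terms: in an element
  \<open>n + f a * y\<close> of \<open>J\<close>, regularity on \<open>R/J\<close> puts \<open>y\<close> into \<open>J + (f 0, \<dots>, f (a - 1))\<close>, so \<open>y\<close> can be
  replaced by an element of \<open>J\<close> at the cost of changing \<open>n\<close>.
\<close>
lemma Int_seq_mult:
  assumes "closed_ideal J" "regular_mod J f d" "a \<le> d" "x \<in> J" "x \<in> seq_mult f a UNIV"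
  shows "x \<in> seq_mult f a J"
  using assms(3-5)
proof (induction a arbitrary: x)
  case (Suc a)
  have cl: "closed_ideal (seq_ideal J f a)" by (rule closed_ideal_seq_ideal[OF assms(1)])
  have cm: "closed_ideal (seq_mult f a UNIV)" by (intro closed_ideal_seq_mult closed_ideal_UNIV)
  obtain n y where x: "x = n + f a * y" "n \<in> seq_mult f a UNIV" using Suc.prems by (auto simp: seq_mult_Suc)
  have "f a * y = x + (- n)" using x by simp
  then have "f a * y \<in> seq_ideal J f a"
    using sum_setI[OF Suc.prems(2) closed_idealD(5)[OF cm x(2)]] unfolding seq_ideal_def by simp
  then have "y \<in> seq_ideal J f a" using assms(2) Suc.prems(1) by (auto simp: regular_mod_def)
  then obtain j t where y: "y = j + t" "j \<in> J" "t \<in> seq_mult f a UNIV"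
    unfolding seq_ideal_def sum_set_def by blast
  have "x - f a * j = n + f a * t" using x y by (simp add: algebra_simps)
  then have "x - f a * j \<in> seq_mult f a UNIV"
    using closed_idealD(2)[OF cm x(2) closed_idealD(3)[OF cm y(3)]] by simp
  moreover have "x - f a * j \<in> J"
    using closed_idealD(6)[OF assms(1) Suc.prems(2) closed_idealD(3)[OF assms(1) y(2)]] .
  ultimately have "x - f a * j \<in> seq_mult f a J" using Suc.IH Suc.prems(1) by simp
  then have "(x - f a * j) + f a * j \<in> seq_mult f (Suc a) J" unfolding seq_mult_Suc using y(2) by blast
  then show ?case by simp
qed simp

text \<open>
  The depth lemma for \<open>0 \<rightarrow> J \<rightarrow> R \<rightarrow> R/J \<rightarrow> 0\<close>.
\<close>
lemma regular_on_ideal: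
  assumes "closed_ideal J" "regular_mod J f d" "regular_mod {0} f (Suc d)"
  shows "regular_on J f (Suc d)"
  unfolding regular_on_def
proof (intro allI ballI impI)
  fix i x assume i: "i < Suc d" and x: "x \<in> J" "f i * x \<in> seq_mult f i J"
  have "seq_mult f i J \<subseteq> seq_mult f i UNIV" by (auto simp: seq_mult_def)
  then have "f i * x \<in> seq_ideal {0} f i" using x unfolding seq_ideal_zero by blast
  then have "x \<in> seq_mult f i UNIV" using assms(3) i unfolding regular_mod_def seq_ideal_zero by blast
  then show "x \<in> seq_mult f i J" using Int_seq_mult[OF assms(1,2)] i x by auto
qed

section \<open>Koszul cochains on words\<close>

text \<open>
  Cochains of degree \<open>p\<close> are functions on words of length \<open>p\<close>, without any alternation. Then
  \<open>shuffle \<alpha>\<close> is the signed shuffle product with the degree-one element \<open>\<alpha>\<close>, and \<open>shuffle x\<close> is the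
  Koszul differential for the elements \<open>x v\<close>. Solved for \<open>\<alpha> v * c t\<close>, the second
  equation says that prefixing the letter \<open>v\<close> is a homotopy between multiplication by \<open>\<alpha> v\<close> and zero. Allowing
  arbitrary functions on words is what makes the recursion, and hence the absence of explicit signs,
  possible.
\<close>
primrec shuffle :: "('v \<Rightarrow> 'a::comm_ring_1) \<Rightarrow> ('v list \<Rightarrow> 'a) \<Rightarrow> 'v list \<Rightarrow> 'a" where
  "shuffle \<alpha> c [] = 0"
| "shuffle \<alpha> c (v # t) = \<alpha> v * c t - shuffle \<alpha> (\<lambda>u. c (v # u)) t"

lemma shuffle_diff: "shuffle \<alpha> (\<lambda>t. c t - c' t) t = shuffle \<alpha> c t - shuffle \<alpha> c' t"
  by (induction t arbitrary: c c') (auto simp: algebra_simps)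

lemma shuffle_sum: "shuffle \<alpha> (\<lambda>t. \<Sum>i\<in>A. r i * c i t) t = (\<Sum>i\<in>A. r i * shuffle \<alpha> (c i) t)"
  by (induction t arbitrary: c) (simp_all add: sum_subtractf sum_distrib_left algebra_simps)

lemma shuffle_zero: "shuffle \<alpha> (\<lambda>t. 0) t = 0"
  by (induction t) auto

lemma shuffle_scale: "shuffle \<alpha> (\<lambda>t. r * c t) t = r * shuffle \<alpha> c t"
  by (induction t arbitrary: c) (auto simp: algebra_simps)

lemma shuffle_anticommute: "shuffle \<alpha> (shuffle \<beta> c) t = - shuffle \<beta> (shuffle \<alpha> c) t"
  by (induction t arbitrary: c) (simp_all add: shuffle_diff shuffle_scale)

lemma shuffle_twice: "shuffle \<alpha> (shuffle \<alpha> c) t = 0"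
  by (induction t arbitrary: c) (simp_all add: shuffle_diff shuffle_scale)

lemma shuffle_vec_add: "shuffle (\<lambda>v. \<alpha> v + \<beta> v) c t = shuffle \<alpha> c t + shuffle \<beta> c t"
  by (induction t arbitrary: c) (auto simp: algebra_simps)

lemma shuffle_mem:
  assumes "closed_ideal M" "\<And>u. Suc (length u) = length t \<Longrightarrow> c u \<in> M"
  shows "shuffle \<alpha> c t \<in> M"
  using assms(2)
proof (induction t arbitrary: c)
  case (Cons v t)
  have "shuffle \<alpha> (\<lambda>u. c (v # u)) t \<in> M" by (rule Cons.IH) (use Cons.prems in auto)
  then show ?case using Cons.prems[of t] closed_idealD[OF assms(1)] by auto
qed (use closed_idealD[OF assms(1)] in auto)

text \<open>
  Vanishing of Koszul cohomology below the length of a regular sequence, in a relative form that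
  avoids quotient modules: \<open>z\<close> is a cocycle modulo \<open>N = (f 0, \<dots>, f (k - 1)) M\<close>. Since \<open>f k\<close> is a
  combination of the \<open>x v\<close>, the homotopy gives \<open>f k * z = d y\<close> modulo \<open>N\<close> with \<open>y\<close> of one degree less.
  So \<open>y\<close> is a cocycle modulo \<open>N + f k M\<close>, hence by induction \<open>y = d w + f k * p\<close> modulo \<open>N\<close>, and
  \<open>f k * z = f k * d p\<close>; now cancel \<open>f k\<close>.
\<close>
theorem koszul_vanishing:
  fixes x :: "'v::finite \<Rightarrow> 'a::comm_ring_1"
  assumes M: "closed_ideal M" and reg: "regular_on M f d"
    and gen: "\<And>i. i < d \<Longrightarrow> \<exists>g. f i = (\<Sum>v\<in>UNIV. g v * x v)"
    and "i + k < d"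
    and "\<And>t. length t = i \<Longrightarrow> z t \<in> M"
    and "\<And>t. length t = Suc i \<Longrightarrow> shuffle x z t \<in> seq_mult f k M"
  shows "\<exists>y. (\<forall>t. Suc (length t) = i \<longrightarrow> y t \<in> M) \<and>
             (\<forall>t. length t = i \<longrightarrow> z t - shuffle x y t \<in> seq_mult f k M)"
  using assms(4-6)
proof (induction i arbitrary: k z)
  case 0
  have N: "closed_ideal (seq_mult f k M)" by (rule closed_ideal_seq_mult[OF M])
  obtain g where g: "f k = (\<Sum>v\<in>UNIV. g v * x v)" using gen 0(1) by auto
  have "f k * z [] = (\<Sum>v\<in>UNIV. g v * shuffle x z [v])" by (simp add: g sum_distrib_right mult.assoc)
  also have "\<dots> \<in> seq_mult f k M"
    by (intro closed_ideal_sum[OF N] closed_idealD(3)[OF N] 0(3)) simp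
  finally have "z [] \<in> seq_mult f k M" using reg 0(1,2) by (auto simp: regular_on_def)
  then show ?case by (intro exI[of _ "\<lambda>_. 0"]) auto
next
  case (Suc i)
  have N: "closed_ideal (seq_mult f k M)" by (rule closed_ideal_seq_mult[OF M])
  obtain g where g: "f k = (\<Sum>v\<in>UNIV. g v * x v)" using gen[of k] Suc.prems(1) by auto
  define y where "y = (\<lambda>t. \<Sum>v\<in>UNIV. g v * z (v # t))"
  have Dy: "shuffle x y t = f k * z t - (\<Sum>v\<in>UNIV. g v * shuffle x z (v # t))" for t
    unfolding y_def shuffle_sum
    by (simp add: g sum_distrib_right right_diff_distrib sum_subtractf mult.assoc)
  have y1: "\<exists>w. (\<forall>t. Suc (length t) = i \<longrightarrow> w t \<in> M) \<and>
             (\<forall>t. length t = i \<longrightarrow> y t - shuffle x w t \<in> seq_mult f (Suc k) M)"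
  proof (rule Suc.IH)
    show "i + Suc k < d" using Suc.prems by simp
    show "y t \<in> M" if "length t = i" for t
      unfolding y_def using that by (intro closed_ideal_sum[OF M] closed_idealD(3)[OF M] Suc.prems) auto
    show "shuffle x y t \<in> seq_mult f (Suc k) M" if "length t = Suc i" for t
    proof -
      have "- (\<Sum>v\<in>UNIV. g v * shuffle x z (v # t)) \<in> seq_mult f k M"
        using that by (intro closed_idealD(5)[OF N] closed_ideal_sum[OF N] closed_idealD(3)[OF N] Suc.prems) auto
      moreover have "shuffle x y t = - (\<Sum>v\<in>UNIV. g v * shuffle x z (v # t)) + f k * z t"
        unfolding Dy by simp
      ultimately show ?thesis unfolding seq_mult_Suc using Suc.prems(2)[OF that] by blast
    qed
  qed
  then obtain w where w: "\<And>t. Suc (length t) = i \<Longrightarrow> w t \<in> M"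
    "\<And>t. length t = i \<Longrightarrow> y t - shuffle x w t \<in> seq_mult f (Suc k) M" by blast
  have "\<forall>t. \<exists>p. length t = i \<longrightarrow> p \<in> M \<and> y t - shuffle x w t - f k * p \<in> seq_mult f k M"
  proof
    fix t :: "'v list"
    show "\<exists>p. length t = i \<longrightarrow> p \<in> M \<and> y t - shuffle x w t - f k * p \<in> seq_mult f k M"
    proof (cases "length t = i")
      case True
      then obtain n p where "y t - shuffle x w t = n + f k * p" "n \<in> seq_mult f k M" "p \<in> M"
        using w(2)[OF True] unfolding seq_mult_Suc by blast
      then show ?thesis by (intro exI[of _ p]) simp
    qed simp
  qed
  then obtain p where p: "\<And>t. length t = i \<Longrightarrow> p t \<in> M"
    "\<And>t. length t = i \<Longrightarrow> y t - shuffle x w t - f k * p t \<in> seq_mult f k M"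
    by metis
  show ?case
  proof (intro exI[of _ p] conjI allI impI)
    show "p t \<in> M" if "Suc (length t) = Suc i" for t using that p by simp
    show "z t - shuffle x p t \<in> seq_mult f k M" if t: "length t = Suc i" for t
    proof -
      have "shuffle x (\<lambda>t. y t - shuffle x w t - f k * p t) t \<in> seq_mult f k M"
        using p(2) t by (intro shuffle_mem[OF N]) auto
      then have "shuffle x y t - f k * shuffle x p t \<in> seq_mult f k M"
        by (simp add: shuffle_diff shuffle_scale shuffle_twice)
      moreover have "(\<Sum>v\<in>UNIV. g v * shuffle x z (v # t)) \<in> seq_mult f k M"
        using t by (intro closed_ideal_sum[OF N] closed_idealD(3)[OF N] Suc.prems) auto
      moreover have "f k * (z t - shuffle x p t) =
          (shuffle x y t - f k * shuffle x p t) + (\<Sum>v\<in>UNIV. g v * shuffle x z (v # t))"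
        unfolding Dy by (simp add: algebra_simps)
      ultimately have "f k * (z t - shuffle x p t) \<in> seq_mult f k M"
        using closed_idealD(2)[OF N] by simp
      moreover have "z t - shuffle x p t \<in> M"
        using Suc.prems(2)[OF t] t p by (intro closed_idealD(6)[OF M] shuffle_mem[OF M]) auto
      ultimately show ?thesis using reg Suc.prems(1) by (auto simp: regular_on_def)
    qed
  qed
qed

corollary koszul_cocycle_is_boundary:
  fixes x :: "'v::finite \<Rightarrow> 'a::comm_ring_1"
  assumes "closed_ideal M" "regular_on M f d"
    and "\<And>i. i < d \<Longrightarrow> \<exists>g. f i = (\<Sum>v\<in>UNIV. g v * x v)"
    and "i < d" "\<And>t. z t \<in> M" "\<And>t. shuffle x z t = 0"
  obtains y where "\<And>t. Suc (length t) = i \<Longrightarrow> y t \<in> M" "\<And>t. length t = i \<Longrightarrow> z t = shuffle x y t"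
  using koszul_vanishing[OF assms(1-3), where i = i and k = 0 and z = z] assms(4-6) by auto

section \<open>Polynomials, substitution and monomial ideals\<close>

abbreviation lookup where "lookup \<equiv> Poly_Mapping.lookup"
abbreviation keys where "keys \<equiv> Poly_Mapping.keys"
abbreviation single where "single \<equiv> Poly_Mapping.single"

lemma lookup_single_mult:
  fixes p :: "('n \<Rightarrow>\<^sub>0 nat) \<Rightarrow>\<^sub>0 'k::comm_ring_1"
  shows "lookup (single b c * p) k = (\<Sum>a\<in>keys p. if k = b + a then c * lookup p a else 0)"
proof -
  have "lookup (single b c * p) k = (\<Sum>l. (c when b = l) * (\<Sum>q. (lookup p q when k = l + q)))"
    by (simp add: lookup_mult lookup_single)
  also have "\<dots> = (\<Sum>l. c * (\<Sum>q. (lookup p q when k = l + q)) when l = b)"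
    by (rule Sum_any.cong) (simp add: when_def)
  also have "\<dots> = c * (\<Sum>q. (lookup p q when k = b + q))" by simp
  also have "(\<Sum>q. (lookup p q when k = b + q)) = (\<Sum>q\<in>keys p. (lookup p q when k = b + q))"
    by (rule Sum_any.expand_superset) (auto simp: in_keys_iff)
  finally show ?thesis by (auto simp: sum_distrib_left when_def intro!: sum.cong)
qed

lemma lookup_single_mult_add:
  fixes p :: "('n \<Rightarrow>\<^sub>0 nat) \<Rightarrow>\<^sub>0 'k::comm_ring_1"
  shows "lookup (single b c * p) (b + a) = c * lookup p a"
proof -
  have "lookup (single b c * p) (b + a) = (\<Sum>a'\<in>keys p. if a = a' then c * lookup p a' else 0)"
    unfolding lookup_single_mult by (auto intro!: sum.cong)
  also have "\<dots> = c * lookup p a" by (simp add: sum.delta' in_keys_iff)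
  finally show ?thesis .
qed

lemma lookup_single_mult_eq_0:
  fixes p :: "('n \<Rightarrow>\<^sub>0 nat) \<Rightarrow>\<^sub>0 'k::comm_ring_1"
  assumes "\<And>a. k \<noteq> b + a"
  shows "lookup (single b c * p) k = 0"
  unfolding lookup_single_mult using assms by simp

lemma sum_singles: "(\<Sum>a\<in>keys p. single a (lookup p a)) = p"
proof (rule poly_mapping_eqI)
  fix k
  have "lookup (\<Sum>a\<in>keys p. single a (lookup p a)) k = (\<Sum>a\<in>keys p. if k = a then lookup p a else 0)"
    by (auto simp: lookup_sum lookup_single when_def intro!: sum.cong)
  then show "lookup (\<Sum>a\<in>keys p. single a (lookup p a)) k = lookup p k"
    by (simp add: sum.delta' in_keys_iff)
qed

lemma exponent_eq_sum: "(\<Sum>v\<in>UNIV. single v (lookup a v)) = (a :: 'n::finite \<Rightarrow>\<^sub>0 nat)"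
proof (rule poly_mapping_eqI)
  fix k
  have "lookup (\<Sum>v\<in>UNIV. single v (lookup a v)) k = (\<Sum>v\<in>UNIV. if k = v then lookup a v else 0)"
    by (auto simp: lookup_sum lookup_single when_def intro!: sum.cong)
  then show "lookup (\<Sum>v\<in>UNIV. single v (lookup a v)) k = lookup a k" by simp
qed

lemma var_power: "var v ^ k = (single (single v k) 1 :: ('n::finite, 'k::field) mpoly)"
  by (induction k) (auto simp: var_def monomial_def mult_single simp flip: single_add)

lemma prod_single_1: "(\<Prod>v\<in>A. single (e v) (1::'k::comm_ring_1)) = single (\<Sum>v\<in>A. e v :: 'n \<Rightarrow>\<^sub>0 nat) 1"
  by (induction A rule: infinite_finite_induct) (auto simp: mult_single)

lemma single_eq_prod_vars:
  "(single a c :: ('n::finite, 'k::field) mpoly) = single 0 c * (\<Prod>v\<in>UNIV. var v ^ lookup a v)"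
  by (simp add: var_power prod_single_1 exponent_eq_sum mult_single)

lemma mpoly_induct [case_names const var add mult]:
  fixes p :: "('n::finite, 'k::field) mpoly"
  assumes c: "\<And>c. Q (single 0 c)" and v: "\<And>v. Q (var v)"
    and add: "\<And>p q. Q p \<Longrightarrow> Q q \<Longrightarrow> Q (p + q)" and mult: "\<And>p q. Q p \<Longrightarrow> Q q \<Longrightarrow> Q (p * q)"
  shows "Q p"
proof -
  have Q1: "Q 1" using c[of 1] by simp
  have pow: "Q (var v ^ k)" for v k by (induction k) (use Q1 v mult in auto)
  have pr: "Q (\<Prod>v\<in>A. var v ^ lookup a v)" for A and a :: "'n \<Rightarrow>\<^sub>0 nat"
    by (induction A rule: infinite_finite_induct) (use Q1 pow mult in auto)
  have s: "Q (single a d)" for a d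
    by (subst single_eq_prod_vars) (rule mult[OF c pr])
  have "Q (\<Sum>a\<in>A. single a (lookup p a))" for A
    by (induction A rule: infinite_finite_induct) (use c[of 0] s add in auto)
  then show ?thesis using sum_singles[of p] by metis
qed

text \<open>
  \<open>\<chi> a c\<close> is the value on the term \<open>c * x^a\<close>; \<open>monomial_hom\<close> collects what makes the extension a
  ring homomorphism.
\<close>
definition extend :: "(('n::finite \<Rightarrow>\<^sub>0 nat) \<Rightarrow> 'k::field \<Rightarrow> 'r::comm_ring_1) \<Rightarrow> ('n, 'k) mpoly \<Rightarrow> 'r" where
  "extend \<chi> p = (\<Sum>a\<in>keys p. \<chi> a (lookup p a))"

locale monomial_hom =
  fixes \<chi> :: "('n::finite \<Rightarrow>\<^sub>0 nat) \<Rightarrow> 'k::field \<Rightarrow> 'r::comm_ring_1"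
  assumes add: "\<chi> a (c + d) = \<chi> a c + \<chi> a d"
    and mult: "\<chi> (a + b) (c * d) = \<chi> a c * \<chi> b d"
    and one: "\<chi> 0 1 = 1"
begin

lemma zero: "\<chi> a 0 = 0"
  using add[of a 0 0] by simp

lemma extend_add: "extend \<chi> (p + q) = extend \<chi> p + extend \<chi> q"
  unfolding extend_def by (rule setsum_keys_plus_distrib) (simp_all add: zero add)

lemma extend_zero [simp]: "extend \<chi> 0 = 0"
  by (simp add: extend_def)

lemma extend_sum: "extend \<chi> (sum f A) = (\<Sum>i\<in>A. extend \<chi> (f i))"
  by (induction A rule: infinite_finite_induct) (auto simp: extend_add)

lemma extend_single [simp]: "extend \<chi> (single a c) = \<chi> a c"
  by (simp add: extend_def zero)

lemma extend_one [simp]: "extend \<chi> 1 = 1"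
  using extend_single[of 0 1] one by simp

lemma extend_mult: "extend \<chi> (p * q) = extend \<chi> p * extend \<chi> q"
proof -
  have "p * q = (\<Sum>a\<in>keys p. \<Sum>b\<in>keys q. single (a + b) (lookup p a * lookup q b))"
    by (subst (1) sum_singles[of p, symmetric], subst (1) sum_singles[of q, symmetric])
      (simp add: sum_product mult_single)
  then have "extend \<chi> (p * q) = (\<Sum>a\<in>keys p. \<Sum>b\<in>keys q. \<chi> a (lookup p a) * \<chi> b (lookup q b))"
    by (simp add: extend_sum mult)
  then show ?thesis by (simp add: extend_def sum_product)
qed

end

text \<open>
  The exponents of \<open>('n, 'k) mpoly\<close> carry no order, so the ring is embedded into one whose variables
  are natural numbers, where leading terms show that there are no zero divisors.
\<close>
lemma mpoly_mult_eq_0: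
  fixes p q :: "('n::finite, 'k::field) mpoly"
  assumes "p * q = 0"
  shows "p = 0 \<or> q = 0"
proof -
  obtain idx :: "'n \<Rightarrow> nat" where idx: "inj idx"
    using finite_imp_inj_to_nat_seg[of "UNIV :: 'n set"] by auto
  \<comment> \<open>renaming of the variables by numbers, on exponents\<close>
  define g where "g = (\<lambda>a :: 'n \<Rightarrow>\<^sub>0 nat. \<Sum>v\<in>UNIV. single (idx v) (lookup a v))"
  have g0: "g 0 = 0" by (simp add: g_def)
  have g_add: "g (a + b) = g a + g b" for a b
    by (simp add: g_def lookup_add single_add sum.distrib)
  have lg: "lookup (g a) (idx v) = lookup a v" for a v
  proof -
    have "lookup (g a) (idx v) = (\<Sum>w\<in>UNIV. if v = w then lookup a w else 0)"
      unfolding g_def lookup_sum using idx by (intro sum.cong) (auto simp: lookup_single when_def inj_eq)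
    then show ?thesis by simp
  qed
  have g_inj: "g a = g b \<Longrightarrow> a = b" for a b by (rule poly_mapping_eqI) (metis lg)
  interpret monomial_hom "\<lambda>a (c::'k). single (g a) c"
    by unfold_locales (simp_all add: single_add g_add mult_single g0)
  let ?h = "extend (\<lambda>a (c::'k). single (g a) c)"
  have h_inj: "r = 0" if "?h r = 0" for r :: "('n, 'k) mpoly"
  proof (rule poly_mapping_eqI)
    fix a
    have "lookup (?h r) (g a) = (\<Sum>b\<in>keys r. if a = b then lookup r b else 0)"
      unfolding extend_def lookup_sum using g_inj by (intro sum.cong) (auto simp: lookup_single when_def)
    also have "\<dots> = lookup r a" by (simp add: sum.delta' in_keys_iff)
    finally show "lookup r a = lookup 0 a" using that by simp
  qed
  have "?h p * ?h q = 0" using assms extend_mult[of p q] by simp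
  then have "?h p = 0 \<or> ?h q = 0" by simp
  then show ?thesis using h_inj by blast
qed

definition subst :: "('n::finite \<Rightarrow> ('n, 'k::field) mpoly) \<Rightarrow> ('n, 'k) mpoly \<Rightarrow> ('n, 'k) mpoly" where
  "subst \<sigma> = extend (\<lambda>a c. single 0 c * (\<Prod>v\<in>UNIV. \<sigma> v ^ lookup a v))"

interpretation subst: monomial_hom
  "\<lambda>a (c::'k::field). single 0 c * (\<Prod>v\<in>UNIV. \<sigma> v ^ lookup a v)" for \<sigma> :: "'n::finite \<Rightarrow> ('n, 'k::field) mpoly"
proof unfold_locales
  fix a b :: "'n \<Rightarrow>\<^sub>0 nat" and c d :: 'k
  have "single 0 (c * d) = (single 0 c * single 0 d :: ('n, 'k) mpoly)" by (simp add: mult_single)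
  then show "single 0 (c * d) * (\<Prod>v\<in>UNIV. \<sigma> v ^ lookup (a + b) v) =
    single 0 c * (\<Prod>v\<in>UNIV. \<sigma> v ^ lookup a v) * (single 0 d * (\<Prod>v\<in>UNIV. \<sigma> v ^ lookup b v))"
    by (simp add: lookup_add power_add prod.distrib mult_ac)
qed (simp_all add: single_add distrib_right)

lemmas subst_add = subst.extend_add[folded subst_def]
  and subst_mult = subst.extend_mult[folded subst_def]
  and subst_sum = subst.extend_sum[folded subst_def]
  and subst_one = subst.extend_one[folded subst_def]
  and subst_zero = subst.extend_zero[folded subst_def]

lemma subst_const: "subst \<sigma> (single 0 c) = single 0 c"
  unfolding subst_def subst.extend_single by simp

lemma subst_var: "subst \<sigma> (var w) = \<sigma> w"
proof -
  have "(\<Prod>v\<in>UNIV. \<sigma> v ^ lookup (single w 1) v) = (\<Prod>v\<in>UNIV. if w = v then \<sigma> v else 1)"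
    by (rule prod.cong) (auto simp: lookup_single when_def)
  then show ?thesis unfolding subst_def var_def monomial_def subst.extend_single by simp
qed

lemma diff_subst_mem:
  assumes J: "closed_ideal J" and "\<And>v. var v - \<sigma> v \<in> J"
  shows "p - subst \<sigma> p \<in> J"
proof (induction p rule: mpoly_induct)
  case (const c)
  then show ?case using closed_idealD(1)[OF J] by (simp add: subst_const)
next
  case (var v)
  then show ?case using assms(2) by (simp add: subst_var)
next
  case (add p q)
  have "(p + q) - subst \<sigma> (p + q) = (p - subst \<sigma> p) + (q - subst \<sigma> q)" by (simp add: subst_add)
  then show ?case using closed_idealD(2)[OF J] add by metis
next
  case (mult p q)
  have "p * q - subst \<sigma> (p * q) = p * (q - subst \<sigma> q) + (p - subst \<sigma> p) * subst \<sigma> q"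
    by (simp add: subst_mult algebra_simps)
  then show ?case using closed_idealD(2-4)[OF J] mult by metis
qed

definition mon_ideal :: "('n::finite \<Rightarrow>\<^sub>0 nat) set \<Rightarrow> ('n, 'k::field) mpoly set" where
  "mon_ideal U = {p. keys p \<subseteq> U}"

definition up_closed :: "('n::finite \<Rightarrow>\<^sub>0 nat) set \<Rightarrow> bool" where
  "up_closed U \<longleftrightarrow> (\<forall>a\<in>U. \<forall>b. a + b \<in> U)"

lemma closed_ideal_mon_ideal:
  fixes U :: "('n::finite \<Rightarrow>\<^sub>0 nat) set"
  assumes "up_closed U"
  shows "closed_ideal (mon_ideal U :: ('n, 'k::field) mpoly set)"
  unfolding closed_ideal_def mon_ideal_def
proof (intro conjI ballI allI)
  show "x + y \<in> {p. keys p \<subseteq> U}" if "x \<in> {p. keys p \<subseteq> U}" "y \<in> {p. keys p \<subseteq> U}" for x y :: "('n, 'k) mpoly"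
    using that keys_add[of x y] by blast
  show "r * x \<in> {p. keys p \<subseteq> U}" if "x \<in> {p. keys p \<subseteq> U}" for r x :: "('n, 'k) mpoly"
  proof -
    have "b + a \<in> U" if "a \<in> keys x" for a b
      using that \<open>x \<in> _\<close> assms unfolding up_closed_def by (metis add.commute mem_Collect_eq subsetD)
    then show ?thesis using keys_mult[of r x] by blast
  qed
qed simp

lemma mon_ideal_Int: "mon_ideal (U \<inter> U') = mon_ideal U \<inter> mon_ideal U'"
  by (auto simp: mon_ideal_def)

text \<open>
  Sort the terms of a polynomial by whether their exponent lies in \<open>U\<close>.
\<close>
lemma sum_set_mon_ideal:
  "sum_set (mon_ideal U) (mon_ideal U') = (mon_ideal (U \<union> U') :: ('n::finite, 'k::field) mpoly set)"
proof
  show "sum_set (mon_ideal U) (mon_ideal U') \<subseteq> (mon_ideal (U \<union> U') :: ('n, 'k) mpoly set)"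
    unfolding sum_set_def mon_ideal_def using keys_add by fastforce
  show "(mon_ideal (U \<union> U') :: ('n, 'k) mpoly set) \<subseteq> sum_set (mon_ideal U) (mon_ideal U')"
  proof
    fix p :: "('n, 'k) mpoly" assume p: "p \<in> mon_ideal (U \<union> U')"
    let ?s = "\<lambda>A. \<Sum>a\<in>A. single a (lookup p a)"
    have k: "keys (?s A) \<subseteq> A" for A
    proof
      fix k assume "k \<in> keys (?s A)"
      then have "(\<Sum>a\<in>A. lookup (single a (lookup p a)) k) \<noteq> 0" by (simp add: in_keys_iff lookup_sum)
      then obtain a where "a \<in> A" "lookup (single a (lookup p a)) k \<noteq> 0" by (rule sum.not_neutral_contains_not_neutral)
      then show "k \<in> A" by (simp add: lookup_single when_def split: if_splits)
    qed
    have "p = ?s (keys p \<inter> U) + ?s (keys p - U)"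
      using sum.Int_Diff[of "keys p" "\<lambda>a. single a (lookup p a)" U] sum_singles[of p] by simp
    also have "\<dots> \<in> sum_set (mon_ideal U) (mon_ideal U')"
    proof (rule sum_setI)
      show "?s (keys p \<inter> U) \<in> mon_ideal U" using k[of "keys p \<inter> U"] unfolding mon_ideal_def by blast
      have "keys p - U \<subseteq> U'" using p unfolding mon_ideal_def by blast
      then show "?s (keys p - U) \<in> mon_ideal U'" using k[of "keys p - U"] unfolding mon_ideal_def by blast
    qed
    finally show "p \<in> sum_set (mon_ideal U) (mon_ideal U')" .
  qed
qed

definition var_ideal :: "'n::finite set \<Rightarrow> ('n, 'k::field) mpoly set" where
  "var_ideal F = mon_ideal {a. \<exists>v\<in>F. lookup a v \<noteq> 0}"

lemma closed_ideal_var_ideal [simp]: "closed_ideal (var_ideal F)"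
  unfolding var_ideal_def by (rule closed_ideal_mon_ideal) (auto simp: up_closed_def lookup_add)

lemma sum_set_var_ideal: "sum_set (var_ideal F) (var_ideal F') = var_ideal (F \<union> F')"
  unfolding var_ideal_def sum_set_mon_ideal by (rule arg_cong[where f = mon_ideal]) auto

lemma var_ideal_empty: "var_ideal {} = {0}"
  unfolding var_ideal_def mon_ideal_def by auto

lemma var_ideal_mono: "F \<subseteq> F' \<Longrightarrow> var_ideal F \<subseteq> var_ideal F'"
  unfolding var_ideal_def mon_ideal_def by blast

lemma keys_var: "keys (var v :: ('n::finite, 'k::field) mpoly) = {single v 1}"
  by (simp add: var_def monomial_def)

lemma var_mem_var_ideal: "(var v :: ('n::finite, 'k::field) mpoly) \<in> var_ideal F \<longleftrightarrow> v \<in> F"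
  unfolding var_ideal_def mon_ideal_def by (auto simp: keys_var lookup_single when_def split: if_splits)

lemma var_ideal_subset_iff: "(var_ideal F :: ('n::finite, 'k::field) mpoly set) \<subseteq> var_ideal F' \<longleftrightarrow> F \<subseteq> F'"
  using var_ideal_mono var_mem_var_ideal by (metis subset_iff)

lemma var_ideal_inj: "(var_ideal F :: ('n::finite, 'k::field) mpoly set) = var_ideal F' \<longleftrightarrow> F = F'"
  by (metis var_ideal_subset_iff subset_antisym order_refl)

lemma mem_var_ideal_UNIV: "p \<in> var_ideal UNIV \<longleftrightarrow> lookup p 0 = 0"
proof -
  have "(\<exists>v. lookup a v \<noteq> 0) \<longleftrightarrow> a \<noteq> 0" for a :: "'n \<Rightarrow>\<^sub>0 nat" by (auto simp: poly_mapping_eq_iff fun_eq_iff)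
  then have "p \<in> var_ideal UNIV \<longleftrightarrow> 0 \<notin> keys p" by (auto simp: var_ideal_def mon_ideal_def)
  then show ?thesis by (simp add: in_keys_iff)
qed

lemma single_eq_mult_var:
  assumes "lookup a v \<noteq> 0"
  shows "(single a c :: ('n::finite, 'k::field) mpoly) = single (a - single v 1) c * var v"
proof -
  have "a = (a - single v 1) + single v 1"
    by (rule poly_mapping_eqI) (use assms in \<open>auto simp: lookup_add lookup_minus lookup_single when_def\<close>)
  then show ?thesis by (simp add: var_def monomial_def mult_single)
qed

lemma var_ideal_eq: "(var_ideal F :: ('n::finite, 'k::field) mpoly set) = {\<Sum>v\<in>F. g v * var v | g. True}"
proof
  have "p \<in> {\<Sum>v\<in>F. g v * var v | g. True}" if "p \<in> var_ideal F" for p :: "('n, 'k) mpoly"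
  proof -
    have "\<forall>a\<in>keys p. \<exists>v\<in>F. lookup a v \<noteq> 0" using that by (auto simp: var_ideal_def mon_ideal_def)
    then obtain w where w: "\<And>a. a \<in> keys p \<Longrightarrow> w a \<in> F \<and> lookup a (w a) \<noteq> 0" by metis
    define g where "g = (\<lambda>v. \<Sum>a\<in>{a\<in>keys p. w a = v}. single (a - single v 1) (lookup p a))"
    have "(\<Sum>v\<in>F. g v * var v) = (\<Sum>v\<in>F. \<Sum>a\<in>{a\<in>keys p. w a = v}. single a (lookup p a))"
      unfolding g_def sum_distrib_right
    proof (intro sum.cong refl)
      fix v a assume "a \<in> {a \<in> keys p. w a = v}"
      then have "lookup a v \<noteq> 0" using w by auto
      then show "single (a - single v 1) (lookup p a) * var v = single a (lookup p a)"
        by (rule single_eq_mult_var[symmetric])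
    qed
    also have "\<dots> = (\<Sum>a\<in>keys p. single a (lookup p a))"
      using w by (intro sum.group) auto
    finally show ?thesis using sum_singles[of p] by auto
  qed
  then show "(var_ideal F :: ('n, 'k) mpoly set) \<subseteq> {\<Sum>v\<in>F. g v * var v | g. True}" by blast
  show "{\<Sum>v\<in>F. g v * var v | g. True} \<subseteq> (var_ideal F :: ('n, 'k) mpoly set)"
    by (auto intro!: closed_ideal_sum closed_idealD(3) simp: var_mem_var_ideal)
qed

section \<open>Prime ideals generated by linear forms\<close>

definition colour_form :: "('n::finite \<Rightarrow> nat) \<Rightarrow> nat \<Rightarrow> ('n, 'k::field) mpoly" where
  "colour_form \<chi> a = (\<Sum>v | \<chi> v = a. var v)"

lemma sum_vars_eq_0:
  assumes "(\<Sum>v\<in>A. var v :: ('n::finite, 'k::field) mpoly) = 0"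
  shows "A = {}"
proof (rule ccontr)
  assume "A \<noteq> {}"
  then obtain w where w: "w \<in> A" by blast
  have "single v (1::nat) = single w 1 \<longleftrightarrow> v = w" for v w :: 'n
    by (metis lookup_single_eq lookup_single_not_eq zero_neq_one)
  then have "lookup (\<Sum>v\<in>A. var v :: ('n, 'k) mpoly) (single w 1) = (\<Sum>v\<in>A. if w = v then 1 else 0)"
    by (auto simp: lookup_sum var_def monomial_def lookup_single when_def intro!: sum.cong)
  also have "\<dots> = 1" using w by (simp add: sum.delta')
  finally show False using assms by simp
qed

lemma prime_set_kernel:
  fixes J :: "('n::finite, 'k::field) mpoly set"
  assumes "\<And>p. p \<in> J \<longleftrightarrow> subst \<sigma> p = 0" "closed_ideal J"
  shows "prime_set J"
  using assms mpoly_mult_eq_0 unfolding prime_set_def by (auto simp: subst_mult subst_one)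

text \<open>
  In each colour below \<open>a\<close> one variable outside \<open>F\<close> is eliminated by means of its colour form, and the
  variables in \<open>F\<close> are set to zero. The resulting substitution moves every polynomial only within its
  class modulo \<open>J\<close> and kills \<open>J\<close>, so \<open>J\<close> is its kernel, and it has values in a domain. Nonmembership in
  \<open>J\<close> can then be read off from the image.
\<close>
lemma colour_forms_prime:
  fixes F :: "'n::finite set" and \<chi> :: "'n \<Rightarrow> nat"
  assumes "\<And>b. b < a \<Longrightarrow> \<exists>v. \<chi> v = b \<and> v \<notin> F"
  defines "J \<equiv> (seq_ideal (var_ideal F) (colour_form \<chi>) a :: ('n, 'k::field) mpoly set)"
  shows "prime_set J"
    and "\<And>v. v \<notin> F \<Longrightarrow> a \<le> \<chi> v \<Longrightarrow> var v \<notin> J"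
    and "\<And>v. v \<notin> F \<Longrightarrow> a \<le> \<chi> v \<Longrightarrow> colour_form \<chi> (\<chi> v) \<notin> J"
    and "a < card (- F) \<Longrightarrow> \<exists>v. var v \<notin> J"
proof -
  obtain l where l: "\<And>b. b < a \<Longrightarrow> \<chi> (l b) = b \<and> l b \<notin> F" using assms(1) by metis
  define \<sigma> :: "'n \<Rightarrow> ('n, 'k) mpoly" where
    "\<sigma> v = (if v \<in> F then 0 else if \<chi> v < a \<and> v = l (\<chi> v) then - (\<Sum>w | \<chi> w = \<chi> v \<and> w \<notin> F \<and> w \<noteq> v. var w)
      else var v)" for v
  have cl: "closed_ideal J" unfolding J_def by (intro closed_ideal_seq_ideal) simp
  have inJ: "colour_form \<chi> b \<in> J" if "b < a" for b
    unfolding J_def using that by (intro seq_in_seq_ideal) auto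
  have varF: "var v \<in> J" if "v \<in> F" for v
    unfolding J_def by (rule subsetD[OF subset_seq_ideal]) (use that in \<open>simp add: var_mem_var_ideal\<close>)
  have rep: "var v - \<sigma> v \<in> J" for v
  proof -
    consider "v \<in> F" | "v \<notin> F" "\<chi> v < a" "v = l (\<chi> v)" | "\<sigma> v = var v"
      by (metis (mono_tags) \<sigma>_def)
    then show ?thesis
    proof cases
      case 1
      then show ?thesis using varF by (simp add: \<sigma>_def)
    next
      case 2
      have "{w. \<chi> w = \<chi> v} = insert v {w. \<chi> w = \<chi> v \<and> w \<notin> F \<and> w \<noteq> v} \<union> {w. \<chi> w = \<chi> v \<and> w \<in> F}"
        using 2 by auto
      then have "colour_form \<chi> (\<chi> v) = (\<Sum>w\<in>insert v {w. \<chi> w = \<chi> v \<and> w \<notin> F \<and> w \<noteq> v}. var w)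
          + (\<Sum>w | \<chi> w = \<chi> v \<and> w \<in> F. (var w :: ('n, 'k) mpoly))"
        unfolding colour_form_def using 2 by (simp only:) (rule sum.union_disjoint, auto)
      then have "var v - \<sigma> v = colour_form \<chi> (\<chi> v) - (\<Sum>w | \<chi> w = \<chi> v \<and> w \<in> F. var w)"
        using 2 by (simp add: \<sigma>_def)
      moreover have "(\<Sum>w | \<chi> w = \<chi> v \<and> w \<in> F. var w) \<in> J" by (rule closed_ideal_sum[OF cl]) (use varF in auto)
      ultimately show ?thesis using closed_idealD(6)[OF cl inJ[OF 2(2)]] by metis
    next
      case 3
      then show ?thesis using closed_idealD(1)[OF cl] by simp
    qed
  qed
  have split_form: "subst \<sigma> (colour_form \<chi> b) = (\<Sum>v | \<chi> v = b \<and> v \<notin> F. \<sigma> v)" for b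
  proof -
    have "subst \<sigma> (colour_form \<chi> b) = (\<Sum>v | \<chi> v = b. \<sigma> v)" by (simp add: colour_form_def subst_sum subst_var)
    also have "\<dots> = (\<Sum>v | \<chi> v = b \<and> v \<notin> F. \<sigma> v)" by (rule sum.mono_neutral_right) (auto simp: \<sigma>_def)
    finally show ?thesis .
  qed
  have kill: "subst \<sigma> (colour_form \<chi> b) = 0" if b: "b < a" for b
  proof -
    let ?B = "{w. \<chi> w = b \<and> w \<notin> F \<and> w \<noteq> l b}"
    have "{v. \<chi> v = b \<and> v \<notin> F} = insert (l b) ?B" using l[OF b] by auto
    then have "subst \<sigma> (colour_form \<chi> b) = \<sigma> (l b) + (\<Sum>v\<in>?B. \<sigma> v)" unfolding split_form by simp
    also have "(\<Sum>v\<in>?B. \<sigma> v) = (\<Sum>v\<in>?B. var v)" by (rule sum.cong) (auto simp: \<sigma>_def)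
    also have "\<sigma> (l b) = - (\<Sum>v\<in>?B. var v)" using l[OF b] b by (simp add: \<sigma>_def)
    finally show ?thesis by simp
  qed
  have ker: "p \<in> J \<longleftrightarrow> subst \<sigma> p = 0" for p
  proof
    assume "subst \<sigma> p = 0"
    then show "p \<in> J" using diff_subst_mem[OF cl rep, of p] by simp
  next
    let ?Z = "{p. subst \<sigma> p = 0}"
    have Z: "closed_ideal ?Z" by (auto simp: closed_ideal_def subst_zero subst_add subst_mult)
    have "var_ideal F \<subseteq> ?Z"
      unfolding var_ideal_eq by (auto simp: subst_sum subst_mult subst_var \<sigma>_def)
    then have "J \<subseteq> ?Z" unfolding J_def using kill by (intro seq_ideal_least[OF Z]) auto
    then show "p \<in> J \<Longrightarrow> subst \<sigma> p = 0" by blast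
  qed
  show "prime_set J" by (rule prime_set_kernel[OF ker cl])
  have var0: "var v \<noteq> (0 :: ('n, 'k) mpoly)" for v using sum_vars_eq_0[of "{v}"] by auto
  show "var v \<notin> J" if "v \<notin> F" "a \<le> \<chi> v" for v
    using that var0 by (simp add: ker subst_var \<sigma>_def)
  show "colour_form \<chi> (\<chi> v) \<notin> J" if "v \<notin> F" "a \<le> \<chi> v" for v
  proof -
    have "subst \<sigma> (colour_form \<chi> (\<chi> v)) = (\<Sum>w | \<chi> w = \<chi> v \<and> w \<notin> F. var w)"
      unfolding split_form by (rule sum.cong) (use that in \<open>auto simp: \<sigma>_def\<close>)
    then show ?thesis using sum_vars_eq_0[of "{w. \<chi> w = \<chi> v \<and> w \<notin> F}"] that unfolding ker by auto
  qed
  show "\<exists>v. var v \<notin> J" if "a < card (- F)"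
  proof -
    have "card (l ` {..<a}) \<le> a" using card_image_le[of "{..<a}" l] by simp
    then have "\<not> - F \<subseteq> l ` {..<a}" using that card_mono[of "l ` {..<a}" "- F"] by auto
    then obtain v where v: "v \<notin> F" "v \<notin> l ` {..<a}" by blast
    then have "\<sigma> v = var v" unfolding \<sigma>_def by auto
    then have "var v \<notin> J" using var0 by (simp add: ker subst_var)
    then show ?thesis by blast
  qed
qed

lemma prime_set_var_ideal: "prime_set (var_ideal F :: ('n::finite, 'k::field) mpoly set)"
  using colour_forms_prime(1)[of 0 "\<lambda>_. 0" F] by simp

section \<open>Ideals, depth and height in the polynomial ring\<close>

lemma mpoly_ring_simps [simp]:
  "carrier (mpoly_ring :: ('n::finite, 'k::field) mpoly ring) = UNIV"
  "monoid.mult (mpoly_ring :: ('n::finite, 'k::field) mpoly ring) = (*)"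
  "one (mpoly_ring :: ('n::finite, 'k::field) mpoly ring) = 1"
  "zero (mpoly_ring :: ('n::finite, 'k::field) mpoly ring) = 0"
  "add (mpoly_ring :: ('n::finite, 'k::field) mpoly ring) = (+)"
  by (simp_all add: mpoly_ring_def ring_of_type_algebra_def)

lemma cring_mpoly_ring: "cring (mpoly_ring :: ('n::finite, 'k::field) mpoly ring)"
  unfolding mpoly_ring_def by (rule cring_from_type_algebra)

lemma ring_mpoly_ring: "ring (mpoly_ring :: ('n::finite, 'k::field) mpoly ring)"
  using cring_mpoly_ring by (rule cring.axioms)

lemma ideal_iff_closed_ideal:
  fixes J :: "('n::finite, 'k::field) mpoly set"
  shows "ideal J mpoly_ring \<longleftrightarrow> closed_ideal J"
proof
  assume "ideal J mpoly_ring"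
  then interpret J: ideal J "mpoly_ring :: ('n, 'k) mpoly ring" .
  note sub = J.additive_subgroup_axioms
  show "closed_ideal J"
    unfolding closed_ideal_def
  proof (intro conjI ballI allI)
    show "0 \<in> J" using additive_subgroup.zero_closed[OF sub] by simp
    show "x + y \<in> J" if "x \<in> J" "y \<in> J" for x y
      using additive_subgroup.a_closed[OF sub that] by simp
    show "r * x \<in> J" if "x \<in> J" for r x
      using J.I_l_closed[OF that, of r] by simp
  qed
next
  assume J: "closed_ideal J"
  interpret R: cring "mpoly_ring :: ('n, 'k) mpoly ring" by (rule cring_mpoly_ring)
  have neg: "inv\<^bsub>add_monoid (mpoly_ring :: ('n, 'k) mpoly ring)\<^esub> x = - x" for x
    unfolding a_inv_def[symmetric] by (rule R.minus_equality) simp_all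
  show "ideal J mpoly_ring"
  proof (rule idealI[OF ring_mpoly_ring])
    show "subgroup J (add_monoid mpoly_ring)"
      using closed_idealD[OF J] by unfold_locales (simp_all add: neg[simplified])
  qed (use closed_idealD[OF J] in simp_all)
qed

lemma primeideal_iff_prime_set:
  fixes Q :: "('n::finite, 'k::field) mpoly set"
  shows "primeideal Q mpoly_ring \<longleftrightarrow> prime_set Q"
proof
  assume "primeideal Q mpoly_ring"
  then interpret Q: primeideal Q "mpoly_ring :: ('n, 'k) mpoly ring" .
  have "1 \<notin> Q" using Q.one_imp_carrier Q.I_notcarr by auto
  then show "prime_set Q"
    using Q.I_prime Q.is_ideal unfolding prime_set_def ideal_iff_closed_ideal by simp
next
  assume "prime_set Q"
  then show "primeideal Q mpoly_ring"
    by (intro primeidealI cring_mpoly_ring) (auto simp: ideal_iff_closed_ideal prime_set_def)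
qed

lemma Idl_eqI:
  fixes J :: "('n::finite, 'k::field) mpoly set"
  assumes "closed_ideal J" "A \<subseteq> J" "\<And>K. closed_ideal K \<Longrightarrow> A \<subseteq> K \<Longrightarrow> J \<subseteq> K"
  shows "Idl\<^bsub>mpoly_ring\<^esub> A = J"
  using assms unfolding genideal_def ideal_iff_closed_ideal by blast

lemma Idl_least:
  fixes K :: "('n::finite, 'k::field) mpoly set"
  assumes "closed_ideal K" "A \<subseteq> K"
  shows "Idl\<^bsub>mpoly_ring\<^esub> A \<subseteq> K"
  using assms unfolding genideal_def ideal_iff_closed_ideal by blast

lemma Idl_superset: "A \<subseteq> Idl\<^bsub>mpoly_ring\<^esub> (A :: ('n::finite, 'k::field) mpoly set)"
  unfolding genideal_def by blast

lemma var_ideal_least: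
  assumes "closed_ideal K" "\<And>v. v \<in> F \<Longrightarrow> var v \<in> K"
  shows "var_ideal F \<subseteq> K"
  unfolding var_ideal_eq by (auto intro!: closed_ideal_sum closed_idealD(3) assms)

lemma max_ideal_eq: "(max_ideal :: ('n::finite, 'k::field) mpoly set) = var_ideal UNIV"
  unfolding max_ideal_def
proof (rule Idl_eqI)
  show "range var \<subseteq> (var_ideal UNIV :: ('n, 'k) mpoly set)" by (auto simp: var_mem_var_ideal)
  show "var_ideal UNIV \<subseteq> K" if "closed_ideal K" "range var \<subseteq> K" for K :: "('n, 'k) mpoly set"
    using that by (intro var_ideal_least) auto
qed simp

lemma ideal_sum_var_ideals:
  "ideal_sum mpoly_ring (var_ideal ` \<F>) = (var_ideal (\<Union>\<F>) :: ('n::finite, 'k::field) mpoly set)"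
  unfolding ideal_sum_def
proof (rule Idl_eqI)
  show "\<Union> (var_ideal ` \<F>) \<subseteq> (var_ideal (\<Union>\<F>) :: ('n, 'k) mpoly set)"
    by (intro UN_least var_ideal_mono) blast
next
  fix K :: "('n, 'k) mpoly set"
  assume K: "closed_ideal K" "\<Union> (var_ideal ` \<F>) \<subseteq> K"
  have "var v \<in> K" if "v \<in> F" "F \<in> \<F>" for v F
    using K(2) that var_mem_var_ideal[of v F] by blast
  then show "var_ideal (\<Union>\<F>) \<subseteq> K" using K(1) by (intro var_ideal_least) auto
qed simp

lemma set_add_eq: "J <+>\<^bsub>mpoly_ring\<^esub> J' = sum_set J (J' :: ('n::finite, 'k::field) mpoly set)"
  unfolding set_add_def' sum_set_def by auto

lemma ideal_as_module_simps [simp]: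
  "carrier (ideal_as_module mpoly_ring M) = M"
  "a \<odot>\<^bsub>ideal_as_module mpoly_ring M\<^esub> x = a * (x :: ('n::finite, 'k::field) mpoly)"
  by (simp_all add: ideal_as_module_def)

lemma submodule_iff:
  fixes M :: "('n::finite, 'k::field) mpoly set"
  assumes "closed_ideal M"
  shows "submodule N mpoly_ring (ideal_as_module mpoly_ring M) \<longleftrightarrow> closed_ideal N \<and> N \<subseteq> M"
proof
  assume "submodule N mpoly_ring (ideal_as_module mpoly_ring M)"
  then interpret N: submodule N "mpoly_ring :: ('n, 'k) mpoly ring" "ideal_as_module mpoly_ring M" .
  show "closed_ideal N \<and> N \<subseteq> M"
    using N.subset N.one_closed N.m_closed N.smult_closed
    unfolding closed_ideal_def by (auto simp: ideal_as_module_def)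
next
  assume N: "closed_ideal N \<and> N \<subseteq> M"
  let ?G = "add_monoid (ideal_as_module mpoly_ring M)"
  have G: "carrier ?G = M" "monoid.mult ?G = (+)" "one ?G = 0"
    by (simp_all add: ideal_as_module_def)
  have neg: "inv\<^bsub>?G\<^esub> x = - x" if "x \<in> M" for x
    unfolding m_inv_def G
  proof (rule the_equality)
    show "- x \<in> M \<and> x + - x = 0 \<and> - x + x = 0" using that closed_idealD[OF assms] by simp
    show "y = - x" if "y \<in> M \<and> x + y = 0 \<and> y + x = 0" for y using that by (metis add_eq_0_iff)
  qed
  show "submodule N mpoly_ring (ideal_as_module mpoly_ring M)"
  proof (intro submodule.intro subgroup.intro submodule_axioms.intro)
    show "inv\<^bsub>?G\<^esub> x \<in> N" if "x \<in> N" for x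
      using that N neg closed_idealD(5)[of N] by auto
  qed (use N closed_idealD[of N] in \<open>auto simp: ideal_as_module_def\<close>)
qed

lemma ideal_smult_eq_seq_mult:
  fixes M :: "('n::finite, 'k::field) mpoly set"
  assumes M: "closed_ideal M"
  shows "ideal_smult mpoly_ring (Idl\<^bsub>mpoly_ring\<^esub> (set fs)) (ideal_as_module mpoly_ring M)
    = seq_mult ((!) fs) (length fs) M"
  (is "?L = ?N")
proof
  have N: "closed_ideal ?N" by (rule closed_ideal_seq_mult[OF M])
  have "closed_ideal {a. \<forall>x\<in>M. a * x \<in> ?N}"
    using closed_idealD[OF N] closed_idealD[OF M] by (auto simp: closed_ideal_def distrib_right mult.assoc)
  moreover have "set fs \<subseteq> {a. \<forall>x\<in>M. a * x \<in> ?N}"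
  proof
    fix a assume "a \<in> set fs"
    then obtain i where i: "i < length fs" "a = fs ! i" by (auto simp: in_set_conv_nth)
    have "a * x \<in> ?N" if "x \<in> M" for x
    proof -
      have "a * x = (\<Sum>j<length fs. fs ! j * (if i = j then x else 0))"
        using i by (simp add: if_distrib sum.delta' cong: if_cong)
      then show ?thesis unfolding seq_mult_def using that closed_idealD(1)[OF M]
        by (intro CollectI exI[of _ "\<lambda>j. if i = j then x else 0"]) auto
    qed
    then show "a \<in> {a. \<forall>x\<in>M. a * x \<in> ?N}" by blast
  qed
  ultimately have "Idl\<^bsub>mpoly_ring\<^esub> (set fs) \<subseteq> {a. \<forall>x\<in>M. a * x \<in> ?N}" by (rule Idl_least)
  then have "\<forall>a\<in>Idl\<^bsub>mpoly_ring\<^esub> (set fs). \<forall>x\<in>M. a * x \<in> ?N" by blast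
  then show "?L \<subseteq> ?N"
    unfolding ideal_smult_def submodule_iff[OF M] ideal_as_module_simps
    using N seq_mult_subset[OF M, of "(!) fs" "length fs"] by blast
  show "?N \<subseteq> ?L"
  proof -
    have "?N \<subseteq> N" if N: "closed_ideal N" "\<forall>a\<in>Idl\<^bsub>mpoly_ring\<^esub> (set fs). \<forall>x\<in>M. a * x \<in> N" for N
    proof -
      have "fs ! i \<in> Idl\<^bsub>mpoly_ring\<^esub> (set fs)" if "i < length fs" for i
        using Idl_superset that nth_mem by (metis subsetD)
      then show ?thesis unfolding seq_mult_def using N by (auto intro!: closed_ideal_sum)
    qed
    then show ?thesis unfolding ideal_smult_def submodule_iff[OF M] by auto
  qed
qed

lemma regular_seq_iff:
  fixes M :: "('n::finite, 'k::field) mpoly set"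
  assumes M: "closed_ideal M"
  shows "regular_seq mpoly_ring (ideal_as_module mpoly_ring M) fs \<longleftrightarrow>
    regular_on M ((!) fs) (length fs) \<and> seq_mult ((!) fs) (length fs) M \<noteq> M"
proof -
  have "seq_mult ((!) (take i fs)) (length (take i fs)) M = seq_mult ((!) fs) i M" if "i < length fs" for i
  proof -
    have "length (take i fs) = i" using that by simp
    moreover have "seq_mult ((!) (take i fs)) i M = seq_mult ((!) fs) i M" by (rule seq_mult_cong) simp
    ultimately show ?thesis by simp
  qed
  then show ?thesis
    unfolding regular_seq_def regular_on_def ideal_smult_eq_seq_mult[OF M] by auto
qed

lemma depth_le:
  fixes M :: "('n::finite, 'k::field) mpoly set"
  assumes M: "closed_ideal M"
    and "\<And>f d. (\<And>i. i < d \<Longrightarrow> f i \<in> var_ideal UNIV) \<Longrightarrow> regular_on M f d \<Longrightarrow> d \<le> b"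
  shows "depth mpoly_ring max_ideal (ideal_as_module mpoly_ring M) \<le> enat b"
  unfolding depth_def
proof (rule Sup_least)
  fix e assume "e \<in> {enat (length fs) |fs. set fs \<subseteq> max_ideal \<and> regular_seq mpoly_ring (ideal_as_module mpoly_ring M) fs}"
  then obtain fs where "e = enat (length fs)" "set fs \<subseteq> var_ideal UNIV" "regular_on M ((!) fs) (length fs)"
    unfolding max_ideal_eq regular_seq_iff[OF M] by blast
  then show "e \<le> enat b" using assms(2)[of "length fs" "(!) fs"] nth_mem by fastforce
qed

lemma regular_on_cong:
  assumes "\<And>i. i < d \<Longrightarrow> f i = g i"
  shows "regular_on M f d \<longleftrightarrow> regular_on M g d"
proof -
  have "f i = g i \<and> seq_mult f i M = seq_mult g i M" if "i < d" for i
    using assms that by (auto intro!: seq_mult_cong)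
  then show ?thesis unfolding regular_on_def by (metis (no_types))
qed

lemma depth_ge:
  fixes M :: "('n::finite, 'k::field) mpoly set"
  assumes M: "closed_ideal M"
    and "\<And>i. i < d \<Longrightarrow> f i \<in> var_ideal UNIV" "regular_on M f d" "seq_mult f d M \<noteq> M"
  shows "enat d \<le> depth mpoly_ring max_ideal (ideal_as_module mpoly_ring M)"
proof -
  let ?fs = "map f [0..<d]"
  have "regular_seq mpoly_ring (ideal_as_module mpoly_ring M) ?fs"
    unfolding regular_seq_iff[OF M] using assms regular_on_cong[of d "(!) ?fs" f M] seq_mult_cong[of d "(!) ?fs" f M]
    by simp
  moreover have "set ?fs \<subseteq> max_ideal" unfolding max_ideal_eq using assms(2) by auto
  ultimately have "enat (length ?fs) \<in> {enat (length fs) |fs. set fs \<subseteq> max_ideal \<and> regular_seq mpoly_ring (ideal_as_module mpoly_ring M) fs}"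
    by blast
  then show ?thesis unfolding depth_def by (intro Sup_upper) simp
qed

text \<open>
  Nakayama's lemma by degrees: an exponent of least degree in \<open>U\<close> cannot occur in a product of an
  element of the ideal with a polynomial without constant term.
\<close>
lemma seq_mult_mon_ideal_neq:
  fixes U :: "('n::finite \<Rightarrow>\<^sub>0 nat) set" and f :: "nat \<Rightarrow> ('n, 'k::field) mpoly"
  assumes U: "up_closed U" "U \<noteq> {}" and f: "\<And>i. i < d \<Longrightarrow> f i \<in> var_ideal UNIV"
  shows "seq_mult f d (mon_ideal U) \<noteq> mon_ideal U"
proof -
  let ?deg = "\<lambda>a :: 'n \<Rightarrow>\<^sub>0 nat. \<Sum>v\<in>UNIV. lookup a v"
  obtain a where a: "a \<in> U" "\<And>b. b \<in> U \<Longrightarrow> ?deg a \<le> ?deg b"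
    using ex_has_least_nat[of "\<lambda>a. a \<in> U" _ ?deg] U(2) by blast
  let ?K = "{p :: ('n, 'k) mpoly. p \<in> mon_ideal U \<and> lookup p a = 0}"
  have prod: "lookup (f i * y) a = 0" if "i < d" "y \<in> mon_ideal U" for i y
  proof (rule ccontr)
    assume "lookup (f i * y) a \<noteq> 0"
    then have "a \<in> keys (f i * y)" by (simp add: in_keys_iff)
    then obtain b c where bc: "a = b + c" "b \<in> keys (f i)" "c \<in> keys y" using keys_mult[of "f i" y] by blast
    have "c \<in> U" using bc(3) that(2) by (auto simp: mon_ideal_def)
    moreover have "b \<noteq> 0" using bc(2) f[OF that(1)] by (auto simp: mem_var_ideal_UNIV in_keys_iff)
    then obtain v where v: "lookup b v \<noteq> 0" by (auto simp: poly_mapping_eq_iff fun_eq_iff)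
    have "?deg c < ?deg a"
      unfolding bc(1) lookup_add by (rule sum_strict_mono_ex1) (use v in auto)
    ultimately show False using a(2) by (meson leD)
  qed
  have "lookup p a = 0" if "p \<in> seq_mult f d (mon_ideal U)" for p
    using that prod unfolding seq_mult_def by (auto simp: lookup_sum)
  moreover have "single a 1 \<in> (mon_ideal U :: ('n, 'k) mpoly set)" using a(1) by (simp add: mon_ideal_def)
  moreover have "lookup (single a (1::'k)) a \<noteq> 0" by simp
  ultimately show ?thesis by metis
qed

lemma exists_var_chain:
  fixes F :: "'n::finite set"
  obtains T where "T 0 = F" "T (card (- F)) = UNIV" "\<And>i. i < card (- F) \<Longrightarrow> T i \<subset> T (Suc i)"
proof -
  obtain g where g: "bij_betw g {..<card (- F)} (- F)"
    using ex_bij_betw_nat_finite[of "- F"] by (auto simp: atLeast0LessThan)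
  define T where "T = (\<lambda>i. F \<union> g ` {..<i})"
  have im: "g ` {..<card (- F)} = - F" and inj: "inj_on g {..<card (- F)}" using g by (auto simp: bij_betw_def)
  show thesis
  proof
    show "T 0 = F" "T (card (- F)) = UNIV" by (auto simp: T_def im)
    show "T i \<subset> T (Suc i)" if i: "i < card (- F)" for i
    proof -
      have "g i \<notin> F" using im i by auto
      moreover have "g i \<notin> g ` {..<i}" using inj i by (fastforce simp: inj_on_def)
      ultimately show ?thesis by (auto simp: T_def lessThan_Suc)
    qed
  qed
qed

text \<open>
  The chain of ideals generated by more and more variables. As subtraction on \<open>enat\<close> stops at zero,
  the bound gives \<open>n - h = 0\<close> in bigsize.
\<close>
lemma le_ideal_height_max_ideal:
  "enat CARD('n) \<le> ideal_height mpoly_ring (max_ideal :: ('n::finite, 'k::field) mpoly set)"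
  unfolding ideal_height_def
proof (rule Inf_greatest)
  fix e assume "e \<in> {prime_height mpoly_ring P | P. primeideal P mpoly_ring \<and> (max_ideal :: ('n, 'k) mpoly set) \<subseteq> P}"
  then obtain P :: "('n, 'k) mpoly set" where P: "e = prime_height mpoly_ring P" "prime_set P" "var_ideal UNIV \<subseteq> P"
    unfolding max_ideal_eq primeideal_iff_prime_set by blast
  have "P \<subseteq> var_ideal UNIV"
  proof
    fix p assume p: "p \<in> P"
    let ?c = "lookup p 0"
    have "p - single 0 ?c \<in> var_ideal UNIV" by (simp add: mem_var_ideal_UNIV lookup_minus)
    then have "single 0 ?c \<in> P" using P(3) p closed_idealD(6)[OF prime_setD(1)[OF P(2)], of p "p - single 0 ?c"] by auto
    then have "single 0 (inverse ?c) * single 0 ?c \<in> P" using closed_idealD(3)[OF prime_setD(1)[OF P(2)]] by blast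
    then have "?c = 0" using prime_setD(2)[OF P(2)] by (cases "?c = 0") (auto simp: mult_single)
    then show "p \<in> var_ideal UNIV" by (simp add: mem_var_ideal_UNIV)
  qed
  then have P': "P = var_ideal UNIV" using P(3) by blast
  obtain T :: "nat \<Rightarrow> 'n set" where T: "T 0 = {}" "T CARD('n) = UNIV" "\<And>i. i < CARD('n) \<Longrightarrow> T i \<subset> T (Suc i)"
    using exists_var_chain[of "{}"] by auto
  have "prime_chain mpoly_ring (\<lambda>i. var_ideal (T i) :: ('n, 'k) mpoly set) CARD('n)"
    using T(3) unfolding prime_chain_def
    by (auto simp: primeideal_iff_prime_set prime_set_var_ideal psubset_eq var_ideal_subset_iff var_ideal_inj)
  moreover have "(\<lambda>i. var_ideal (T i)) CARD('n) = P" using P' T(2) by simp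
  ultimately have "enat CARD('n) \<in> {enat d | d p. prime_chain mpoly_ring p d \<and> p d = P}"
    unfolding mem_Collect_eq by metis
  then show "enat CARD('n) \<le> e" unfolding P(1) prime_height_def by (rule Sup_upper)
qed

lemma coset_eq_iff:
  fixes J :: "('n::finite, 'k::field) mpoly set"
  assumes "closed_ideal J"
  shows "J +>\<^bsub>mpoly_ring\<^esub> x = J +>\<^bsub>mpoly_ring\<^esub> y \<longleftrightarrow> x - y \<in> J"
proof -
  have mem: "z \<in> J +>\<^bsub>mpoly_ring\<^esub> x \<longleftrightarrow> z - x \<in> J" for z x
  proof
    assume "z \<in> J +>\<^bsub>mpoly_ring\<^esub> x"
    then obtain j where "j \<in> J" "z = j + x" unfolding a_r_coset_def' by auto
    then show "z - x \<in> J" by simp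
  next
    assume "z - x \<in> J"
    moreover have "z = (z - x) + x" by simp
    ultimately show "z \<in> J +>\<^bsub>mpoly_ring\<^esub> x" unfolding a_r_coset_def' mpoly_ring_simps by blast
  qed
  show ?thesis
  proof
    assume "J +>\<^bsub>mpoly_ring\<^esub> x = J +>\<^bsub>mpoly_ring\<^esub> y"
    then have "x \<in> J +>\<^bsub>mpoly_ring\<^esub> y" using mem[of x x] closed_idealD(1)[OF assms] by simp
    then show "x - y \<in> J" by (simp add: mem)
  next
    assume xy: "x - y \<in> J"
    have "z - x \<in> J \<longleftrightarrow> z - y \<in> J" for z
      using closed_idealD(2)[OF assms _ xy, of "z - x"] closed_idealD(6)[OF assms _ xy, of "z - y"] by auto
    then show "J +>\<^bsub>mpoly_ring\<^esub> x = J +>\<^bsub>mpoly_ring\<^esub> y" using mem by blast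
  qed
qed

text \<open>
  Carries a chain of primes above \<open>J\<close> over to the quotient; the second part keeps it strict.
\<close>
lemma primeideal_Quot_image:
  fixes J :: "('n::finite, 'k::field) mpoly set"
  assumes J: "closed_ideal J" and P: "prime_set P" "J \<subseteq> P"
  defines "\<pi> \<equiv> (\<lambda>x. J +>\<^bsub>mpoly_ring\<^esub> x)"
  shows "primeideal (\<pi> ` P) (mpoly_ring Quot J)" and "\<And>x. \<pi> x \<in> \<pi> ` P \<longleftrightarrow> x \<in> P"
proof -
  have iJ: "ideal J mpoly_ring" using J by (simp add: ideal_iff_closed_ideal)
  interpret J: ideal J "mpoly_ring :: ('n, 'k) mpoly ring" by (rule iJ)
  have cP: "closed_ideal P" by (rule prime_setD(1)[OF P(1)])
  show mem: "\<pi> x \<in> \<pi> ` P \<longleftrightarrow> x \<in> P" for x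
  proof
    assume "\<pi> x \<in> \<pi> ` P"
    then obtain y where y: "y \<in> P" "x - y \<in> J" unfolding \<pi>_def using coset_eq_iff[OF J] by blast
    then have "(x - y) + y \<in> P" using P(2) closed_idealD(2)[OF cP] by blast
    then show "x \<in> P" by simp
  qed auto
  have car: "carrier (mpoly_ring Quot J) = range \<pi>"
    unfolding FactRing_def A_RCOSETS_def' \<pi>_def by auto
  show "primeideal (\<pi> ` P) (mpoly_ring Quot J)"
  proof (rule primeidealI)
    show "ideal (\<pi> ` P) (mpoly_ring Quot J)"
      unfolding \<pi>_def using ring.ring_ideal_imp_quot_ideal[OF ring_mpoly_ring iJ, of P] cP
      by (simp add: ideal_iff_closed_ideal)
    show "cring (mpoly_ring Quot J)" by (rule J.quotient_is_cring[OF cring_mpoly_ring])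
    show "carrier (mpoly_ring Quot J) \<noteq> \<pi> ` P"
      using mem[of 1] prime_setD(2)[OF P(1)] unfolding car by blast
    fix a b assume ab: "a \<in> carrier (mpoly_ring Quot J)" "b \<in> carrier (mpoly_ring Quot J)"
      "a \<otimes>\<^bsub>mpoly_ring Quot J\<^esub> b \<in> \<pi> ` P"
    obtain x y where xy: "a = \<pi> x" "b = \<pi> y" using ab unfolding car by blast
    have "a \<otimes>\<^bsub>mpoly_ring Quot J\<^esub> b = \<pi> (x * y)"
      unfolding xy \<pi>_def using ring_hom_mult[OF J.rcos_ring_hom, of x y] by simp
    then have "x * y \<in> P" using ab(3) mem by simp
    then show "a \<in> \<pi> ` P \<or> b \<in> \<pi> ` P" unfolding xy mem using prime_setD(3)[OF P(1)] by blast
  qed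
qed

lemma le_krull_dim_Quot_var_ideal:
  "enat (card (- F)) \<le> krull_dim (mpoly_ring Quot (var_ideal F :: ('n::finite, 'k::field) mpoly set))"
proof -
  let ?J = "var_ideal F :: ('n, 'k) mpoly set"
  let ?pi = "\<lambda>x. ?J +>\<^bsub>mpoly_ring\<^esub> x"
  obtain T where T: "T 0 = F" "T (card (- F)) = UNIV" "\<And>i. i < card (- F) \<Longrightarrow> T i \<subset> T (Suc i)"
    using exists_var_chain[of F] by blast
  have FT: "F \<subseteq> T i" if "i \<le> card (- F)" for i
    using that
  proof (induction i)
    case (Suc i)
    then show ?case using T(3)[of i] by auto
  qed (use T(1) in simp)
  have "prime_chain (mpoly_ring Quot ?J) (\<lambda>i. ?pi ` var_ideal (T i)) (card (- F))"
    unfolding prime_chain_def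
  proof (intro conjI allI impI)
    show "primeideal (?pi ` var_ideal (T i)) (mpoly_ring Quot ?J)" if "i \<le> card (- F)" for i
      by (rule primeideal_Quot_image) (simp_all add: prime_set_var_ideal var_ideal_mono FT that)
    show "?pi ` var_ideal (T i) \<subset> ?pi ` var_ideal (T (Suc i))" if i: "i < card (- F)" for i
    proof -
      have sub: "var_ideal (T i) \<subseteq> (var_ideal (T (Suc i)) :: ('n, 'k) mpoly set)"
        using T(3)[OF i] by (intro var_ideal_mono) auto
      obtain v where v: "v \<in> T (Suc i)" "v \<notin> T i" using T(3)[OF i] by blast
      have "?pi (var v) \<notin> ?pi ` var_ideal (T i)"
        using primeideal_Quot_image(2)[of ?J "var_ideal (T i)" "var v"] v FT[of i] i
        by (simp add: prime_set_var_ideal var_ideal_mono var_mem_var_ideal)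
      moreover have "?pi (var v) \<in> ?pi ` var_ideal (T (Suc i))"
        using v(1) by (intro imageI) (simp add: var_mem_var_ideal)
      ultimately show ?thesis using sub by blast
    qed
  qed
  then show ?thesis unfolding krull_dim_def by (intro Sup_upper) blast
qed

section \<open>Krull dimension\<close>

interpretation mpoly_space: vector_space "\<lambda>(c::'k::field) (p::('n::finite, 'k) mpoly). single 0 c * p"
  by unfold_locales (simp_all add: distrib_left distrib_right single_add mult_single mult.assoc[symmetric])

text \<open>
  The polynomials are indexed by \<open>A\<close> because the products of powers to which this is applied may
  coincide for different exponents.
\<close>
lemma linear_relation:
  fixes \<phi> :: "'i \<Rightarrow> ('n::finite, 'k::field) mpoly"
  assumes T: "finite T" and A: "finite A" and card: "card T < card A"
    and keys: "\<And>x. x \<in> A \<Longrightarrow> keys (\<phi> x) \<subseteq> T"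
  obtains c where "\<exists>x\<in>A. c x \<noteq> 0" "(\<Sum>x\<in>A. single 0 (c x) * \<phi> x) = 0"
proof (cases "inj_on \<phi> A")
  case False
  then obtain x y where xy: "x \<in> A" "y \<in> A" "x \<noteq> y" "\<phi> x = \<phi> y" by (auto simp: inj_on_def)
  define c where "c = (\<lambda>z. if z = x then 1 else if z = y then - 1 else (0::'k))"
  have "(\<Sum>z\<in>A. single 0 (c z) * \<phi> z) = (\<Sum>z\<in>{x, y}. single 0 (c z) * \<phi> z)"
    using xy A by (intro sum.mono_neutral_right) (auto simp: c_def)
  also have "\<dots> = 0" using xy by (simp add: c_def single_uminus)
  finally have rel: "(\<Sum>z\<in>A. single 0 (c z) * \<phi> z) = 0" .
  have "c x \<noteq> 0" by (simp add: c_def)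
  then show ?thesis using that[OF _ rel] xy(1) by blast
next
  case True
  let ?B = "(\<lambda>a. single a 1) ` T :: ('n, 'k) mpoly set"
  have sp: "\<phi> ` A \<subseteq> mpoly_space.span ?B"
  proof
    fix p assume "p \<in> \<phi> ` A"
    then have k: "keys p \<subseteq> T" using keys by auto
    have "(\<Sum>a\<in>keys p. single 0 (lookup p a) * single a 1) \<in> mpoly_space.span ?B"
      using k by (intro mpoly_space.span_sum mpoly_space.span_scale mpoly_space.span_base) auto
    then show "p \<in> mpoly_space.span ?B" by (simp add: mult_single sum_singles)
  qed
  have "card ?B \<le> card T" using T by (rule card_image_le)
  then have "\<not> card (\<phi> ` A) \<le> card ?B" using card card_image[OF True] by simp
  then have "mpoly_space.dependent (\<phi> ` A)"
    using mpoly_space.independent_span_bound[of ?B "\<phi> ` A"] T sp by blast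
  then obtain u where u: "\<exists>v\<in>\<phi> ` A. u v \<noteq> 0" "(\<Sum>v\<in>\<phi> ` A. single 0 (u v) * v) = 0"
    using mpoly_space.dependent_finite[of "\<phi> ` A"] A by auto
  then show ?thesis using that[of "\<lambda>x. u (\<phi> x)"] True by (simp add: sum.reindex)
qed

definition list_power :: "'a::comm_monoid_mult list \<Rightarrow> nat list \<Rightarrow> 'a" where
  "list_power fs xs = prod_list (map2 (^) fs xs)"

lemma list_power_simps [simp]:
  "list_power [] xs = 1"
  "list_power (f # fs) (x # xs) = f ^ x * list_power fs xs"
  by (simp_all add: list_power_def)

text \<open>
  Along a chain of primes with \<open>f\<close> in \<open>p 1\<close> but not in \<open>p 0\<close>, cancel from a relation in \<open>p 0\<close> the
  lowest occurring power of \<open>f\<close>. Modulo \<open>p 1\<close> only the terms with that power remain, and they form a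
  relation between the remaining elements of the list. In the end a nonzero constant would lie in a prime.
\<close>
lemma chain_kills_relation:
  fixes p :: "nat \<Rightarrow> ('n::finite, 'k::field) mpoly set"
  assumes "\<And>i. i \<le> length fs \<Longrightarrow> prime_set (p i)"
    and "\<And>i. i < length fs \<Longrightarrow> p i \<subseteq> p (Suc i) \<and> fs ! i \<in> p (Suc i) \<and> fs ! i \<notin> p i"
    and "finite B" "B \<noteq> {}" "\<And>xs. xs \<in> B \<Longrightarrow> length xs = length fs \<and> c xs \<noteq> 0"
  shows "(\<Sum>xs\<in>B. single 0 (c xs) * list_power fs xs) \<notin> p 0"
  using assms
proof (induction fs arbitrary: p B c)
  case Nil
  have "B = {[]}" using Nil(4,5) by force
  moreover have "single 0 d \<notin> p 0" if "d \<noteq> 0" for d :: 'k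
  proof
    assume "single 0 d \<in> p 0"
    then have "single 0 (inverse d) * single 0 d \<in> p 0"
      using closed_idealD(3)[OF prime_setD(1)[OF Nil(1)[of 0]]] by simp
    then show False using prime_setD(2)[OF Nil(1)[of 0]] that by (simp add: mult_single)
  qed
  ultimately show ?case using Nil(5)[of "[]"] by simp
next
  case (Cons f fs)
  have pr0: "prime_set (p 0)" and pr1: "prime_set (p 1)" using Cons.prems(1)[of 0] Cons.prems(1)[of 1] by auto
  have c1: "closed_ideal (p 1)" using pr1 by (rule prime_setD)
  have f: "p 0 \<subseteq> p 1" "f \<in> p 1" "f \<notin> p 0" using Cons.prems(2)[of 0] by auto
  define m where "m = Min (hd ` B)"
  have m_le: "m \<le> hd xs" if "xs \<in> B" for xs using that Cons.prems(3) by (simp add: m_def)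
  have "m \<in> hd ` B" unfolding m_def using Cons.prems(3,4) by (intro Min_in) auto
  define B0 where "B0 = {xs\<in>B. hd xs = m}"
  define B1 where "B1 = {xs\<in>B. hd xs \<noteq> m}"
  let ?t = "\<lambda>xs. single 0 (c xs) * list_power (f # fs) xs"
  let ?s = "\<lambda>xs. single 0 (c xs) * list_power fs (tl xs)"
  have cons: "xs = hd xs # tl xs" if "xs \<in> B" for xs using Cons.prems(5)[OF that] by (cases xs) auto
  have t0: "?t xs = f ^ m * ?s xs" if "xs \<in> B0" for xs
  proof -
    have "xs = m # tl xs" using that cons[of xs] by (auto simp: B0_def)
    then have "list_power (f # fs) xs = f ^ m * list_power fs (tl xs)" by (metis list_power_simps(2))
    then show ?thesis by (simp add: mult_ac)
  qed
  have t1: "?t xs = f ^ m * (f * (f ^ (hd xs - m - 1) * ?s xs))" if "xs \<in> B1" for xs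
  proof -
    have xs: "xs \<in> B" "m < hd xs" using that m_le[of xs] by (auto simp: B1_def)
    obtain k where "hd xs = Suc (m + k)" using less_imp_Suc_add[OF xs(2)] by blast
    then have "f ^ hd xs = f ^ m * f * f ^ (hd xs - m - 1)" by (simp add: power_add mult_ac)
    moreover have "list_power (f # fs) xs = f ^ hd xs * list_power fs (tl xs)"
      using cons[OF xs(1)] by (metis list_power_simps(2))
    ultimately show ?thesis by (simp add: mult_ac)
  qed
  define R where "R = (\<Sum>xs\<in>B1. f ^ (hd xs - m - 1) * ?s xs)"
  define S where "S = (\<Sum>xs\<in>B0. ?s xs)"
  have BB: "B = B0 \<union> B1" "B0 \<inter> B1 = {}" "finite B0" "finite B1"
    using Cons.prems(3) by (auto simp: B0_def B1_def)
  have "sum ?t B = sum ?t B0 + sum ?t B1" unfolding BB(1) by (rule sum.union_disjoint) (use BB in auto)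
  also have "sum ?t B0 = f ^ m * S" unfolding S_def sum_distrib_left by (rule sum.cong) (use t0 in auto)
  also have "sum ?t B1 = f ^ m * (f * R)" unfolding R_def sum_distrib_left by (rule sum.cong) (use t1 in auto)
  finally have total: "sum ?t B = f ^ m * (S + f * R)" by (simp add: distrib_left)
  show ?case
  proof
    assume "sum ?t B \<in> p 0"
    moreover have "f ^ m \<notin> p 0" using prime_set_power[OF pr0] f(3) by blast
    ultimately have "S + f * R \<in> p 0" unfolding total using prime_setD(3)[OF pr0] by blast
    then have "S + f * R \<in> p 1" using f(1) by blast
    then have "(S + f * R) - f * R \<in> p 1" using closed_idealD(4,6)[OF c1] f(2) by blast
    then have S: "S \<in> p (Suc 0)" by simp
    have inj: "inj_on tl B0" using cons by (auto simp: inj_on_def B0_def) metis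
    have "S = (\<Sum>ys\<in>tl ` B0. single 0 (c (m # ys)) * list_power fs ys)"
      unfolding S_def sum.reindex[OF inj] by (rule sum.cong) (use cons in \<open>auto simp: B0_def\<close>)
    moreover have "(\<Sum>ys\<in>tl ` B0. single 0 (c (m # ys)) * list_power fs ys) \<notin> p (Suc 0)"
    proof (rule Cons.IH[where p = "\<lambda>i. p (Suc i)" and c = "\<lambda>ys. c (m # ys)"])
      show "tl ` B0 \<noteq> {}" using \<open>m \<in> hd ` B\<close> by (auto simp: B0_def)
      show "length ys = length fs \<and> c (m # ys) \<noteq> 0" if ys: "ys \<in> tl ` B0" for ys
      proof -
        obtain xs where xs: "xs \<in> B" "hd xs = m" "ys = tl xs" using ys unfolding B0_def by blast
        then show ?thesis using Cons.prems(5)[OF xs(1)] cons[OF xs(1)] by auto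
      qed
      show "p (Suc i) \<subseteq> p (Suc (Suc i)) \<and> fs ! i \<in> p (Suc (Suc i)) \<and> fs ! i \<notin> p (Suc i)"
        if "i < length fs" for i using Cons.prems(2)[of "Suc i"] that by simp
    qed (use Cons.prems(1) BB(3) in auto)
    ultimately show False using S by simp
  qed
qed

definition exponent_box :: "'n::finite set \<Rightarrow> nat \<Rightarrow> ('n \<Rightarrow>\<^sub>0 nat) set" where
  "exponent_box F M = {a. \<forall>v. if v \<in> F then lookup a v = 0 else lookup a v \<le> M}"

lemma card_exponent_box:
  "finite (exponent_box F M) \<and> card (exponent_box F M) \<le> Suc M ^ card (- F)"
proof -
  let ?P = "PiE (- F) (\<lambda>_. {..M})"
  let ?r = "\<lambda>a. restrict (lookup a) (- F)"
  have fin: "finite ?P" by (intro finite_PiE) auto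
  have inj: "inj_on ?r (exponent_box F M)"
  proof (rule inj_onI)
    fix a b assume ab: "a \<in> exponent_box F M" "b \<in> exponent_box F M" "?r a = ?r b"
    show "a = b"
    proof (rule poly_mapping_eqI)
      fix v show "lookup a v = lookup b v"
        using ab(1,2) fun_cong[OF ab(3), of v] by (cases "v \<in> F") (auto simp: exponent_box_def)
    qed
  qed
  have img: "?r ` exponent_box F M \<subseteq> ?P"
    by (auto simp: exponent_box_def PiE_def extensional_def split: if_splits)
  have "card ?P = Suc M ^ card (- F)" by (simp add: card_PiE)
  then show ?thesis
    using inj_on_finite[OF inj img fin] card_inj_on_le[OF inj img fin] by simp
qed

lemma keys_mult_box:
  assumes "keys p \<subseteq> exponent_box F M" "keys q \<subseteq> exponent_box F N"
  shows "keys (p * q) \<subseteq> exponent_box F (M + N)"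
proof
  fix k assume "k \<in> keys (p * q)"
  then obtain a b where "k = a + b" "a \<in> exponent_box F M" "b \<in> exponent_box F N"
    using keys_mult[of p q] assms by blast
  then show "k \<in> exponent_box F (M + N)"
    by (auto simp: exponent_box_def lookup_add split: if_splits intro: add_mono)
qed

lemma exponent_box_mono: "M \<le> N \<Longrightarrow> exponent_box F M \<subseteq> exponent_box F N"
  by (auto simp: exponent_box_def split: if_splits intro: order_trans)

lemma keys_one_box: "keys (1 :: ('n::finite, 'k::field) mpoly) \<subseteq> exponent_box F M"
  by (simp add: exponent_box_def)

lemma keys_power_box:
  assumes "keys (p :: ('n::finite, 'k::field) mpoly) \<subseteq> exponent_box F M"
  shows "keys (p ^ k) \<subseteq> exponent_box F (k * M)"
proof (induction k)
  case (Suc k)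
  then show ?case using keys_mult_box[OF assms Suc] by simp
qed (use keys_one_box in simp)

lemma keys_list_power_box:
  assumes "length xs = length fs" "\<forall>f\<in>set fs. keys (f :: ('n::finite, 'k::field) mpoly) \<subseteq> exponent_box F M"
    "set xs \<subseteq> {..N}"
  shows "keys (list_power fs xs) \<subseteq> exponent_box F (length fs * (N * M))"
  using assms
proof (induction xs fs rule: list_induct2)
  case (Cons x xs f fs)
  have "keys (f ^ x) \<subseteq> exponent_box F (x * M)" using Cons.prems by (intro keys_power_box) auto
  moreover have "exponent_box F (x * M) \<subseteq> exponent_box F (N * M)"
    using Cons.prems(2) by (intro exponent_box_mono mult_right_mono) auto
  ultimately have "keys (f ^ x) \<subseteq> exponent_box F (N * M)" by blast
  then have "keys (f ^ x * list_power fs xs) \<subseteq> exponent_box F (N * M + length fs * (N * M))"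
    using Cons.prems by (intro keys_mult_box Cons.IH) auto
  then show ?case by simp
qed (use keys_one_box in simp)

lemma ex_keys_box:
  fixes fs :: "('n::finite, 'k::field) mpoly list"
  assumes "\<And>f a v. f \<in> set fs \<Longrightarrow> a \<in> keys f \<Longrightarrow> v \<in> F \<Longrightarrow> lookup a v = 0"
  obtains M where "\<forall>f\<in>set fs. keys f \<subseteq> exponent_box F M"
proof -
  let ?S = "(\<lambda>(a, v). lookup a v) ` ((\<Union>f\<in>set fs. keys f) \<times> UNIV)"
  have fin: "finite ?S" by (intro finite_imageI finite_cartesian_product finite_UN_I) auto
  have "lookup a v \<le> Max (insert 0 ?S)" if "f \<in> set fs" "a \<in> keys f" for f a v
    using that fin by (intro Max_ge) force+
  then have "keys f \<subseteq> exponent_box F (Max (insert 0 ?S))" if "f \<in> set fs" for f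
    using assms that unfolding exponent_box_def by auto
  then show thesis using that by blast
qed

text \<open>
  Choose an element in each step of the chain, reduced so as not to involve the variables in \<open>F\<close>. For
  exponents at most \<open>N\<close> there are \<open>(N + 1)^d\<close> products of powers of these elements, but only of the
  order of \<open>N^n\<close> monomials, \<open>n = card (- F)\<close>, in which to express them. For \<open>d > n\<close> and large \<open>N\<close> the products are dependent,
  which \<open>chain_kills_relation\<close> forbids.
\<close>
lemma prime_chain_length_le:
  fixes p :: "nat \<Rightarrow> ('n::finite, 'k::field) mpoly set"
  assumes pr: "\<And>i. i \<le> d \<Longrightarrow> prime_set (p i)" and strict: "\<And>i. i < d \<Longrightarrow> p i \<subset> p (Suc i)"
    and F: "var_ideal F \<subseteq> p 0"
  shows "d \<le> card (- F)"
proof (rule ccontr)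
  assume "\<not> d \<le> card (- F)"
  then have d: "card (- F) < d" by simp
  have Fp: "var_ideal F \<subseteq> p i" if "i \<le> d" for i
    using that
  proof (induction i)
    case (Suc i)
    then show ?case using strict[of i] by auto
  qed (use F in simp)
  have "\<forall>i. \<exists>f. i < d \<longrightarrow> f \<in> p (Suc i) \<and> f \<notin> p i" using strict by blast
  then obtain f where f: "\<And>i. i < d \<Longrightarrow> f i \<in> p (Suc i) \<and> f i \<notin> p i" by metis
  define \<sigma> where "\<sigma> = (\<lambda>v. if v \<in> F then 0 else var v :: ('n, 'k) mpoly)"
  have "\<exists>h. (\<forall>a\<in>keys h. \<forall>v\<in>F. lookup a v = 0) \<and> g - h \<in> var_ideal F" for g :: "('n, 'k) mpoly"
  proof -
    have "g \<in> sum_set (var_ideal F) (mon_ideal {a. \<forall>v\<in>F. lookup a v = 0})"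
      unfolding var_ideal_def sum_set_mon_ideal by (auto simp: mon_ideal_def)
    then show ?thesis unfolding sum_set_def mon_ideal_def[of "{a. \<forall>v\<in>F. lookup a v = 0}"] by force
  qed
  then obtain red where red: "\<And>g a v. a \<in> keys (red g) \<Longrightarrow> v \<in> F \<Longrightarrow> lookup a v = 0"
    "\<And>g :: ('n, 'k) mpoly. g - red g \<in> var_ideal F" by metis
  have red_mem: "red (f i) \<in> p j \<longleftrightarrow> f i \<in> p j" if "j \<le> d" for i j
  proof -
    have c: "closed_ideal (p j)" using pr[OF that] by (rule prime_setD)
    have "f i - red (f i) \<in> p j" using red(2) Fp[OF that] by blast
    then show ?thesis
      using closed_idealD(2)[OF c, of "f i - red (f i)" "red (f i)"] closed_idealD(6)[OF c, of "f i" "f i - red (f i)"]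
      by auto
  qed
  define fs where "fs = map (\<lambda>i. red (f i)) [0..<d]"
  have len: "length fs = d" by (simp add: fs_def)
  obtain M where M: "\<forall>g\<in>set fs. keys g \<subseteq> exponent_box F M"
  proof (rule ex_keys_box[of fs F])
    show "lookup a v = 0" if "g \<in> set fs" "a \<in> keys g" "v \<in> F" for g a v
      using that red(1) by (auto simp: fs_def)
  qed blast
  define n where "n = card (- F)"
  define E where "E = Suc (d * M)"
  \<comment> \<open>large enough for \<open>(d N M + 1)^n \<le> E^n (N + 1)^n < (N + 1)^d\<close>\<close>
  define N where "N = E ^ n"
  define A where "A = {xs :: nat list. set xs \<subseteq> {..N} \<and> length xs = d}"
  let ?T = "exponent_box F (d * (N * M))"
  have A: "finite A" "card A = Suc N ^ d"
    unfolding A_def using finite_lists_length_eq[of "{..N}" d] card_lists_length_eq[of "{..N}" d] by simp_all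
  have "Suc (d * (N * M)) \<le> E * Suc N" by (simp add: E_def algebra_simps)
  then have "Suc (d * (N * M)) ^ n \<le> (E * Suc N) ^ n" by (rule power_mono) simp
  also have "\<dots> = N * Suc N ^ n" by (simp only: power_mult_distrib N_def)
  also have "\<dots> < Suc N * Suc N ^ n" by simp
  also have "\<dots> = Suc N ^ Suc n" by simp
  also have "\<dots> \<le> Suc N ^ d" using d by (intro power_increasing) (auto simp: n_def)
  finally have "card ?T < card A"
    using card_exponent_box[of F "d * (N * M)"] A(2) by (simp add: n_def)
  moreover have "keys (list_power fs xs) \<subseteq> ?T" if "xs \<in> A" for xs
    using keys_list_power_box[of xs fs F M N] that M len by (simp add: A_def)
  ultimately obtain c where c: "\<exists>xs\<in>A. c xs \<noteq> 0" "(\<Sum>xs\<in>A. single 0 (c xs) * list_power fs xs) = 0"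
    using linear_relation[of ?T A "list_power fs"] card_exponent_box[of F] A(1) by blast
  let ?B = "{xs\<in>A. c xs \<noteq> 0}"
  have "(\<Sum>xs\<in>?B. single 0 (c xs) * list_power fs xs) = (\<Sum>xs\<in>A. single 0 (c xs) * list_power fs xs)"
    using A(1) by (intro sum.mono_neutral_left) auto
  moreover have "(\<Sum>xs\<in>?B. single 0 (c xs) * list_power fs xs) \<notin> p 0"
  proof (rule chain_kills_relation)
    show "p i \<subseteq> p (Suc i) \<and> fs ! i \<in> p (Suc i) \<and> fs ! i \<notin> p i" if "i < length fs" for i
      using that strict[of i] f[of i] red_mem by (auto simp: fs_def)
    show "finite ?B" using A(1) by simp
    show "?B \<noteq> {}" using c(1) by blast
  qed (use pr len in \<open>auto simp: A_def\<close>)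
  ultimately show False using c(2) closed_idealD(1)[OF prime_setD(1)[OF pr[of 0]]] by simp
qed

theorem krull_dim_Quot_var_ideal:
  "krull_dim (mpoly_ring Quot (var_ideal F :: ('n::finite, 'k::field) mpoly set)) = enat (card (- F))"
proof (rule antisym)
  let ?J = "var_ideal F :: ('n, 'k) mpoly set"
  have iJ: "ideal ?J mpoly_ring" by (simp add: ideal_iff_closed_ideal)
  interpret J: ideal ?J "mpoly_ring :: ('n, 'k) mpoly ring" by (rule iJ)
  let ?pi = "\<lambda>x. ?J +>\<^bsub>mpoly_ring\<^esub> x"
  show "krull_dim (mpoly_ring Quot ?J) \<le> enat (card (- F))"
    unfolding krull_dim_def
  proof (rule Sup_least)
    fix e assume "e \<in> {enat d | d p. prime_chain (mpoly_ring Quot ?J) p d}"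
    then obtain d p where e: "e = enat d" and p: "prime_chain (mpoly_ring Quot ?J) p d" by blast
    have car: "carrier (mpoly_ring Quot ?J) = range ?pi"
      unfolding FactRing_def A_RCOSETS_def' by auto
    define P where "P = (\<lambda>i. {x. ?pi x \<in> p i})"
    have "d \<le> card (- F)"
    proof (rule prime_chain_length_le[of d P])
      show "prime_set (P i)" if "i \<le> d" for i
        using ring_hom_ring.primeideal_vimage[OF J.rcos_ring_hom_ring cring_mpoly_ring, of "p i"] p that
        by (simp add: prime_chain_def P_def primeideal_iff_prime_set)
      show "P i \<subset> P (Suc i)" if i: "i < d" for i
      proof -
        have sub: "p i \<subset> p (Suc i)" using p i by (auto simp: prime_chain_def)
        then obtain y where y: "y \<in> p (Suc i)" "y \<notin> p i" by blast
        have "ideal (p (Suc i)) (mpoly_ring Quot ?J)"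
          using p i by (simp add: prime_chain_def primeideal.axioms)
        then have "p (Suc i) \<subseteq> range ?pi"
          using additive_subgroup.a_subset[OF ideal.axioms(1)] car by blast
        then obtain x where "y = ?pi x" using y(1) by blast
        then show ?thesis using sub y unfolding P_def by blast
      qed
      show "var_ideal F \<subseteq> P 0"
      proof
        fix x assume x: "x \<in> ?J"
        have "?pi x = ?pi 0" using x by (subst coset_eq_iff) auto
        also have "\<dots> = zero (mpoly_ring Quot ?J)"
          using ring_hom_zero[OF J.rcos_ring_hom ring_mpoly_ring J.quotient_is_ring] by simp
        finally have "?pi x = zero (mpoly_ring Quot ?J)" .
        moreover have "ideal (p 0) (mpoly_ring Quot ?J)"
          using p by (simp add: prime_chain_def primeideal.axioms)
        ultimately show "x \<in> P 0"
          using additive_subgroup.zero_closed[OF ideal.axioms(1)] unfolding P_def by fastforce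
      qed
    qed
    then show "e \<le> enat (card (- F))" by (simp add: e)
  qed
qed (rule le_krull_dim_Quot_var_ideal)

section \<open>Upper bounds for the depth\<close>

definition nonfaces :: "('i \<Rightarrow> 'n set) \<Rightarrow> 'i set \<Rightarrow> ('n::finite \<Rightarrow>\<^sub>0 nat) set" where
  "nonfaces G V = {a. \<forall>i\<in>V. \<not> keys a \<subseteq> G i}"

text \<open>
  The Stanley-Reisner ideal of the complex generated by the faces \<open>G i\<close>.
\<close>
definition facet_ideal :: "('i \<Rightarrow> 'n set) \<Rightarrow> 'i set \<Rightarrow> ('n::finite, 'k::field) mpoly set" where
  "facet_ideal G V = mon_ideal (nonfaces G V)"

lemma keys_add_nat: "keys (a + b :: 'n \<Rightarrow>\<^sub>0 nat) = keys a \<union> keys b"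
  by (auto simp: in_keys_iff lookup_add)

lemma up_closed_nonfaces: "up_closed (nonfaces G V)"
  by (auto simp: up_closed_def nonfaces_def keys_add_nat)

lemma closed_ideal_facet_ideal [simp]: "closed_ideal (facet_ideal G V)"
  unfolding facet_ideal_def by (rule closed_ideal_mon_ideal[OF up_closed_nonfaces])

lemma facet_ideal_single: "facet_ideal G {i} = var_ideal (- G i)"
  unfolding facet_ideal_def var_ideal_def nonfaces_def
  by (rule arg_cong[where f = mon_ideal]) (auto simp: in_keys_iff subset_iff)

lemma facet_ideal_insert: "facet_ideal G (insert i V) = facet_ideal G V \<inter> var_ideal (- G i)"
  unfolding facet_ideal_single[symmetric] unfolding facet_ideal_def mon_ideal_Int[symmetric]
  by (rule arg_cong[where f = mon_ideal]) (auto simp: nonfaces_def)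

lemma facet_ideal_eq_INT: "facet_ideal G V = (\<Inter>i\<in>V. var_ideal (- G i))"
  unfolding facet_ideal_single[symmetric] by (auto simp: facet_ideal_def mon_ideal_def nonfaces_def)

lemma lookup_facet_ideal_face:
  assumes "p \<in> facet_ideal G V" "i \<in> V" "keys a \<subseteq> G i"
  shows "lookup p a = 0"
proof (rule ccontr)
  assume "lookup p a \<noteq> 0"
  then have "a \<in> nonfaces G V" using assms(1) by (auto simp: facet_ideal_def mon_ideal_def in_keys_iff)
  then show False using assms(2,3) by (auto simp: nonfaces_def)
qed

lemma single_mem_facet_ideal: "a \<in> nonfaces G V \<Longrightarrow> single a c \<in> facet_ideal G V"
  by (auto simp: facet_ideal_def mon_ideal_def)

lemma var_cocycle_is_boundary:
  fixes M :: "('n::finite, 'k::field) mpoly set"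
  assumes "closed_ideal M" "regular_on M f d" "\<And>i. i < d \<Longrightarrow> f i \<in> var_ideal UNIV"
    and "i < d" "\<And>t. z t \<in> M" "\<And>t. shuffle var z t = 0"
  obtains y where "\<And>t. Suc (length t) = i \<Longrightarrow> y t \<in> M" "\<And>t. length t = i \<Longrightarrow> z t = shuffle var y t"
proof -
  have "\<exists>g. f i = (\<Sum>v\<in>UNIV. g v * var v)" if "i < d" for i
    using assms(3)[OF that] unfolding var_ideal_eq by blast
  then show thesis using koszul_cocycle_is_boundary[OF assms(1,2) _ assms(4-6)] that by blast
qed

lemma single_plus_eq_iff: "(\<exists>a. single b (1::nat) + single c 1 = single v 1 + a) \<longleftrightarrow> v = b \<or> v = c"
proof
  assume "\<exists>a. single b (1::nat) + single c 1 = single v 1 + a"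
  then obtain a where "single b (1::nat) + single c 1 = single v 1 + a" by blast
  then have "lookup (single b (1::nat) + single c 1) v \<noteq> 0" by (simp add: lookup_add)
  then show "v = b \<or> v = c" by (auto simp: lookup_add lookup_single when_def split: if_splits)
qed (metis add.commute)

lemma var_mult_eq: "var v * p = (single (single v 1) 1 * p :: ('n::finite, 'k::field) mpoly)"
  by (simp add: var_def monomial_def)

abbreviation unit_vec :: "'n \<Rightarrow> 'n \<Rightarrow> 'a::comm_ring_1" where
  "unit_vec c \<equiv> (\<lambda>v. if v = c then 1 else 0)"

definition shuffle_all :: "('v \<Rightarrow> 'a::comm_ring_1) list \<Rightarrow> 'v list \<Rightarrow> 'a" where
  "shuffle_all \<alpha>s = foldr shuffle \<alpha>s (\<lambda>t. if t = [] then 1 else 0)"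

lemma shuffle_all_simps [simp]:
  "shuffle_all [] = (\<lambda>t. if t = [] then 1 else 0)"
  "shuffle_all (\<alpha> # \<alpha>s) = shuffle \<alpha> (shuffle_all \<alpha>s)"
  by (simp_all add: shuffle_all_def)

lemma shuffle_all_head_zero:
  "(\<And>\<alpha>. \<alpha> \<in> set \<alpha>s \<Longrightarrow> \<alpha> v = 0) \<Longrightarrow> shuffle_all \<alpha>s (v # t) = 0"
proof (induction \<alpha>s arbitrary: t)
  case (Cons \<alpha> \<alpha>s)
  have "(\<lambda>u. shuffle_all \<alpha>s (v # u)) = (\<lambda>u. 0)" using Cons by auto
  then show ?case using Cons.prems[of \<alpha>] by (simp add: shuffle_zero)
qed simp

text \<open>
  Only one term of the shuffle of \<open>cs\<close> with the remaining factors starts with the letters of \<open>cs\<close> in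
  order.
\<close>
lemma shuffle_all_prefix:
  fixes \<alpha>s :: "('v \<Rightarrow> 'a::comm_ring_1) list"
  assumes "distinct cs" "\<And>c \<alpha>. c \<in> set cs \<Longrightarrow> \<alpha> \<in> set \<alpha>s \<Longrightarrow> \<alpha> c = 0"
  shows "shuffle_all (map unit_vec cs @ \<alpha>s) (cs @ t) = shuffle_all \<alpha>s t"
  using assms
proof (induction cs)
  case (Cons c cs)
  have "(\<lambda>u. shuffle_all (map unit_vec cs @ \<alpha>s) (c # u)) = (\<lambda>u. 0)"
  proof
    fix u show "shuffle_all (map unit_vec cs @ \<alpha>s) (c # u) = 0"
      by (rule shuffle_all_head_zero) (use Cons.prems in auto)
  qed
  moreover have "shuffle_all (map unit_vec cs @ \<alpha>s) (cs @ t) = shuffle_all \<alpha>s t"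
    by (rule Cons.IH) (use Cons.prems in auto)
  ultimately show ?case by (simp add: shuffle_zero)
qed simp

lemma shuffle_shuffle_all_mem:
  "\<beta> \<in> set \<alpha>s \<Longrightarrow> shuffle \<beta> (shuffle_all \<alpha>s) t = 0"
proof (induction \<alpha>s arbitrary: t)
  case (Cons \<alpha> \<alpha>s)
  show ?case
  proof (cases "\<beta> = \<alpha>")
    case True
    then show ?thesis by (simp add: shuffle_twice)
  next
    case False
    then have "shuffle \<beta> (shuffle_all \<alpha>s) = (\<lambda>t. 0)" using Cons by auto
    then show ?thesis by (simp add: shuffle_anticommute[of \<beta> \<alpha>] shuffle_zero)
  qed
qed simp

lemma shuffle_vec_sum:
  "shuffle (\<lambda>v. \<Sum>j\<in>J. r j * \<beta> j v) c t = (\<Sum>j\<in>J. r j * shuffle (\<beta> j) c t)"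
  by (induction t arbitrary: c) (simp_all add: sum_distrib_left sum_distrib_right sum_subtractf right_diff_distrib mult.assoc)

lemma shuffle_all_two_mem:
  assumes M: "closed_ideal M" and ab: "\<And>v w. \<alpha> v * \<beta> w \<in> M"
  shows "shuffle_all [\<alpha>, \<beta>] t \<in> M"
proof -
  have u: "shuffle \<beta> (\<lambda>t. if t = [] then 1 else 0) (w # s) = (if s = [] then \<beta> w else 0)" for w s
  proof -
    have "(\<lambda>u. if w # u = [] then 1 else 0 :: 'a) = (\<lambda>u. 0)" by simp
    then show ?thesis by (simp add: shuffle_zero)
  qed
  have v: "shuffle \<alpha> (\<lambda>s. if s = [] then \<beta> v else 0) t \<in> M" for v t
  proof (cases t)
    case (Cons w s)
    have "(\<lambda>u. if w # u = [] then \<beta> v else 0) = (\<lambda>u. 0)" by simp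
    then show ?thesis using Cons ab[of w v] closed_idealD(1)[OF M] by (simp add: shuffle_zero)
  qed (use closed_idealD(1)[OF M] in simp)
  show ?thesis
  proof (cases t)
    case Nil
    then show ?thesis using closed_idealD(1)[OF M] by simp
  next
    case (Cons v s)
    have "\<alpha> v * shuffle \<beta> (\<lambda>t. if t = [] then 1 else 0) s \<in> M"
      using ab[of v] closed_idealD(1)[OF M] u by (cases s) auto
    moreover have "shuffle_all [\<alpha>, \<beta>] t = \<alpha> v * shuffle \<beta> (\<lambda>t. if t = [] then 1 else 0) s
        - shuffle \<alpha> (\<lambda>s. if s = [] then \<beta> v else 0) s"
      unfolding Cons shuffle_all_simps shuffle.simps(2)[of \<alpha>] u ..
    ultimately show ?thesis using v closed_idealD(6)[OF M] by simp
  qed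
qed

lemma shuffle_all_append_mem:
  assumes M: "closed_ideal M" and "\<And>t. shuffle_all \<alpha>s t \<in> M"
  shows "shuffle_all (\<beta>s @ \<alpha>s) t \<in> M"
  using assms(2) by (induction \<beta>s arbitrary: t) (auto intro: shuffle_mem[OF M])

text \<open>
  In the differential of \<open>y\<close> at the word \<open>cs @ [b, a]\<close>, the letters in \<open>cs\<close> contribute multiples of
  variables other than \<open>a\<close> and \<open>b\<close>, so only the terms \<open>x\<^sub>b y\<close> and \<open>x\<^sub>a y\<close> can contain \<open>x\<^sub>a x\<^sub>b\<close>.
\<close>
lemma boundary_coefficient:
  fixes y :: "'n::finite list \<Rightarrow> ('n, 'k::field) mpoly"
  assumes "a \<notin> set cs" "b \<notin> set cs"
    and "\<And>t. length t = Suc (length cs) \<Longrightarrow> lookup (y t) (single a 1) = 0 \<and> lookup (y t) (single b 1) = 0"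
  shows "lookup (shuffle var y (cs @ [b, a])) (single b 1 + single a 1) = 0"
  using assms
proof (induction cs arbitrary: y)
  case Nil
  have "lookup (var b * y [a]) (single b 1 + single a 1) = 0"
    using Nil(3)[of "[a]"] by (simp only: var_mult_eq lookup_single_mult_add) simp
  moreover have "lookup (var a * y [b]) (single b 1 + single a 1) = 0"
    using Nil(3)[of "[b]"] by (simp only: var_mult_eq lookup_single_mult_add add.commute[of "single b 1"]) simp
  ultimately show ?case by (simp add: lookup_minus)
next
  case (Cons c cs)
  have "lookup (var c * y (cs @ [b, a])) (single b 1 + single a 1) = 0"
    unfolding var_mult_eq using Cons.prems single_plus_eq_iff[of b a c]
    by (intro lookup_single_mult_eq_0) auto
  moreover have "lookup (shuffle var (\<lambda>u. y (c # u)) (cs @ [b, a])) (single b 1 + single a 1) = 0"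
    by (rule Cons.IH) (use Cons.prems in auto)
  ultimately show ?case by (simp add: lookup_minus)
qed

text \<open>
  After deleting the vertices in \<open>C\<close>, the complex falls apart into the vertex set \<open>A\<close> of the facets in
  \<open>K\<close> and the rest \<open>B\<close>. With \<open>x\<^sub>A\<close>, \<open>x\<^sub>B\<close> the parts of the Koszul element \<open>x\<close> supported in \<open>A\<close> and \<open>B\<close>,
  the shuffle product of the unit vectors of \<open>C\<close> with \<open>x\<^sub>B\<close> and \<open>x\<^sub>A\<close> is a cocycle of degree
  \<open>card C + 2\<close>, because \<open>x\<close> is a combination of its factors. Its values lie in the ideal since no face
  meets both \<open>A\<close> and \<open>B\<close>. It takes the value \<open>x\<^sub>a x\<^sub>b\<close> at \<open>C, b, a\<close>, which a boundary of a cochain with values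
  in the ideal cannot, as neither \<open>x\<^sub>a\<close> nor \<open>x\<^sub>b\<close> occurs in the ideal. This is the class that Hochster's
  formula attaches to the restriction of the complex to the complement of \<open>C\<close>.
\<close>
theorem regular_length_le_separation:
  fixes G :: "'i \<Rightarrow> 'n::finite set" and f :: "nat \<Rightarrow> ('n, 'k::field) mpoly"
  assumes K: "K \<subseteq> V" "k \<in> K" "l \<in> V - K"
    and a: "a \<in> G k - C" and b: "b \<in> G l - C"
    and sep: "\<And>i j. i \<in> K \<Longrightarrow> j \<in> V - K \<Longrightarrow> G i \<inter> G j \<subseteq> C"
    and reg: "regular_on (facet_ideal G V) f d" "\<And>i. i < d \<Longrightarrow> f i \<in> var_ideal UNIV"
  shows "d \<le> card C + 2"
proof (rule ccontr)
  assume "\<not> d \<le> card C + 2"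
  then have d: "card C + 2 < d" by simp
  let ?I = "facet_ideal G V :: ('n, 'k) mpoly set"
  define A where "A = (\<Union>i\<in>K. G i) - C"
  define xA xB :: "'n \<Rightarrow> ('n, 'k) mpoly"
    where "xA = (\<lambda>v. if v \<in> A then var v else 0)" and "xB = (\<lambda>v. if v \<notin> A \<and> v \<notin> C then var v else 0)"
  obtain cs where cs: "set cs = C" "distinct cs" using finite_distinct_list[of C] by auto
  have len: "length cs = card C" using distinct_card[OF cs(2)] cs(1) by simp
  have aA: "a \<in> A" using a K(2) by (auto simp: A_def)
  have bA: "b \<notin> A" using b K(3) sep by (auto simp: A_def)
  define \<alpha>s where "\<alpha>s = map unit_vec cs @ [xB, xA]"
  define z where "z = shuffle_all \<alpha>s"
  have prod: "xB v * xA w \<in> ?I" for v w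
  proof (cases "w \<in> A \<and> v \<notin> A \<and> v \<notin> C")
    case True
    have "\<not> {v, w} \<subseteq> G i" if i: "i \<in> V" for i
    proof
      assume vw: "{v, w} \<subseteq> G i"
      then have "i \<notin> K" using True by (auto simp: A_def)
      moreover obtain j where "j \<in> K" "w \<in> G j" using True by (auto simp: A_def)
      ultimately have "w \<in> C" using sep[of j i] i vw by blast
      then show False using True by (simp add: A_def)
    qed
    then have "single v 1 + single w 1 \<in> nonfaces G V" by (auto simp: nonfaces_def keys_add_nat)
    then have "single (single v 1 + single w 1) 1 \<in> ?I" by (rule single_mem_facet_ideal)
    then show ?thesis using True by (simp add: xA_def xB_def var_def monomial_def mult_single)
  next
    case False
    then show ?thesis using closed_idealD(1)[of ?I] by (auto simp: xA_def xB_def)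
  qed
  have zI: "z t \<in> ?I" for t
    unfolding z_def \<alpha>s_def by (intro shuffle_all_append_mem shuffle_all_two_mem prod) simp_all
  have zcocycle: "shuffle var z t = 0" for t
  proof -
    have var_split: "var v = (xA v + xB v) + (\<Sum>c\<in>C. var c * unit_vec c v)" for v
    proof -
      have "(\<Sum>c\<in>C. var c * unit_vec c v) = (\<Sum>c\<in>C. if v = c then var c else 0 :: ('n, 'k) mpoly)"
        by (rule sum.cong) auto
      also have "\<dots> = (if v \<in> C then var v else 0)" by (rule sum.delta') simp
      finally show ?thesis by (auto simp: xA_def xB_def A_def)
    qed
    have "shuffle var z t = (shuffle xA z t + shuffle xB z t) + (\<Sum>c\<in>C. var c * shuffle (unit_vec c) z t)"
      by (subst var_split[abs_def]) (simp only: shuffle_vec_add shuffle_vec_sum)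
    also have "\<dots> = 0"
      using cs(1) by (simp add: z_def shuffle_shuffle_all_mem \<alpha>s_def)
    finally show ?thesis .
  qed
  obtain y where y: "\<And>t. Suc (length t) = card C + 2 \<Longrightarrow> y t \<in> ?I"
    "\<And>t. length t = card C + 2 \<Longrightarrow> z t = shuffle var y t"
    using var_cocycle_is_boundary[OF closed_ideal_facet_ideal reg d zI zcocycle] by blast
  have coeff: "lookup (shuffle var y (cs @ [b, a])) (single b 1 + single a 1) = 0"
  proof (rule boundary_coefficient)
    show "lookup (y t) (single a 1) = 0 \<and> lookup (y t) (single b 1) = 0" if "length t = Suc (length cs)" for t
    proof -
      have "y t \<in> ?I" using y(1) that len by simp
      moreover have "k \<in> V" "l \<in> V" using K by auto
      ultimately show ?thesis using a b by (auto intro: lookup_facet_ideal_face)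
    qed
  qed (use a b cs in auto)
  have "z (cs @ [b, a]) = shuffle_all [xB, xA] [b, a]"
    unfolding z_def \<alpha>s_def using cs by (intro shuffle_all_prefix) (auto simp: xA_def xB_def A_def)
  also have "\<dots> = xB b * xA a - xA b * xB a"
    by (simp add: algebra_simps)
  also have "\<dots> = single (single b 1 + single a 1) 1"
    using aA bA b by (simp add: xA_def xB_def var_def monomial_def mult_single)
  finally have "shuffle var y (cs @ [b, a]) = single (single b 1 + single a 1) 1"
    using y(2)[of "cs @ [b, a]"] len by simp
  then show False using coeff by simp
qed

text \<open>
  The complex has the homotopy type of the graph of meeting facets, and an edge \<open>{i, j}\<close> on a cycle
  carries a one-dimensional cohomology class: \<open>\<phi> v w\<close> is the difference of the values at \<open>w\<close> and \<open>v\<close> of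
  the indicator of \<open>G i \<inter> G j\<close>, but only inside the facet \<open>G j\<close>. It is additive on faces, so the Koszul differential of
  \<open>\<phi> v w x\<^sub>v x\<^sub>w\<close> has values in the ideal. If this were a boundary of \<open>y\<close> with values in the ideal, the
  coefficients of \<open>y\<close> would correct \<open>\<phi>\<close> off the faces to a \<open>\<theta>\<close> that is additive everywhere, so
  \<open>\<theta> v0\<close> would be a potential for \<open>\<phi>\<close>. Along the path from \<open>i\<close> to \<open>k\<close> this potential stays zero, while the
  step from \<open>v0\<close> inside \<open>G j\<close> forces the value \<open>-1\<close> on \<open>G k \<inter> G j\<close>.
\<close>
theorem regular_length_le_cycle:
  fixes G :: "'i \<Rightarrow> 'n::finite set" and f :: "nat \<Rightarrow> ('n, 'k::field) mpoly"
  assumes ijk: "i \<in> V" "j \<in> V" "k \<in> V" "i \<noteq> k" "i \<noteq> j" "k \<noteq> j" "G i \<inter> G j \<noteq> {}" "G k \<inter> G j \<noteq> {}"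
    and triple: "\<And>a b c. a \<in> V \<Longrightarrow> b \<in> V \<Longrightarrow> c \<in> V \<Longrightarrow> a \<noteq> b \<Longrightarrow> a \<noteq> c \<Longrightarrow> b \<noteq> c \<Longrightarrow> G a \<inter> G b \<inter> G c = {}"
    and path: "(i, k) \<in> {(a, b). a \<in> V - {j} \<and> b \<in> V - {j} \<and> G a \<inter> G b \<noteq> {}}\<^sup>*"
    and reg: "regular_on (facet_ideal G V) f d" "\<And>i. i < d \<Longrightarrow> f i \<in> var_ideal UNIV"
  shows "d \<le> 3"
proof (rule ccontr)
  assume "\<not> d \<le> 3"
  then have d: "3 < d" by simp
  let ?I = "facet_ideal G V :: ('n, 'k) mpoly set"
  define X0 where "X0 = G i \<inter> G j"
  define \<phi> where "\<phi> v w = (if v \<in> G j \<and> w \<in> G j then (if w \<in> X0 then 1 else 0) - (if v \<in> X0 then 1 else 0) else 0 :: 'k)" for v w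
  have \<phi>_other: "\<phi> v w = 0" if l: "l \<in> V" "l \<noteq> j" "v \<in> G l" "w \<in> G l" for l v w
  proof (cases "v \<in> G j \<and> w \<in> G j")
    case True
    show ?thesis
    proof (cases "l = i")
      case True
      then show ?thesis using l \<open>v \<in> G j \<and> w \<in> G j\<close> by (simp add: \<phi>_def X0_def)
    next
      case False
      then have "G i \<inter> G j \<inter> G l = {}" using triple[of i j l] ijk l by auto
      then show ?thesis using l \<open>v \<in> G j \<and> w \<in> G j\<close> by (auto simp: \<phi>_def X0_def)
    qed
  qed (auto simp: \<phi>_def)
  have \<phi>_cocycle: "\<phi> w y - \<phi> v y + \<phi> v w = 0" if "l \<in> V" "{v, w, y} \<subseteq> G l" for l v w y
  proof (cases "l = j")
    case True
    then show ?thesis using that by (simp add: \<phi>_def)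
  next
    case False
    then show ?thesis using that \<phi>_other[of l] by simp
  qed
  define u :: "'n list \<Rightarrow> ('n, 'k) mpoly" where
    "u t = (case t of [v, w] \<Rightarrow> single (single v 1 + single w 1) (\<phi> v w) | _ \<Rightarrow> 0)" for t
  define z where "z = shuffle var u"
  have z3: "z [v, w, y] = single (single v 1 + (single w 1 + single y 1)) (\<phi> w y - \<phi> v y + \<phi> v w)" for v w y
  proof -
    have "z [v, w, y] = var v * u [w, y] - (var w * u [v, y] - (var y * u [v, w]))"
      by (simp add: z_def)
    also have "var v * u [w, y] = single (single v 1 + (single w 1 + single y 1)) (\<phi> w y)"
      by (simp add: u_def var_mult_eq mult_single)
    also have "var w * u [v, y] = single (single v 1 + (single w 1 + single y 1)) (\<phi> v y)"
      by (simp add: u_def var_mult_eq mult_single add.left_commute)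
    also have "var y * u [v, w] = single (single v 1 + (single w 1 + single y 1)) (\<phi> v w)"
      by (simp add: u_def var_mult_eq mult_single add.left_commute add.commute)
    finally show ?thesis by (simp add: single_diff single_add algebra_simps)
  qed
  have zI: "z t \<in> ?I" for t
  proof (cases "length t = 3")
    case True
    then obtain v w y where t: "t = [v, w, y]" by (auto simp: numeral_3_eq_3 length_Suc_conv)
    show ?thesis
    proof (cases "\<exists>l\<in>V. {v, w, y} \<subseteq> G l")
      case True
      then show ?thesis unfolding t z3 using \<phi>_cocycle closed_idealD(1)[OF closed_ideal_facet_ideal] by auto
    next
      case False
      then have "single v 1 + (single w 1 + single y 1) \<in> nonfaces G V" by (auto simp: nonfaces_def keys_add_nat)
      then show ?thesis unfolding t z3 by (rule single_mem_facet_ideal)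
    qed
  next
    case False
    have "z t \<in> {0}" unfolding z_def
      by (rule shuffle_mem) (use False in \<open>auto simp: u_def split: list.splits\<close>)
    then show ?thesis using closed_idealD(1)[of ?I] by simp
  qed
  have zcocycle: "shuffle var z t = 0" for t by (simp add: z_def shuffle_twice)
  obtain y where y: "\<And>t. Suc (length t) = 3 \<Longrightarrow> y t \<in> ?I" "\<And>t. length t = 3 \<Longrightarrow> z t = shuffle var y t"
    using var_cocycle_is_boundary[OF closed_ideal_facet_ideal reg d zI zcocycle] by blast
  define \<psi> where "\<psi> v w = lookup (y [v, w]) (single v 1 + single w 1)" for v w
  define \<theta> where "\<theta> v w = \<phi> v w - \<psi> v w" for v w
  have rel: "\<theta> w s - \<theta> v s + \<theta> v w = 0" for v w s
  proof -
    let ?m = "single v (1::nat) + (single w 1 + single s 1)"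
    have "lookup (z [v, w, s]) ?m = lookup (var v * y [w, s]) ?m - (lookup (var w * y [v, s]) ?m - lookup (var s * y [v, w]) ?m)"
      using y(2)[of "[v, w, s]"] by (simp add: lookup_minus)
    also have "lookup (var v * y [w, s]) ?m = \<psi> w s"
      unfolding var_mult_eq lookup_single_mult_add by (simp add: \<psi>_def)
    also have "lookup (var w * y [v, s]) ?m = \<psi> v s"
      unfolding var_mult_eq add.left_commute[of "single v 1"] lookup_single_mult_add by (simp add: \<psi>_def)
    also have "?m = single s 1 + (single v 1 + single w 1)" by (simp add: add_ac)
    also have "lookup (var s * y [v, w]) (single s 1 + (single v 1 + single w 1)) = \<psi> v w"
      unfolding var_mult_eq lookup_single_mult_add by (simp add: \<psi>_def)
    finally have "\<phi> w s - \<phi> v s + \<phi> v w = \<psi> w s - (\<psi> v s - \<psi> v w)"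
      unfolding z3 by (simp add: add_ac)
    then show ?thesis by (simp add: \<theta>_def algebra_simps)
  qed
  have face: "\<theta> v w = \<phi> v w" if "l \<in> V" "v \<in> G l" "w \<in> G l" for l v w
  proof -
    have "\<psi> v w = 0" unfolding \<psi>_def
      by (rule lookup_facet_ideal_face[OF y(1) that(1)]) (use that in \<open>auto simp: keys_add_nat\<close>)
    then show ?thesis by (simp add: \<theta>_def)
  qed
  obtain v0 where v0: "v0 \<in> X0" using ijk by (auto simp: X0_def)
  have "\<forall>v\<in>G k. \<theta> v0 v = 0"
    using path
  proof (induction rule: rtrancl_induct)
    case base
    show ?case using face[of i v0] \<phi>_other[of i v0] v0 ijk by (auto simp: X0_def)
  next
    case (step l l')
    obtain p where p: "p \<in> G l" "p \<in> G l'" and l': "l' \<in> V" "l' \<noteq> j" using step.hyps(2) by auto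
    show ?case
    proof
      fix v assume v: "v \<in> G l'"
      have "\<theta> p v - \<theta> v0 v + \<theta> v0 p = 0" by (rule rel)
      moreover have "\<theta> v0 p = 0" using step.IH p by blast
      moreover have "\<theta> p v = 0" using face[of l' p v] \<phi>_other[of l' p v] l' p v by simp
      ultimately show "\<theta> v0 v = 0" by simp
    qed
  qed
  moreover obtain p where p: "p \<in> G k" "p \<in> G j" using ijk by blast
  moreover have "p \<notin> X0" using triple[of i j k] ijk p by (auto simp: X0_def)
  ultimately have "\<phi> v0 p = 0" using face[of j v0 p] v0 ijk by (auto simp: X0_def)
  then show False using p v0 \<open>p \<notin> X0\<close> by (simp add: \<phi>_def X0_def)
qed

section \<open>A regular sequence for a tree of facets\<close>

lemma seq_ideal_cong:
  assumes "\<And>i. i < a \<Longrightarrow> f i = g i"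
  shows "seq_ideal J f a = seq_ideal J g a"
  unfolding seq_ideal_def by (simp only: seq_mult_cong[OF assms])

text \<open>
  A monomial supported in \<open>G x\<close> but not in \<open>G y\<close> is a nonface of all the facets in \<open>V\<close>, as the
  others are disjoint from \<open>G x\<close>.
\<close>
lemma sum_set_facet_ideal_leaf:
  fixes G :: "'i \<Rightarrow> 'n::finite set"
  assumes "y \<in> V" "\<And>z. z \<in> V \<Longrightarrow> G x \<inter> G z \<noteq> {} \<Longrightarrow> z = y"
  shows "sum_set (facet_ideal G V) (var_ideal (- G x)) = (var_ideal (- (G y \<inter> G x)) :: ('n, 'k::field) mpoly set)"
proof -
  have "nonfaces G V \<union> {a :: 'n \<Rightarrow>\<^sub>0 nat. \<exists>v\<in>- G x. lookup a v \<noteq> 0} = {a. \<exists>v\<in>- (G y \<inter> G x). lookup a v \<noteq> 0}"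
  proof (intro Set.set_eqI iffI)
    fix a :: "'n \<Rightarrow>\<^sub>0 nat" assume "a \<in> nonfaces G V \<union> {a. \<exists>v\<in>- G x. lookup a v \<noteq> 0}"
    then show "a \<in> {a. \<exists>v\<in>- (G y \<inter> G x). lookup a v \<noteq> 0}"
      using assms(1) by (auto simp: nonfaces_def in_keys_iff subset_iff)
  next
    fix a :: "'n \<Rightarrow>\<^sub>0 nat" assume "a \<in> {a. \<exists>v\<in>- (G y \<inter> G x). lookup a v \<noteq> 0}"
    then obtain v where v: "v \<notin> G y \<inter> G x" "v \<in> keys a" by (auto simp: in_keys_iff)
    show "a \<in> nonfaces G V \<union> {a. \<exists>v\<in>- G x. lookup a v \<noteq> 0}"
    proof (cases "keys a \<subseteq> G x")
      case True
      have "\<not> keys a \<subseteq> G z" if z: "z \<in> V" for z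
      proof
        assume az: "keys a \<subseteq> G z"
        then have "G x \<inter> G z \<noteq> {}" using True v by blast
        then show False using assms(2)[OF z] az True v by blast
      qed
      then show ?thesis by (simp add: nonfaces_def)
    next
      case False
      then show ?thesis by (auto simp: in_keys_iff)
    qed
  qed
  then show ?thesis unfolding facet_ideal_def var_ideal_def sum_set_mon_ideal by simp
qed

text \<open>
  The facets are added in the order in which the tree grows, each time by \<open>regular_mod_Int\<close>.
\<close>
lemma regular_mod_facet_ideal:
  fixes f :: "nat \<Rightarrow> ('n::finite, 'k::field) mpoly"
  assumes "grows adj {r} W"
    and "\<And>x y. x \<in> W \<Longrightarrow> y \<in> W \<Longrightarrow> x \<noteq> y \<Longrightarrow> adj x y \<longleftrightarrow> G x \<inter> G y \<noteq> {}"
    and "\<And>x. x \<in> W \<Longrightarrow> regular_mod (var_ideal (- G x)) f (Suc q)"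
    and "\<And>x y. x \<in> W \<Longrightarrow> y \<in> W \<Longrightarrow> x \<noteq> y \<Longrightarrow> adj x y \<Longrightarrow> regular_mod (var_ideal (- (G y \<inter> G x))) f q"
  shows "regular_mod (facet_ideal G W) f (Suc q)"
  using assms
proof (induction rule: grows.induct)
  case start
  then show ?case by (simp add: facet_ideal_single)
next
  case (leaf W x y)
  have neq: "z \<noteq> x" if "z \<in> W" for z using leaf.hyps(2) that by blast
  show ?case
    unfolding facet_ideal_insert
  proof (rule regular_mod_Int)
    show "regular_mod (facet_ideal G W) f (Suc q)" by (rule leaf.IH) (use leaf.prems in auto)
    have "sum_set (facet_ideal G W) (var_ideal (- G x)) = (var_ideal (- (G y \<inter> G x)) :: ('n, 'k) mpoly set)"
    proof (rule sum_set_facet_ideal_leaf[OF leaf.hyps(3)])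
      fix z assume z: "z \<in> W" "G x \<inter> G z \<noteq> {}"
      then have "adj x z" using leaf.prems(1)[of x z] neq[of z] by auto
      then show "z = y" using leaf.hyps(5) z by blast
    qed
    then show "regular_mod (sum_set (facet_ideal G W) (var_ideal (- G x))) f q"
      using leaf.prems(3)[of x y] leaf.hyps(3,4) neq[of y] by auto
  qed (use leaf.prems(2) in auto)
qed

text \<open>
  Exchange of two elements in a domain: \<open>x\<close>, \<open>h\<close> is regular since \<open>N + (x)\<close> is prime, hence so is
  \<open>h\<close>, \<open>x\<close>. The detour is due to \<open>N + (h)\<close>, which need not be prime.
\<close>
lemma regular_pair:
  fixes N :: "'a::comm_ring_1 set"
  assumes N: "prime_set N" "x \<notin> N" and Q: "prime_set {n + x * t | n t. n \<in> N}" and h: "h \<notin> {n + x * t | n t. n \<in> N}"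
    and y: "x * y \<in> {n + h * t | n t. n \<in> N}"
  shows "y \<in> {n + h * t | n t. n \<in> N}"
proof -
  have cN: "closed_ideal N" by (rule prime_setD(1)[OF N(1)])
  obtain n t where n: "n \<in> N" "x * y = n + h * t" using y by blast
  have "h * t = (- n) + x * y" using n(2) by simp
  then have "h * t \<in> {n + x * t | n t. n \<in> N}" using closed_idealD(5)[OF cN n(1)] by blast
  then have "t \<in> {n + x * t | n t. n \<in> N}" using prime_setD(3)[OF Q] h by blast
  then obtain n' g where n': "n' \<in> N" "t = n' + x * g" by blast
  have "x * (y - h * g) = n + n' * h" using n(2) n'(2) by (simp add: algebra_simps)
  then have "x * (y - h * g) \<in> N" using closed_idealD(2)[OF cN n(1) closed_idealD(4)[OF cN n'(1)]] by simp
  then have "y - h * g \<in> N" using prime_setD(3)[OF N(1)] N(2) by blast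
  moreover have "y = (y - h * g) + h * g" by simp
  ultimately show ?thesis by blast
qed

lemma seq_ideal_var:
  fixes f :: "nat \<Rightarrow> ('n::finite, 'k::field) mpoly"
  shows "seq_ideal (var_ideal {w}) f q = {n + var w * t | n t. n \<in> seq_ideal {0} f q}"
proof -
  have e: "(var_ideal {w} :: ('n, 'k) mpoly set) = {var w * t | t. True}"
    unfolding var_ideal_eq by (auto simp: mult.commute)
  show ?thesis
    unfolding seq_ideal_zero unfolding seq_ideal_def sum_set_def e by (auto; metis add.commute)
qed

text \<open>
  The pairwise intersections are disjoint from each other, so each can be enumerated by its own
  colours; the vertices in at most one facet receive the colour \<open>q\<close>.
\<close>
lemma ex_intersection_colouring:
  fixes G :: "nat \<Rightarrow> 'n::finite set"
  assumes triple: "\<And>a b c. a \<in> V \<Longrightarrow> b \<in> V \<Longrightarrow> c \<in> V \<Longrightarrow> a \<noteq> b \<Longrightarrow> a \<noteq> c \<Longrightarrow> b \<noteq> c \<Longrightarrow> G a \<inter> G b \<inter> G c = {}"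
    and big: "\<And>i j. i \<in> V \<Longrightarrow> j \<in> V \<Longrightarrow> i \<noteq> j \<Longrightarrow> G i \<inter> G j \<noteq> {} \<Longrightarrow> q \<le> card (G i \<inter> G j)"
  obtains \<chi> :: "'n \<Rightarrow> nat"
  where "\<And>i j a. i \<in> V \<Longrightarrow> j \<in> V \<Longrightarrow> i \<noteq> j \<Longrightarrow> G i \<inter> G j \<noteq> {} \<Longrightarrow> a < q \<Longrightarrow> \<exists>v\<in>G i \<inter> G j. \<chi> v = a"
    and "\<And>v. \<forall>i\<in>V. \<forall>j\<in>V. i \<noteq> j \<longrightarrow> v \<notin> G i \<inter> G j \<Longrightarrow> \<chi> v = q"
proof -
  have "\<forall>E :: 'n set. \<exists>g. bij_betw g E {0..<card E}" by (simp add: ex_bij_betw_finite_nat)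
  then obtain g where g: "\<And>E :: 'n set. bij_betw (g E) E {0..<card E}" by metis
  \<comment> \<open>this is \<open>G i \<inter> G j\<close> for \<open>v\<close> in that set, since no third facet contains \<open>v\<close>\<close>
  define E where "E v = (\<Inter>i\<in>{i\<in>V. v \<in> G i}. G i)" for v
  define \<chi> where "\<chi> v = (if \<exists>i\<in>V. \<exists>j\<in>V. i \<noteq> j \<and> v \<in> G i \<inter> G j then g (E v) v else q)" for v
  show thesis
  proof
    fix i j a assume ij: "i \<in> V" "j \<in> V" "i \<noteq> j" "G i \<inter> G j \<noteq> {}" "a < q"
    have "a \<in> {0..<card (G i \<inter> G j)}" using big[OF ij(1-4)] ij(5) by simp
    then obtain v where v: "v \<in> G i \<inter> G j" "g (G i \<inter> G j) v = a"
      using g[of "G i \<inter> G j"] unfolding bij_betw_def by (metis imageE)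
    have "{k\<in>V. v \<in> G k} = {i, j}" using ij v(1) triple[of i j] by blast
    then have "E v = G i \<inter> G j" by (simp add: E_def)
    then have "\<chi> v = a" using v ij by (auto simp: \<chi>_def)
    then show "\<exists>v\<in>G i \<inter> G j. \<chi> v = a" using v(1) by blast
  next
    fix v assume "\<forall>i\<in>V. \<forall>j\<in>V. i \<noteq> j \<longrightarrow> v \<notin> G i \<inter> G j"
    then show "\<chi> v = q" by (auto simp: \<chi>_def)
  qed
qed

text \<open>
  The sequence consists of the colour forms of the colours below \<open>q\<close>, an element \<open>h\<close>, and a variable
  \<open>x\<^sub>w\<close>. Every intersection of two adjacent facets sees all colours, so the forms are regular modulo all
  primes involved and generate primes there. A facet has more than \<open>q\<close> vertices, so
  \<open>h\<close> can be chosen, by prime avoidance, to be regular on the facets as well. For \<open>w\<close> a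
  vertex that belongs only to the last leaf is taken; it enters no colour form used. Avoiding also the
  prime generated by \<open>x\<^sub>w\<close> and the forms makes \<open>x\<^sub>w\<close> regular after \<open>h\<close> on the polynomial ring.
\<close>
theorem tree_regular_sequence:
  fixes G :: "nat \<Rightarrow> 'n::finite set"
  assumes tree: "tree_on adj V" "symp adj" and V: "2 \<le> card V"
    and adj: "\<And>i j. i \<in> V \<Longrightarrow> j \<in> V \<Longrightarrow> adj i j \<longleftrightarrow> i \<noteq> j \<and> G i \<inter> G j \<noteq> {}"
    and anti: "\<And>i j. i \<in> V \<Longrightarrow> j \<in> V \<Longrightarrow> i \<noteq> j \<Longrightarrow> \<not> G i \<subseteq> G j"
    and triple: "\<And>a b c. a \<in> V \<Longrightarrow> b \<in> V \<Longrightarrow> c \<in> V \<Longrightarrow> a \<noteq> b \<Longrightarrow> a \<noteq> c \<Longrightarrow> b \<noteq> c \<Longrightarrow> G a \<inter> G b \<inter> G c = {}"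
    and big: "\<And>i j. i \<in> V \<Longrightarrow> j \<in> V \<Longrightarrow> i \<noteq> j \<Longrightarrow> G i \<inter> G j \<noteq> {} \<Longrightarrow> q \<le> card (G i \<inter> G j)"
  obtains f :: "nat \<Rightarrow> ('n, 'k::field) mpoly"
  where "\<And>i. i < q + 2 \<Longrightarrow> f i \<in> var_ideal UNIV" "regular_on (facet_ideal G V) f (q + 2)"
proof -
  obtain r where r: "r \<in> V" "grows adj {r} V" using tree(1) by (auto simp: tree_on_def)
  have finV: "finite V" using grows_finite[OF r(2)] by simp
  obtain x y where xy: "x \<in> V" "y \<in> V" "adj x y" "\<And>z. z \<in> V \<Longrightarrow> adj x z \<Longrightarrow> z = y"
    using r(2)
  proof cases
    case start
    then show thesis using V by simp
  next
    case (leaf W x y)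
    show thesis
    proof (rule that[of x y])
      show "z = y" if "z \<in> V" "adj x z" for z
      proof (rule leaf(6)[OF _ that(2)])
        have "x \<in> V" using leaf(1) by simp
        then have "z \<noteq> x" using that(2) adj[of x x] by auto
        then show "z \<in> W" using that(1) leaf(1) by simp
      qed
    qed (use leaf(1,4,5) in simp_all)
  qed
  have xy': "x \<noteq> y" using adj xy by blast
  obtain w where w: "w \<in> G x" "w \<notin> G y" using anti[OF xy(1,2) xy'] by blast
  \<comment> \<open>the facet of the leaf \<open>x\<close> meets no other facet than \<open>G y\<close>\<close>
  have w_private: "w \<notin> G i \<inter> G j" if ij: "i \<in> V" "j \<in> V" "i \<noteq> j" for i j
  proof
    assume wij: "w \<in> G i \<inter> G j"
    have "w \<notin> G z" if "z \<in> V" "z \<noteq> x" for z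
    proof
      assume "w \<in> G z"
      then have "adj x z" using adj[OF xy(1) that(1)] that w by auto
      then show False using xy(4)[OF that(1)] \<open>w \<in> G z\<close> w by blast
    qed
    then show False using wij ij by blast
  qed
  obtain \<chi> :: "'n \<Rightarrow> nat" where
    \<chi>: "\<And>i j a. i \<in> V \<Longrightarrow> j \<in> V \<Longrightarrow> i \<noteq> j \<Longrightarrow> G i \<inter> G j \<noteq> {} \<Longrightarrow> a < q \<Longrightarrow> \<exists>v\<in>G i \<inter> G j. \<chi> v = a"
    and \<chi>': "\<And>v. \<forall>i\<in>V. \<forall>j\<in>V. i \<noteq> j \<longrightarrow> v \<notin> G i \<inter> G j \<Longrightarrow> \<chi> v = q"
  proof (rule ex_intersection_colouring[of V G q, OF triple big])
    fix \<chi> :: "'n \<Rightarrow> nat"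
    assume 1: "\<And>i j a. i \<in> V \<Longrightarrow> j \<in> V \<Longrightarrow> i \<noteq> j \<Longrightarrow> G i \<inter> G j \<noteq> {} \<Longrightarrow> a < q \<Longrightarrow> \<exists>v\<in>G i \<inter> G j. \<chi> v = a"
      and 2: "\<And>v. \<forall>i\<in>V. \<forall>j\<in>V. i \<noteq> j \<longrightarrow> v \<notin> G i \<inter> G j \<Longrightarrow> \<chi> v = q"
    show thesis by (rule that[of \<chi>, OF 1 2])
  qed
  have \<chi>w: "\<chi> w = q" using \<chi>' w_private by blast
  have nbr: "\<exists>j\<in>V. j \<noteq> i \<and> G i \<inter> G j \<noteq> {}" if i: "i \<in> V" for i
  proof -
    have "V \<noteq> {i}" using V by auto
    then obtain k where k: "k \<in> V" "k \<noteq> i" using i by blast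
    have "(i, k) \<in> {(k, l). k \<in> V \<and> l \<in> V \<and> adj k l}\<^sup>*" by (rule grows_connected[OF r(2) tree(2) i k(1)])
    then obtain j where "j \<in> V" "adj i j" using k(2) by (auto elim: converse_rtranclE)
    then show ?thesis using adj[OF i, of j] by auto
  qed
  have vert: "\<exists>v. \<chi> v = a \<and> v \<notin> - G i" if "i \<in> V" "a < q" for i a
    using nbr[OF that(1)] \<chi>[OF that(1) _ _ _ that(2)] by blast
  have card_G: "q < card (G i)" if i: "i \<in> V" for i
  proof -
    obtain j where j: "j \<in> V" "j \<noteq> i" "G i \<inter> G j \<noteq> {}" using nbr[OF i] by blast
    have "G i \<inter> G j \<subset> G i" using anti[OF i j(1)] j(2) by blast
    then have "card (G i \<inter> G j) < card (G i)" by (intro psubset_card_mono) simp_all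
    then show ?thesis using big[OF i j(1) _ j(3)] j(2) by simp
  qed
  have ex1: "\<exists>v. \<chi> v = a \<and> v \<notin> {w}" if "a < q" for a
    using vert[OF xy(1) that] \<chi>w that by fastforce
  let ?c = "colour_form \<chi> :: nat \<Rightarrow> ('n, 'k) mpoly"
  define \<Q> where "\<Q> = insert (seq_ideal (var_ideal {w}) ?c q) ((\<lambda>i. seq_ideal (var_ideal (- G i)) ?c q) ` V)"
  have c_max: "?c a \<in> var_ideal UNIV" for a
    unfolding colour_form_def by (intro closed_ideal_sum) (simp_all add: var_mem_var_ideal)
  have not_sub: "\<not> var_ideal UNIV \<subseteq> Q" if "var v \<notin> Q" for Q and v :: 'n
    using that var_mem_var_ideal[of v UNIV] by blast
  obtain h :: "('n, 'k) mpoly" where h: "h \<in> var_ideal UNIV" "\<And>Q. Q \<in> \<Q> \<Longrightarrow> h \<notin> Q"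
  proof (rule prime_avoidance[of \<Q> "var_ideal UNIV"])
    show "finite \<Q>" using finV by (simp add: \<Q>_def)
    show "prime_set Q" if "Q \<in> \<Q>" for Q
      using that vert ex1 unfolding \<Q>_def by (auto intro!: colour_forms_prime(1))
    show "\<not> var_ideal UNIV \<subseteq> Q" if Q: "Q \<in> \<Q>" for Q
    proof -
      have "w \<notin> G y" by (rule w(2))
      then have "card (G y) \<le> card (- {w})" by (intro card_mono) auto
      then have "q < card (- {w})" using card_G[OF xy(2)] by linarith
      moreover have "Q = seq_ideal (var_ideal {w}) ?c q \<or> (\<exists>i\<in>V. Q = seq_ideal (var_ideal (- G i)) ?c q)"
        using Q by (auto simp: \<Q>_def)
      ultimately have "\<exists>v. var v \<notin> Q"
      proof (elim disjE bexE)
        assume "Q = seq_ideal (var_ideal {w}) ?c q" "q < card (- {w})"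
        then show ?thesis using colour_forms_prime(4)[of q \<chi> "{w}", OF ex1] by simp
      next
        fix i assume i: "i \<in> V" "Q = seq_ideal (var_ideal (- G i)) ?c q"
        then show ?thesis
          using colour_forms_prime(4)[of q \<chi> "- G i", OF vert[OF i(1)]] card_G[OF i(1)] by simp
      qed
      then show ?thesis using not_sub by blast
    qed
  qed auto
  define f where "f i = (if i < q then ?c i else if i = q then h else var w)" for i
  have f_seq: "seq_ideal J f a = seq_ideal J ?c a" if "a \<le> q" for J a
    using that by (intro seq_ideal_cong) (simp add: f_def)
  have reg_q: "regular_mod (var_ideal F) f q" if F: "\<And>a. a < q \<Longrightarrow> \<exists>v. \<chi> v = a \<and> v \<notin> F" for F
  proof (rule regular_mod_prime_seq)
    fix a assume a: "a < q"
    obtain v where v: "\<chi> v = a" "v \<notin> F" using F[OF a] by blast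
    show "prime_set (seq_ideal (var_ideal F) f a) \<and> f a \<notin> seq_ideal (var_ideal F) f a"
      using colour_forms_prime(1)[of a \<chi> F] colour_forms_prime(3)[of a \<chi> F v] F a v
      by (simp add: f_seq f_def)
  qed
  have reg_Suc: "regular_mod J f (Suc d)"
    if "regular_mod J f d" "\<And>x. f d * x \<in> seq_ideal J f d \<Longrightarrow> x \<in> seq_ideal J f d" for J d
    using that unfolding regular_mod_def less_Suc_eq by blast
  have reg_facet: "regular_mod (var_ideal (- G i)) f (Suc q)" if i: "i \<in> V" for i
  proof (rule reg_Suc)
    show "regular_mod (var_ideal (- G i)) f q" by (rule reg_q) (rule vert[OF i])
    have "prime_set (seq_ideal (var_ideal (- G i)) ?c q)" by (rule colour_forms_prime(1)) (rule vert[OF i])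
    moreover have "h \<notin> seq_ideal (var_ideal (- G i)) ?c q" using h(2) i by (simp add: \<Q>_def)
    ultimately show "x \<in> seq_ideal (var_ideal (- G i)) f q" if "f q * x \<in> seq_ideal (var_ideal (- G i)) f q" for x
      using that prime_setD(3) by (simp add: f_seq f_def) blast
  qed
  have reg_I: "regular_mod (facet_ideal G V) f (Suc q)"
  proof (rule regular_mod_facet_ideal[OF r(2)])
    show "regular_mod (var_ideal (- (G j \<inter> G i))) f q" if "i \<in> V" "j \<in> V" "i \<noteq> j" "adj i j" for i j
    proof (rule reg_q)
      fix a assume "a < q"
      then show "\<exists>v. \<chi> v = a \<and> v \<notin> - (G j \<inter> G i)" using \<chi>[of i j a] that adj[of i j] by blast
    qed
  qed (use reg_facet adj in auto)
  let ?N = "seq_ideal {0} ?c q"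
  have N: "prime_set ?N" "var w \<notin> ?N"
  proof -
    have ex: "\<exists>v. \<chi> v = a \<and> v \<notin> {}" if "a < q" for a using vert[OF xy(1) that] by blast
    show "prime_set ?N" using colour_forms_prime(1)[of q \<chi> "{}", OF ex] by (simp add: var_ideal_empty)
    show "var w \<notin> ?N" using colour_forms_prime(2)[of q \<chi> "{}" w, OF ex] \<chi>w by (simp add: var_ideal_empty)
  qed
  have Q0: "prime_set (seq_ideal (var_ideal {w}) ?c q)" "h \<notin> seq_ideal (var_ideal {w}) ?c q"
    using colour_forms_prime(1)[of q \<chi> "{w}"] ex1 h(2) by (auto simp: \<Q>_def)
  have N_sub: "?N \<subseteq> seq_ideal (var_ideal {w}) ?c q"
    by (rule seq_ideal_mono) (simp add: closed_idealD(1))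
  have reg_0: "regular_mod {0} f (Suc (Suc q))"
  proof (intro reg_Suc)
    show "regular_mod {0} f q" using reg_q[of "{}"] vert[OF xy(1)] unfolding var_ideal_empty by blast
    show "x \<in> seq_ideal {0} f q" if "f q * x \<in> seq_ideal {0} f q" for x
      using that N(1) Q0(2) N_sub prime_setD(3)[OF N(1), of h x] by (auto simp: f_seq f_def)
    show "x \<in> seq_ideal {0} f (Suc q)" if "f (Suc q) * x \<in> seq_ideal {0} f (Suc q)" for x
    proof -
      have e: "seq_ideal {0} f (Suc q) = {n + h * t | n t. n \<in> ?N}"
        unfolding seq_ideal_Suc f_seq[OF order_refl] by (simp add: f_def)
      have fw: "f (Suc q) = var w" by (simp add: f_def)
      show ?thesis
        using that unfolding e fw by (rule regular_pair[OF N Q0[unfolded seq_ideal_var]])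
    qed
  qed
  have "regular_on (facet_ideal G V) f (q + 2)"
    using regular_on_ideal[OF closed_ideal_facet_ideal reg_I reg_0] by simp
  moreover have "f i \<in> var_ideal UNIV" for i
    using c_max h(1) by (simp add: f_def var_mem_var_ideal)
  ultimately show thesis using that by blast
qed

section \<open>The facets of a squarefree monomial ideal\<close>

text \<open>
  A prime containing a monomial contains one of its variables, so the variables in \<open>P\<close> already generate
  a prime above \<open>I\<close>.
\<close>
lemma minimal_prime_is_var_ideal:
  fixes I :: "('n::finite, 'k::field) mpoly set"
  assumes "squarefree_monomial_ideal I" "P \<in> minimal_primes mpoly_ring I"
  shows "\<exists>F. P = var_ideal F"
proof -
  obtain A where A: "I = Idl\<^bsub>mpoly_ring\<^esub> (monomial ` A)" using assms(1) by (auto simp: squarefree_monomial_ideal_def)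
  have P: "prime_set P" "I \<subseteq> P" "\<And>Q. prime_set Q \<Longrightarrow> I \<subseteq> Q \<Longrightarrow> Q \<subseteq> P \<Longrightarrow> Q = P"
    using assms(2) by (auto simp: minimal_primes_def primeideal_iff_prime_set)
  define F where "F = {v. var v \<in> P}"
  have "var_ideal F \<subseteq> P" using prime_setD(1)[OF P(1)] by (rule var_ideal_least) (simp add: F_def)
  moreover have "I \<subseteq> var_ideal F"
    unfolding A
  proof (rule Idl_least)
    show "monomial ` A \<subseteq> (var_ideal F :: ('n, 'k) mpoly set)"
    proof
      fix p :: "('n, 'k) mpoly" assume "p \<in> monomial ` A"
      then obtain a where a: "a \<in> A" "p = monomial a" by blast
      have "monomial a \<in> monomial ` A" using a(1) by (rule imageI)
      then have "monomial a \<in> P" using P(2) Idl_superset[of "monomial ` A"] unfolding A by blast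
      moreover have "monomial a = (\<Prod>v\<in>UNIV. var v ^ lookup a v :: ('n, 'k) mpoly)"
        using single_eq_prod_vars[of a "1::'k"] by (simp add: monomial_def)
      ultimately have "\<not> (\<forall>v\<in>UNIV. var v ^ lookup a v \<notin> P)"
        using prime_set_prod[OF P(1), of UNIV "\<lambda>v. var v ^ lookup a v"] by auto
      then obtain v where v: "var v ^ lookup a v \<in> P" by blast
      then have "v \<in> F" using prime_set_power[OF P(1)] by (simp add: F_def)
      moreover have "lookup a v \<noteq> 0" using v prime_setD(2)[OF P(1)] by (cases "lookup a v = 0") auto
      ultimately show "p \<in> var_ideal F" using a(2) by (auto simp: monomial_def var_ideal_def mon_ideal_def)
    qed
  qed simp
  ultimately have "var_ideal F = P" by (intro P(3) prime_set_var_ideal)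
  then show ?thesis by blast
qed

text \<open>
  The codimension term vanishes, so the number \<open>t\<close> in the definition of bigsize is 3; the second part
  is its minimality.
\<close>
lemma bigsize_eq_2D:
  fixes I :: "('n::finite, 'k::field) mpoly set"
  defines "\<P> \<equiv> minimal_primes mpoly_ring I"
  assumes fin: "finite \<P>" and sum: "ideal_sum mpoly_ring \<P> = max_ideal" and big: "bigsize I = 2"
  shows "\<And>\<A>. \<A> \<subseteq> \<P> \<Longrightarrow> card \<A> = 3 \<Longrightarrow> ideal_sum mpoly_ring \<A> = max_ideal"
    and "\<exists>\<A>\<subseteq>\<P>. card \<A> = 2 \<and> ideal_sum mpoly_ring \<A> \<noteq> max_ideal"
proof -
  let ?Q = "\<lambda>e. 1 \<le> e \<and> (\<forall>\<A>\<subseteq>\<P>. card \<A> = e \<longrightarrow> ideal_sum mpoly_ring \<A> = max_ideal)"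
  have codim: "enat CARD('n) - ideal_height mpoly_ring (max_ideal :: ('n, 'k) mpoly set) = 0"
    using le_ideal_height_max_ideal[where 'n = 'n and 'k = 'k]
    by (cases "ideal_height mpoly_ring (max_ideal :: ('n, 'k) mpoly set)") (auto simp: zero_enat_def)
  have "enat (LEAST e. ?Q e) - 1 = 2"
    using big sum codim unfolding bigsize_def \<P>_def[symmetric] Let_def by simp
  then have t: "(LEAST e. ?Q e) = 3" by (simp add: one_enat_def numeral_eq_enat)
  have "?Q (Suc (card \<P>))"
  proof (intro conjI allI impI)
    fix \<A> assume "\<A> \<subseteq> \<P>" "card \<A> = Suc (card \<P>)"
    then show "ideal_sum mpoly_ring \<A> = max_ideal" using card_mono[OF fin, of \<A>] by simp
  qed simp
  then have "?Q (LEAST e. ?Q e)" by (rule LeastI)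
  then show "ideal_sum mpoly_ring \<A> = max_ideal" if "\<A> \<subseteq> \<P>" "card \<A> = 3" for \<A>
    unfolding t using that by blast
  have "2 < (LEAST e. ?Q e)" unfolding t by simp
  then have "\<not> ?Q 2" by (rule not_less_Least)
  then show "\<exists>\<A>\<subseteq>\<P>. card \<A> = 2 \<and> ideal_sum mpoly_ring \<A> \<noteq> max_ideal" by auto
qed

lemma max_ideal_eq_iff:
  "(var_ideal F :: ('n::finite, 'k::field) mpoly set) = max_ideal \<longleftrightarrow> F = UNIV"
  unfolding max_ideal_eq by (rule var_ideal_inj)

section \<open>Depth and the graph of meeting facets\<close>

text \<open>
  For a tree, an edge with an intersection of size \<open>q\<close> is a bridge and its removal separates the complex,
  which gives the upper bound. Without the tree property the graph is disconnected or has an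
  edge on a cycle, and the depth is at most \<open>3 < q + 2\<close>.
\<close>
theorem depth_facet_ideal_iff_tree:
  fixes G :: "nat \<Rightarrow> 'n::finite set" and V :: "nat set"
  defines "I \<equiv> facet_ideal G V :: ('n, 'k::field) mpoly set"
    and "adj \<equiv> \<lambda>i j. i \<noteq> j \<and> G i \<inter> G j \<noteq> {}"
  assumes V: "finite V" "2 \<le> card V"
    and anti: "\<And>i j. i \<in> V \<Longrightarrow> j \<in> V \<Longrightarrow> i \<noteq> j \<Longrightarrow> \<not> G i \<subseteq> G j"
    and triple: "\<And>a b c. a \<in> V \<Longrightarrow> b \<in> V \<Longrightarrow> c \<in> V \<Longrightarrow> a \<noteq> b \<Longrightarrow> a \<noteq> c \<Longrightarrow> b \<noteq> c \<Longrightarrow> G a \<inter> G b \<inter> G c = {}"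
    and big: "\<And>i j. i \<in> V \<Longrightarrow> j \<in> V \<Longrightarrow> adj i j \<Longrightarrow> q \<le> card (G i \<inter> G j)"
    and min: "i0 \<in> V" "j0 \<in> V" "adj i0 j0" "card (G i0 \<inter> G j0) = q"
    and q: "2 \<le> q"
  shows "depth mpoly_ring max_ideal (ideal_as_module mpoly_ring I) = enat (q + 2) \<longleftrightarrow> tree_on adj V"
proof
  have cl: "closed_ideal I" by (simp add: I_def)
  have sym: "symp adj" by (auto simp: symp_def adj_def)
  assume tree: "tree_on adj V"
  obtain K where K: "K \<subseteq> V" "i0 \<in> K" "j0 \<notin> K"
    "\<And>k l. k \<in> K \<Longrightarrow> l \<in> V - K \<Longrightarrow> adj k l \<Longrightarrow> k = i0 \<and> l = j0"
    using tree_edge_is_bridge[OF tree sym min(1,2,3)] min(3) unfolding adj_def by blast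
  have ij: "i0 \<noteq> j0" using min(3) by (simp add: adj_def)
  obtain a where a: "a \<in> G i0" "a \<notin> G j0" using anti[OF min(1,2) ij] by blast
  obtain b where b: "b \<in> G j0" "b \<notin> G i0" using anti[OF min(2,1)] ij by blast
  have "depth mpoly_ring max_ideal (ideal_as_module mpoly_ring I) \<le> enat (q + 2)"
  proof (rule depth_le[OF cl])
    fix f :: "nat \<Rightarrow> ('n, 'k) mpoly" and d
    assume f: "\<And>i. i < d \<Longrightarrow> f i \<in> var_ideal UNIV" "regular_on I f d"
    have "d \<le> card (G i0 \<inter> G j0) + 2"
    proof (rule regular_length_le_separation)
      show "G i \<inter> G j \<subseteq> G i0 \<inter> G j0" if "i \<in> K" "j \<in> V - K" for i j
        using K(4)[OF that] that unfolding adj_def by blast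
      show "regular_on (facet_ideal G V) f d" using f(2) by (simp add: I_def)
    qed (use K(1-3) a b min(2) f(1) in auto)
    then show "d \<le> q + 2" by (simp add: min(4))
  qed
  moreover have "enat (q + 2) \<le> depth mpoly_ring max_ideal (ideal_as_module mpoly_ring I)"
  proof -
    have "\<exists>f :: nat \<Rightarrow> ('n, 'k) mpoly. (\<forall>i<q + 2. f i \<in> var_ideal UNIV) \<and> regular_on (facet_ideal G V) f (q + 2)"
    proof (rule tree_regular_sequence[OF tree sym V(2), of G q])
      show "adj i j \<longleftrightarrow> i \<noteq> j \<and> G i \<inter> G j \<noteq> {}" for i j by (simp add: adj_def)
      show "q \<le> card (G i \<inter> G j)" if "i \<in> V" "j \<in> V" "i \<noteq> j" "G i \<inter> G j \<noteq> {}" for i j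
        using big[of i j] that by (simp add: adj_def)
      show "\<not> G i \<subseteq> G j" if "i \<in> V" "j \<in> V" "i \<noteq> j" for i j by (rule anti[OF that])
      show "G a \<inter> G b \<inter> G c = {}"
        if "a \<in> V" "b \<in> V" "c \<in> V" "a \<noteq> b" "a \<noteq> c" "b \<noteq> c" for a b c by (rule triple[OF that])
    qed blast
    then obtain f :: "nat \<Rightarrow> ('n, 'k) mpoly" where
      f: "\<And>i. i < q + 2 \<Longrightarrow> f i \<in> var_ideal UNIV" "regular_on (facet_ideal G V) f (q + 2)" by blast
    have "G i \<noteq> UNIV" if i: "i \<in> V" for i
    proof -
      obtain j where "j \<in> V" "j \<noteq> i" using min(1,2) ij by metis
      then show ?thesis using anti[of j i] i by auto
    qed
    then have "(\<Sum>v\<in>UNIV. single v 1) \<in> nonfaces G V"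
    proof -
      have "lookup (\<Sum>v\<in>UNIV. single v (1::nat)) w = (\<Sum>v\<in>UNIV. if w = v then 1 else 0)" for w :: 'n
        by (auto simp: lookup_sum lookup_single when_def intro!: sum.cong)
      then have "keys (\<Sum>v\<in>(UNIV :: 'n set). single v (1::nat)) = UNIV" by (auto simp: in_keys_iff)
      then show ?thesis using \<open>\<And>i. i \<in> V \<Longrightarrow> G i \<noteq> UNIV\<close> by (auto simp: nonfaces_def)
    qed
    then have "seq_mult f (q + 2) I \<noteq> I"
      unfolding I_def facet_ideal_def using f(1) by (intro seq_mult_mon_ideal_neq up_closed_nonfaces) auto
    then show ?thesis using f by (intro depth_ge[OF cl]) (auto simp: I_def)
  qed
  ultimately show "depth mpoly_ring max_ideal (ideal_as_module mpoly_ring I) = enat (q + 2)" by (rule antisym)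
next
  have cl: "closed_ideal I" by (simp add: I_def)
  have sym: "symp adj" by (auto simp: symp_def adj_def)
  assume depth: "depth mpoly_ring max_ideal (ideal_as_module mpoly_ring I) = enat (q + 2)"
  show "tree_on adj V"
  proof (rule ccontr)
    assume nt: "\<not> tree_on adj V"
    have "V \<noteq> {}" using min(1) by blast
    have "depth mpoly_ring max_ideal (ideal_as_module mpoly_ring I) \<le> enat 3"
    proof (rule depth_le[OF cl])
      fix f :: "nat \<Rightarrow> ('n, 'k) mpoly" and d
      assume f: "\<And>i. i < d \<Longrightarrow> f i \<in> var_ideal UNIV" "regular_on I f d"
      from V(1) \<open>V \<noteq> {}\<close> sym nt show "d \<le> 3"
      proof (cases rule: not_tree_cases)
        case (disconnected K)
        then obtain k l where kl: "k \<in> K" "l \<in> V - K" by blast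
        then have kl': "k \<in> V" "l \<in> V" "k \<noteq> l" using disconnected by auto
        obtain a where a: "a \<in> G k" using anti[OF kl'] by blast
        obtain b where b: "b \<in> G l" using anti[OF kl'(2,1)] kl'(3) by blast
        have "d \<le> card ({} :: 'n set) + 2"
        proof (rule regular_length_le_separation[OF disconnected(1) kl])
          show "G i \<inter> G j \<subseteq> {}" if "i \<in> K" "j \<in> V - K" for i j
            using disconnected(4)[OF that] that by (auto simp: adj_def)
          show "regular_on (facet_ideal G V) f d" using f(2) by (simp add: I_def)
        qed (use a b f(1) in auto)
        then show ?thesis by simp
      next
        case (cycle i j k)
        have path: "(i, k) \<in> {(a, b). a \<in> V - {j} \<and> b \<in> V - {j} \<and> G a \<inter> G b \<noteq> {}}\<^sup>*"
          by (rule subsetD[OF rtrancl_mono cycle(9)]) (auto simp: adj_def)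
        show ?thesis
        proof (rule regular_length_le_cycle[OF cycle(1-4,7,8) _ _ _ path])
          show "G i \<inter> G j \<noteq> {}" "G k \<inter> G j \<noteq> {}" using cycle(5,6) by (auto simp: adj_def)
          show "regular_on (facet_ideal G V) f d" using f(2) by (simp add: I_def)
        qed (fact triple f(1))+
      qed
    qed
    then show False using depth q by simp
  qed
qed

theorem corollary2p8:
  fixes I :: "('n::finite, 'k::field) mpoly set"
    and P :: "nat \<Rightarrow> ('n, 'k) mpoly set"
    and s :: nat
  assumes "squarefree_monomial_ideal I"
    and "bij_betw P {1..s} (minimal_primes mpoly_ring I)"
    and "I = (\<Inter>i\<in>{1..s}. P i)"
    and "ideal_sum mpoly_ring (P ` {1..s}) = max_ideal"
    and "bigsize I = 2"
    and "q_inv I > 1"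
  shows "(depth mpoly_ring max_ideal (ideal_as_module mpoly_ring I) = 2 + q_inv I \<and> 2 + q_inv I > 3)
     \<longleftrightarrow> concat_of_edgeless (assoc_graph P s)"
proof -
  let ?V = "{1..s}"
  have inj: "inj_on P ?V" and P_img: "P ` ?V = minimal_primes mpoly_ring I"
    using assms(2) by (auto simp: bij_betw_def)
  have "\<forall>i\<in>?V. \<exists>F. P i = var_ideal F"
    using minimal_prime_is_var_ideal[OF assms(1)] P_img by blast
  then obtain F where F: "\<And>i. i \<in> ?V \<Longrightarrow> P i = var_ideal (F i)" by metis
  define G where "G i = - F i" for i
  have P: "P i = var_ideal (- G i)" if "i \<in> ?V" for i using F that by (simp add: G_def)
  define adj where "adj i j \<longleftrightarrow> i \<noteq> j \<and> G i \<inter> G j \<noteq> {}" for i j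
  have I: "I = facet_ideal G ?V" unfolding assms(3) facet_ideal_eq_INT using P by simp
  have sum_eq: "P i <+>\<^bsub>mpoly_ring\<^esub> P j = var_ideal (- (G i \<inter> G j))" if "i \<in> ?V" "j \<in> ?V" for i j
    using that by (simp add: P set_add_eq sum_set_var_ideal)
  have sum_max: "P i <+>\<^bsub>mpoly_ring\<^esub> P j = max_ideal \<longleftrightarrow> G i \<inter> G j = {}" if "i \<in> ?V" "j \<in> ?V" for i j
    unfolding sum_eq[OF that] max_ideal_eq_iff by blast
  have sums: "ideal_sum mpoly_ring (P ` A) = max_ideal \<longleftrightarrow> (\<Inter>i\<in>A. G i) = {}" if "A \<subseteq> ?V" for A
  proof -
    have "P ` A = var_ideal ` (\<lambda>i. - G i) ` A"
      unfolding image_image using P that by (intro image_cong) auto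
    then have "ideal_sum mpoly_ring (P ` A) = var_ideal (\<Union>i\<in>A. - G i)"
      by (simp only: ideal_sum_var_ideals)
    also have "(\<Union>i\<in>A. - G i) = - (\<Inter>i\<in>A. G i)" by simp
    finally have "ideal_sum mpoly_ring (P ` A) = var_ideal (- (\<Inter>i\<in>A. G i))" .
    then show ?thesis by (simp only: max_ideal_eq_iff) (metis Compl_empty_eq double_compl)
  qed
  have anti: "\<not> G i \<subseteq> G j" if ij: "i \<in> ?V" "j \<in> ?V" "i \<noteq> j" for i j
  proof
    assume "G i \<subseteq> G j"
    then have sub: "P j \<subseteq> P i" using ij by (simp add: P var_ideal_mono)
    have Pi: "P i \<in> minimal_primes mpoly_ring I" and Pj: "P j \<in> minimal_primes mpoly_ring I"
      unfolding P_img[symmetric] using ij by simp_all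
    have "primeideal (P j) mpoly_ring \<and> I \<subseteq> P j" using Pj by (simp add: minimal_primes_def)
    then have "P j = P i" using Pi sub by (simp add: minimal_primes_def)
    then show False using inj_onD[OF inj, of j i] ij by blast
  qed
  have fin: "finite (minimal_primes mpoly_ring I)" unfolding P_img[symmetric] by simp
  note bigsize = bigsize_eq_2D[OF fin assms(4)[unfolded P_img] assms(5), folded P_img]
  have triple: "G a \<inter> G b \<inter> G c = {}"
    if abc: "a \<in> ?V" "b \<in> ?V" "c \<in> ?V" "a \<noteq> b" "a \<noteq> c" "b \<noteq> c" for a b c
  proof -
    have "card (P ` {a, b, c}) = card {a, b, c}"
      using abc by (intro card_image inj_on_subset[OF inj]) auto
    then have "card (P ` {a, b, c}) = 3" using abc by simp
    then have "ideal_sum mpoly_ring (P ` {a, b, c}) = max_ideal"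
      using abc by (intro bigsize(1)) auto
    then show ?thesis using sums[of "{a, b, c}"] abc by auto
  qed
  define D where "D = {card (G i \<inter> G j) | i j. i \<in> ?V \<and> j \<in> ?V \<and> adj i j}"
  have q_inv: "q_inv I = Inf (enat ` D)"
  proof -
    have "{krull_dim (mpoly_ring Quot (P' <+>\<^bsub>mpoly_ring\<^esub> Q)) | P' Q.
        P' \<in> P ` ?V \<and> Q \<in> P ` ?V \<and> P' \<noteq> Q \<and> P' <+>\<^bsub>mpoly_ring\<^esub> Q \<noteq> max_ideal}
      = {krull_dim (mpoly_ring Quot (P i <+>\<^bsub>mpoly_ring\<^esub> P j)) | i j. i \<in> ?V \<and> j \<in> ?V \<and> adj i j}"
    proof -
      have eq: "adj i j \<longleftrightarrow> P i \<noteq> P j \<and> P i <+>\<^bsub>mpoly_ring\<^esub> P j \<noteq> max_ideal"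
        if "i \<in> ?V" "j \<in> ?V" for i j
        unfolding adj_def using sum_max[OF that] inj_on_eq_iff[OF inj that] by blast
      show ?thesis (is "?L = ?R")
      proof (intro Set.equalityI subsetI)
        fix d assume "d \<in> ?L"
        then obtain i j where "d = krull_dim (mpoly_ring Quot (P i <+>\<^bsub>mpoly_ring\<^esub> P j))" "i \<in> ?V" "j \<in> ?V"
          "P i \<noteq> P j" "P i <+>\<^bsub>mpoly_ring\<^esub> P j \<noteq> max_ideal" by blast
        then show "d \<in> ?R" using eq[of i j] by blast
      next
        fix d assume "d \<in> ?R"
        then obtain i j where "d = krull_dim (mpoly_ring Quot (P i <+>\<^bsub>mpoly_ring\<^esub> P j))" "i \<in> ?V" "j \<in> ?V" "adj i j"
          by blast
        moreover from this have "P i \<in> P ` ?V" "P j \<in> P ` ?V" by simp_all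
        ultimately show "d \<in> ?L" using eq[of i j] by blast
      qed
    qed
    also have "\<dots> = {enat (card (G i \<inter> G j)) | i j. i \<in> ?V \<and> j \<in> ?V \<and> adj i j}"
    proof -
      have "krull_dim (mpoly_ring Quot (P i <+>\<^bsub>mpoly_ring\<^esub> P j)) = enat (card (G i \<inter> G j))"
        if "i \<in> ?V" "j \<in> ?V" for i j
        unfolding sum_eq[OF that] krull_dim_Quot_var_ideal by simp
      then show ?thesis by (intro Collect_cong iff_exI) auto
    qed
    also have "\<dots> = enat ` D" unfolding D_def by blast
    finally show ?thesis unfolding q_inv_def P_img by simp
  qed
  obtain A where A: "A \<subseteq> ?V" "card A = 2" "(\<Inter>i\<in>A. G i) \<noteq> {}"
  proof -
    obtain \<A> where \<A>: "\<A> \<subseteq> P ` ?V" "card \<A> = 2" "ideal_sum mpoly_ring \<A> \<noteq> max_ideal" using bigsize(2) by blast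
    then obtain A where A: "A \<subseteq> ?V" "\<A> = P ` A" by (auto simp: subset_image_iff)
    have "card A = 2" using \<A>(2) A card_image[OF inj_on_subset[OF inj A(1)]] by simp
    then show thesis using that A \<A>(3) sums[OF A(1)] by simp
  qed
  then obtain i1 j1 where ij1: "A = {i1, j1}" "i1 \<noteq> j1" by (auto simp: card_2_iff)
  have V2: "2 \<le> card ?V" using A card_mono[OF _ A(1)] by simp
  have "card (G i1 \<inter> G j1) \<in> D" unfolding D_def adj_def using A ij1 by auto
  then have D: "D \<noteq> {}" by blast
  define q where "q = (LEAST d. d \<in> D)"
  have qD: "q \<in> D" unfolding q_def using D by (metis LeastI ex_in_conv)
  have q_le: "q \<le> d" if "d \<in> D" for d unfolding q_def using that by (rule Least_le)
  have q_eq: "q_inv I = enat q"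
    unfolding q_inv
  proof (rule antisym)
    show "Inf (enat ` D) \<le> enat q" using qD by (intro Inf_lower) simp
    show "enat q \<le> Inf (enat ` D)" using q_le by (intro Inf_greatest) auto
  qed
  have q2: "2 \<le> q" using assms(6) unfolding q_eq by (simp add: one_enat_def)
  obtain i0 j0 where ij0: "i0 \<in> ?V" "j0 \<in> ?V" "adj i0 j0" "card (G i0 \<inter> G j0) = q" using qD unfolding D_def by blast
  have big: "q \<le> card (G i \<inter> G j)" if "i \<in> ?V" "j \<in> ?V" "adj i j" for i j
    using q_le that unfolding D_def by blast
  have adj_eq: "adj = (\<lambda>i j. i \<noteq> j \<and> G i \<inter> G j \<noteq> {})" unfolding adj_def ..
  have depth: "depth mpoly_ring max_ideal (ideal_as_module mpoly_ring I) = enat (q + 2) \<longleftrightarrow> tree_on adj ?V"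
    unfolding I adj_eq
    by (rule depth_facet_ideal_iff_tree[OF _ V2 anti triple _ ij0(1,2) _ ij0(4) q2])
      (use big ij0(3) in \<open>simp_all add: adj_def\<close>)
  have graph: "assoc_graph P s = (?V, non_edges adj ?V)"
    unfolding assoc_graph_def non_edges_def adj_def
    by (intro arg_cong2[where f = Pair] refl Collect_cong iff_exI) (use sum_max in auto)
  have sym: "symp adj" by (auto simp: symp_def adj_def)
  have "tree_on adj ?V \<longleftrightarrow> concat_of_edgeless (?V, non_edges adj ?V)"
  proof
    assume "tree_on adj ?V"
    then show "concat_of_edgeless (?V, non_edges adj ?V)"
      using tree_imp_concat_of_edgeless[OF _ sym V2] unfolding tree_on_def by blast
  next
    assume "concat_of_edgeless (?V, non_edges adj ?V)"
    then have "tree_on (co_adj (?V, non_edges adj ?V)) ?V" using concat_of_edgeless_imp_tree by fastforce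
    then show "tree_on adj ?V"
    proof (rule tree_on_cong)
      show "adj x y \<longleftrightarrow> co_adj (?V, non_edges adj ?V) x y" if "x \<in> ?V" "y \<in> ?V" for x y
        using that unfolding co_adj_def non_edges_def adj_def by (auto simp: doubleton_eq_iff)
    qed
  qed
  moreover have "2 + q_inv I = enat (q + 2)" "2 + q_inv I > 3"
    using q2 unfolding q_eq by (simp_all add: numeral_eq_enat add.commute)
  ultimately show ?thesis using depth graph by simp
qed

end
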